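(* Let $q>1$, $0<p\le q<\infty$, $\alpha>p-1$, and let $\mu$ be a positive Borel measure on $[0,1)$ satisfying condition $(W_{p,\alpha})$. Then $\mathcal{H}_{\mu,\alpha+1-p}$ is a compact operator from $\mathcal{D}^p_\alpha$ into $\mathcal{D}^q_{\alpha-p}$ if and only if $\mu$ is a vanishing $\left(\frac{\alpha+2-p}{p}+\frac{\alpha+2-p}{q'}\right)$-Carleson measure.
   Context: $\mathbb{D}$ is the open unit disc, $dA=\frac1\pi dx\,dy$. For $0<p<\infty$, $\alpha>-1$, $A^p_\alpha$ is the space of analytic $f$ on $\mathbb{D}$ with $\|f\|_{A^p_\alpha}=\left((\alpha+1)\int_{\mathbb{D}}|f|^p(1-|z|^2)^\alpha dA\right)^{1/p}<\infty$, and $\mathcal{D}^p_\alpha$ consists of analytic $f$ with $f'\in A^p_\alpha$, normed by $|f(0)|+\|f'\|_{A^p_\alpha}$. $1/q+1/q'=1$. For a positive Borel measure $\mu$ on $[0,1)$ and $\beta>0$, $\mu_{n,k,\beta}=\frac{\Gamma(n+\beta)}{n!\Gamma(\beta)}\int_{[0,1)}t^{n+k}d\mu(t)$ and for $f(z)=\sum_k a_kz^k$ analytic, $\mathcal{H}_{\mu,\beta}(f)(z)=\sum_n\left(\sum_k\mu_{n,k,\beta}a_k\right)z^n$. Compactness from $X$ into $Y$ means $\mathcal{H}_{\mu,\beta}$ maps $X$ into $Y$ and takes bounded sets to relatively compact sets. For $s>0$, $\mu$ is an $s$-Carleson measure if $\mu([t,1))\le C(1-t)^s$ for $0\le t<1$,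 and a vanishing $s$-Carleson measure if $\mu([t,1))=o((1-t)^s)$ as $t\to1^-$. Condition $(W_{p,\alpha})$: if $0<p\le1$, $\mu$ is a $\frac{\alpha+2}{p}$-Carleson measure; if $1\le p\le 2$, $\mu$ is a $\frac{\alpha+2-(p-1)^2}{p}$-Carleson measure; if $2\le p<\infty$, $\mu$ is a $\frac{\alpha+1}{p}$-Carleson measure. *)

theory Defs
  imports "HOL-Analysis.Analysis"
begin

text \<open>Weighted Bergman integral with dA = (1/pi) dx dy on the unit disc.\<close>
definition bergman_int :: "real \<Rightarrow> real \<Rightarrow> (complex \<Rightarrow> complex) \<Rightarrow> ennreal" where
  "bergman_int p \<alpha> f =
     (\<integral>\<^sup>+ z. indicator (ball 0 1) z *
        ennreal (norm (f z) powr p * (1 - norm z ^ 2) powr \<alpha> / pi) \<partial>lborel)"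

definition in_bergman :: "real \<Rightarrow> real \<Rightarrow> (complex \<Rightarrow> complex) \<Rightarrow> bool" where
  "in_bergman p \<alpha> f \<longleftrightarrow> f holomorphic_on ball 0 1 \<and> bergman_int p \<alpha> f < \<infinity>"

definition bergman_norm :: "real \<Rightarrow> real \<Rightarrow> (complex \<Rightarrow> complex) \<Rightarrow> real" where
  "bergman_norm p \<alpha> f = ((\<alpha> + 1) * enn2real (bergman_int p \<alpha> f)) powr (1 / p)"

definition in_dirichlet :: "real \<Rightarrow> real \<Rightarrow> (complex \<Rightarrow> complex) \<Rightarrow> bool" where
  "in_dirichlet p \<alpha> f \<longleftrightarrow> f holomorphic_on ball 0 1 \<and> in_bergman p \<alpha> (deriv f)"

definition dirichlet_norm :: "real \<Rightarrow> real \<Rightarrow> (complex \<Rightarrow> complex) \<Rightarrow> real" where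
  "dirichlet_norm p \<alpha> f = norm (f 0) + bergman_norm p \<alpha> (deriv f)"

definition taylor_coeff :: "(complex \<Rightarrow> complex) \<Rightarrow> nat \<Rightarrow> complex" where
  "taylor_coeff f k = (deriv ^^ k) f 0 / of_nat (fact k)"

definition mu_coef :: "real measure \<Rightarrow> real \<Rightarrow> nat \<Rightarrow> nat \<Rightarrow> real" where
  "mu_coef \<mu> \<beta> n k = Gamma (real n + \<beta>) / (fact n * Gamma \<beta>) * (\<integral>t. t ^ (n + k) \<partial>\<mu>)"

definition H_coeff :: "real measure \<Rightarrow> real \<Rightarrow> (complex \<Rightarrow> complex) \<Rightarrow> nat \<Rightarrow> complex" where
  "H_coeff \<mu> \<beta> f n = (\<Sum>k. of_real (mu_coef \<mu> \<beta> n k) * taylor_coeff f k)"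

definition H_defined :: "real measure \<Rightarrow> real \<Rightarrow> (complex \<Rightarrow> complex) \<Rightarrow> bool" where
  "H_defined \<mu> \<beta> f \<longleftrightarrow>
     (\<forall>n. summable (\<lambda>k. of_real (mu_coef \<mu> \<beta> n k) * taylor_coeff f k)) \<and>
     (\<forall>z\<in>ball 0 1. summable (\<lambda>n. H_coeff \<mu> \<beta> f n * z ^ n))"

definition Hankel :: "real measure \<Rightarrow> real \<Rightarrow> (complex \<Rightarrow> complex) \<Rightarrow> complex \<Rightarrow> complex" where
  "Hankel \<mu> \<beta> f z = (\<Sum>n. H_coeff \<mu> \<beta> f n * z ^ n)"

text \<open>Compactness of H from D^p_a into D^q_b: H maps D^p_a into D^q_b, and bounded sets
  are mapped to relatively compact sets (sequential formulation, Y complete metric).\<close>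
definition Hankel_compact ::
  "real measure \<Rightarrow> real \<Rightarrow> real \<Rightarrow> real \<Rightarrow> real \<Rightarrow> real \<Rightarrow> bool" where
  "Hankel_compact \<mu> \<beta> p a q b \<longleftrightarrow>
     (\<forall>f. in_dirichlet p a f \<longrightarrow> H_defined \<mu> \<beta> f \<and> in_dirichlet q b (Hankel \<mu> \<beta> f)) \<and>
     (\<forall>F :: nat \<Rightarrow> complex \<Rightarrow> complex. \<forall>M.
        (\<forall>j. in_dirichlet p a (F j) \<and> dirichlet_norm p a (F j) \<le> M) \<longrightarrow>
        (\<exists>r g. strict_mono r \<and> in_dirichlet q b g \<and>
           (\<lambda>j. dirichlet_norm q b (\<lambda>z. Hankel \<mu> \<beta> (F (r j)) z - g z)) \<longlonglongrightarrow> 0))"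

definition measure_on_01 :: "real measure \<Rightarrow> bool" where
  "measure_on_01 \<mu> \<longleftrightarrow> sets \<mu> = sets borel \<and> emeasure \<mu> (UNIV - {0..<1}) = 0"

definition carleson :: "real measure \<Rightarrow> real \<Rightarrow> bool" where
  "carleson \<mu> s \<longleftrightarrow> (\<exists>C. \<forall>t. 0 \<le> t \<and> t < 1 \<longrightarrow> emeasure \<mu> {t..<1} \<le> ennreal (C * (1 - t) powr s))"

definition vanishing_carleson :: "real measure \<Rightarrow> real \<Rightarrow> bool" where
  "vanishing_carleson \<mu> s \<longleftrightarrow>
     (\<forall>\<epsilon>>0. \<exists>\<delta>>0. \<forall>t. 1 - \<delta> < t \<and> t < 1 \<longrightarrow> emeasure \<mu> {t..<1} \<le> ennreal (\<epsilon> * (1 - t) powr s))"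

definition cond_W :: "real measure \<Rightarrow> real \<Rightarrow> real \<Rightarrow> bool" where
  "cond_W \<mu> p \<alpha> \<longleftrightarrow>
     (p \<le> 1 \<longrightarrow> carleson \<mu> ((\<alpha> + 2) / p)) \<and>
     (1 \<le> p \<and> p \<le> 2 \<longrightarrow> carleson \<mu> ((\<alpha> + 2 - (p - 1)^2) / p)) \<and>
     (2 \<le> p \<longrightarrow> carleson \<mu> ((\<alpha> + 1) / p))"

end

theory Submission
  imports Defs "HOL-Complex_Analysis.Complex_Analysis"
begin

text \<open>
  Write \<open>N = \<alpha> + 2 - p\<close>. For \<open>f\<close> in the source space the derivative of the image is, up to a
  constant, the integral of \<open>t f(t) (1 - t z) powr (- N)\<close> against \<open>\<mu>\<close>, and \<open>\<bar>1 - t z\<bar>\<close> is comparable to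
  the maximum of \<open>1 - t\<close> and \<open>\<bar>1 - z\<bar>\<close>. Decomposing both \<open>[0,1)\<close> and the disc dyadically around the
  point 1 therefore turns the operator into convolution with a geometrically decaying kernel, acting on
  \<open>l\<^sup>q\<close>. The suprema of \<open>f\<close> over the dyadic blocks are controlled by the
  sub-mean-value property of \<open>\<bar>f'\<bar> powr p\<close>, and \<open>l\<^sup>p\<close> embeds in \<open>l\<^sup>q\<close> since \<open>p \<le> q\<close>. This shows
  boundedness under the Carleson condition; under the vanishing condition the tail of the convolution is
  small, and the finitely many remaining blocks are handled by Montel's theorem.

  Conversely, the functions \<open>f\<^sub>a(z) = (1 - a) (1 - a z) powr (- N / p - 1)\<close> are bounded in the source
  space. Evaluating the derivative of the image of \<open>f\<^sub>a\<close> at the point \<open>a\<close> itself bounds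
  \<open>(1 - a) powr (- s) * \<mu>([a,1))\<close> from above, \<open>s\<close> being the Carleson exponent; along a convergent
  subsequence of the images these weighted point values tend to zero, because they do so for every fixed
  function of the target space.
\<close>

subsection \<open>Area integrals of holomorphic functions\<close>

text \<open>Everything rests on one exponent count. Put \<open>b = \<alpha> + 1 - p\<close>, so N =
  b + 1, and 1/q' = 1 - 1/q. On the i-th block of the radius a function of the source space is at
  most x_i 2^(i N/p) with x in l^q, and under the Carleson condition the block has mass at most a
  constant times 2^(-i s) with s = N/p + N/q'; what remains is 2^(-i N/q'). For z in the k-th
  annulus about 1 the kernel is at most of order 2^(N min(i,k)), and the weighted area of that
  annulus, at most of order 2^(-k N), contributes 2^(-k N/q) to the l^q norm. The exponent N
  min(i,k) - i N/q' - k N/q equals -(N/q)(k - i) for i \<le> k and -(N/q')(i - k) for i \<ge> k: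
  decay on both sides, because 1 < q < \<infinity>.

  Two obstacles shape the rest. The exponent p may lie below 1, so convexity arguments give way to
  sub-mean-value properties and threshold inequalities. And the operator is defined by coefficient
  series, so its integral formula requires absolute convergence first; growth of Taylor coefficients
  and decay of moments are estimated for that purpose.\<close>

lemma measurable_Complex [measurable]:
  assumes [measurable]: "f \<in> borel_measurable M" "g \<in> borel_measurable M"
  shows "(\<lambda>x. Complex (f x) (g x)) \<in> borel_measurable M"
  unfolding Complex_eq by measurable

text \<open>Lebesgue measure is determined by its values on boxes, and a box in the plane is the
  product of its projections. Iterated integrals in \<open>Re\<close> and \<open>Im\<close> become
  available this way.\<close>

lemma lborel_complex: "(lborel :: complex measure) = distr (lborel \<Otimes>\<^sub>M lborel) borel (\<lambda>(x, y). Complex x y)"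
proof (rule lborel_eqI)
  have [measurable]: "(\<lambda>(x, y). Complex x y) \<in> borel_measurable (lborel \<Otimes>\<^sub>M lborel)"
    by (simp add: split_beta') measurable
  fix l u :: complex
  assume le: "\<And>b. b \<in> Basis \<Longrightarrow> l \<bullet> b \<le> u \<bullet> b"
  have "emeasure (distr (lborel \<Otimes>\<^sub>M lborel) borel (\<lambda>(x, y). Complex x y)) (box l u)
      = emeasure (lborel \<Otimes>\<^sub>M lborel) ({Re l<..<Re u} \<times> {Im l<..<Im u})"
    by (subst emeasure_distr)
       (auto intro!: arg_cong[where f="emeasure _"] simp: box_def Basis_complex_def space_pair_measure)
  also have "\<dots> = ennreal (Re u - Re l) * ennreal (Im u - Im l)"
    using le[of 1] le[of \<i>] by (subst lborel.emeasure_pair_measure_Times) (auto simp: Basis_complex_def)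
  also have "\<dots> = (\<Prod>b\<in>Basis. (u - l) \<bullet> b)"
    using le[of 1] le[of \<i>] by (simp add: Basis_complex_def ennreal_mult)
  finally show "emeasure (distr (lborel \<Otimes>\<^sub>M lborel) borel (\<lambda>(x, y). Complex x y)) (box l u)
      = (\<Prod>b\<in>Basis. (u - l) \<bullet> b)" .
qed simp

lemma nn_integral_complex:
  assumes [measurable]: "f \<in> borel_measurable borel"
  shows "(\<integral>\<^sup>+z. f z \<partial>lborel) = (\<integral>\<^sup>+y. \<integral>\<^sup>+x. f (Complex x y) \<partial>lborel \<partial>lborel)"
    and "(\<integral>\<^sup>+z. f z \<partial>lborel) = (\<integral>\<^sup>+x. \<integral>\<^sup>+y. f (Complex x y) \<partial>lborel \<partial>lborel)"
proof -
  have [measurable]: "(\<lambda>p. f (case p of (x, y) \<Rightarrow> Complex x y)) \<in> borel_measurable (lborel \<Otimes>\<^sub>M lborel)"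
    by (simp add: split_beta') measurable
  have "(\<integral>\<^sup>+z. f z \<partial>lborel) = (\<integral>\<^sup>+p. f (case p of (x, y) \<Rightarrow> Complex x y) \<partial>(lborel \<Otimes>\<^sub>M lborel))"
    by (subst lborel_complex, subst nn_integral_distr) (auto simp: split_beta')
  then show "(\<integral>\<^sup>+z. f z \<partial>lborel) = (\<integral>\<^sup>+x. \<integral>\<^sup>+y. f (Complex x y) \<partial>lborel \<partial>lborel)"
    by (simp add: lborel.nn_integral_fst[symmetric] split_beta')
  also have "\<dots> = (\<integral>\<^sup>+y. \<integral>\<^sup>+x. f (Complex x y) \<partial>lborel \<partial>lborel)"
    by (rule lborel_pair.Fubini'[symmetric]) (simp only: split_beta', measurable)
  finally show "(\<integral>\<^sup>+z. f z \<partial>lborel) = (\<integral>\<^sup>+y. \<integral>\<^sup>+x. f (Complex x y) \<partial>lborel \<partial>lborel)" .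
qed

text \<open>If the sheared coordinate is integrated first, the other one is frozen and the shear is
  a mere translation. This is why \<open>nn_integral_complex\<close> keeps both orders of
  integration.\<close>

lemma nn_integral_shear:
  fixes f :: "complex \<Rightarrow> ennreal" and a :: real
  assumes [measurable]: "f \<in> borel_measurable borel"
  shows nn_integral_shear_Re: "(\<integral>\<^sup>+z. f (Complex (Re z + a * Im z) (Im z)) \<partial>lborel) = (\<integral>\<^sup>+z. f z \<partial>lborel)"
    and nn_integral_shear_Im: "(\<integral>\<^sup>+z. f (Complex (Re z) (Im z + a * Re z)) \<partial>lborel) = (\<integral>\<^sup>+z. f z \<partial>lborel)"
proof -
  have eq: "(\<integral>\<^sup>+x. g (x + t) \<partial>lborel) = (\<integral>\<^sup>+x. g x \<partial>lborel)"
    if [measurable]: "g \<in> borel_measurable borel" for g :: "real \<Rightarrow> ennreal" and t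
    using nn_integral_real_affine[of g 1 t] by (simp add: add.commute)
  show "(\<integral>\<^sup>+z. f (Complex (Re z + a * Im z) (Im z)) \<partial>lborel) = (\<integral>\<^sup>+z. f z \<partial>lborel)"
    by (simp add: nn_integral_complex(1) eq[where g="\<lambda>x. f (Complex x _)"])
  show "(\<integral>\<^sup>+z. f (Complex (Re z) (Im z + a * Re z)) \<partial>lborel) = (\<integral>\<^sup>+z. f z \<partial>lborel)"
    by (simp add: nn_integral_complex(2) eq[where g="\<lambda>y. f (Complex _ y)"])
qed

lemma nn_integral_rotate:
  fixes f :: "complex \<Rightarrow> ennreal"
  assumes meas: "f \<in> borel_measurable borel" and c: "norm c = 1"
  shows "(\<integral>\<^sup>+z. f (c * z) \<partial>lborel) = (\<integral>\<^sup>+z. f z \<partial>lborel)"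
proof -
  \<comment> \<open>A rotation by an angle other than \<open>\<pi>\<close> is a product of three shears.\<close>
  have *: "(\<integral>\<^sup>+z. f (c * z) \<partial>lborel) = (\<integral>\<^sup>+z. f z \<partial>lborel)"
    if [measurable]: "f \<in> borel_measurable borel" and c: "norm c = 1" "Re c \<noteq> -1"
    for c and f :: "complex \<Rightarrow> ennreal"
  proof -
    \<comment> \<open>For \<open>c\<close> = exp(i \<phi>) the shear parameters are - tan(\<phi>/2)
      and sin \<phi>; the half-angle tangent, written with \<open>1 + Re c\<close> in the
      denominator, is what breaks down at \<open>c = -1\<close>.\<close>
    define a where "a = - Im c / (1 + Re c)"
    define b where "b = Im c"
    have n: "(Re c)\<^sup>2 + (Im c)\<^sup>2 = 1"
      using c by (metis cmod_power2 one_power2)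
    have nz: "1 + Re c \<noteq> 0" using c by linarith
    have 1: "1 + a * b = Re c"
    proof -
      have "(1 + Re c) * (1 + a * b) = (1 + Re c) - (Im c)\<^sup>2"
        using nz by (simp add: a_def b_def field_simps power2_eq_square)
      also have "\<dots> = (1 + Re c) * Re c" using n by (simp add: algebra_simps power2_eq_square)
      finally show ?thesis using nz by simp
    qed
    have 2: "a + Re c * a = - Im c"
      proof -
      have "(1 + Re c) * a = - Im c" using nz by (simp add: a_def)
      then show ?thesis by (simp add: algebra_simps)
    qed
    define g1 where "g1 z = f (Complex (Re z + a * Im z) (Im z))" for z
    define g2 where "g2 z = g1 (Complex (Re z) (Im z + b * Re z))" for z
    define g3 where "g3 z = g2 (Complex (Re z + a * Im z) (Im z))" for z
    have [measurable]: "g1 \<in> borel_measurable borel" "g2 \<in> borel_measurable borel"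
      unfolding g1_def[abs_def] g2_def[abs_def] by measurable
    have "g3 z = f (c * z)" for z
    proof -
      have e1: "Re z + a * Im z + a * (b * Re z + Re c * Im z) = Re c * Re z - Im c * Im z"
      proof -
        have "Re z + a * Im z + a * (b * Re z + Re c * Im z) = (1 + a * b) * Re z + (a + Re c * a) * Im z"
          by (simp add: algebra_simps)
        then show ?thesis by (simp add: 1 2)
      qed
      have e2: "Im z + b * (Re z + a * Im z) = b * Re z + (1 + a * b) * Im z"
        by (simp add: algebra_simps)
      show ?thesis
        unfolding g3_def g2_def g1_def
        by (rule arg_cong[where f=f]) (simp add: complex_eq_iff e2 1 e1, simp add: b_def)
    qed
    then have "(\<integral>\<^sup>+z. f (c * z) \<partial>lborel) = (\<integral>\<^sup>+z. g3 z \<partial>lborel)" by simp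
    also have "\<dots> = (\<integral>\<^sup>+z. g2 z \<partial>lborel)" unfolding g3_def by (rule nn_integral_shear_Re) measurable
    also have "\<dots> = (\<integral>\<^sup>+z. g1 z \<partial>lborel)" unfolding g2_def by (rule nn_integral_shear_Im) measurable
    also have "\<dots> = (\<integral>\<^sup>+z. f z \<partial>lborel)" unfolding g1_def by (rule nn_integral_shear_Re) measurable
    finally show ?thesis .
  qed
  show ?thesis
  proof (cases "Re c = -1")
    case False then show ?thesis using * meas c by blast
  next
    case True
    have n: "(Re c)\<^sup>2 + (Im c)\<^sup>2 = 1"
      using c by (metis cmod_power2 one_power2)
    \<comment> \<open>The rotation by \<pi> is two rotations by \<pi>/2, to which the shears
      apply.\<close>
    with True have "c = -1" by (simp add: complex_eq_iff)
    then have "(\<integral>\<^sup>+z. f (c * z) \<partial>lborel) = (\<integral>\<^sup>+z. f (\<i> * (\<i> * z)) \<partial>lborel)"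
      by (simp add: mult.assoc[symmetric])
    also have "\<dots> = (\<integral>\<^sup>+z. f (\<i> * z) \<partial>lborel)"
      by (rule *[where f="\<lambda>z. f (\<i> * z)"]) (use meas in \<open>auto intro!: measurable_compose[OF _ meas]\<close>)
    also have "\<dots> = (\<integral>\<^sup>+z. f z \<partial>lborel)"
      by (rule *[OF meas]) auto
    finally show ?thesis .
  qed
qed

section \<open>Mean value inequalities over discs and annuli\<close>

text \<open>Holomorphy on the ball says nothing about \<open>f\<close> outside, where it may fail to
  be measurable; measurability on the whole plane is obtained only after cutting off.\<close>

lemma holomorphic_cutoff_measurable:
  assumes "f holomorphic_on ball w R"
  shows "(\<lambda>z. indicator (ball w R) z *\<^sub>R f z) \<in> borel_measurable borel"
  by (intro borel_measurable_continuous_on_indicator holomorphic_on_imp_continuous_on assms) auto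

text \<open>Cauchy's formula for the \<open>m\<close>-th derivative on the unit circle, applied to
  the rescaled function sending \<zeta> to f(w + z \<zeta>), whose \<open>m\<close>-th derivative at
  0 carries the factor \<open>z ^ m\<close>.\<close>

lemma taylor_coeff_le_circle_mean:
  assumes hol: "f holomorphic_on ball w R" and z: "norm z < R"
  shows "ennreal (norm ((deriv ^^ m) f w / fact m) * norm z ^ m) \<le>
    (\<integral>\<^sup>+\<theta>. indicator {0..1} \<theta> * ennreal (norm (f (w + exp (2 * pi * \<theta> * \<i>) * z))) \<partial>lborel)"
proof -
  define h where "h \<zeta> = f (z * \<zeta> + w)" for \<zeta>
  \<comment> \<open>A radius \<open>R'\<close> beyond 1 makes \<open>h\<close> holomorphic across
    the unit circle; for \<open>z = 0\<close> the quotient \<open>R / norm z\<close> is of no use,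
    and any such radius will do.\<close>
  obtain R' where R': "1 < R'" "norm z * R' < R"
  proof (cases "z = 0")
    case True then show ?thesis using z that[of 2] by auto
  next
    case False
    then show ?thesis using z that[of "(1 + R / norm z) / 2"] by (auto simp: field_simps)
  qed
  have sub: "z * \<zeta> + w \<in> ball w R" if "\<zeta> \<in> ball 0 R'" for \<zeta>
  proof -
    have "norm z * norm \<zeta> \<le> norm z * R'" using that by (intro mult_left_mono) auto
    then show ?thesis using R' by (simp add: dist_norm norm_mult)
  qed
  have holh: "h holomorphic_on ball 0 R'"
    unfolding h_def
    by (rule holomorphic_on_compose_gen[OF _ hol, unfolded o_def])
       (use sub in \<open>auto intro!: holomorphic_intros\<close>)
  have d: "(deriv ^^ m) h 0 = z ^ m * (deriv ^^ m) f w"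
    using higher_deriv_compose_linear'[OF hol, of "ball 0 R'" 0 z w m] sub R'
    unfolding h_def by auto
  have cont: "continuous_on (cball 0 1) h"
    by (rule continuous_on_subset[OF holomorphic_on_imp_continuous_on[OF holh]]) (use R' in auto)
  have hol1: "h holomorphic_on ball 0 1"
    by (rule holomorphic_on_subset[OF holh]) (use R' in auto)
  have "((\<lambda>u. h u / (u-0) ^ (Suc m)) has_contour_integral ((2 * pi * \<i>) / (fact m) * (deriv ^^ m) h 0)) (circlepath 0 1)"
    by (rule Cauchy_has_contour_integral_higher_derivative_circlepath[OF cont hol1]) auto
  then have I1: "((\<lambda>x::real. h (exp (2 * pi * \<i> * x)) / (exp (2 * pi * \<i> * x)) ^ Suc m * (2 * pi * \<i> * exp (2 * pi * \<i> * x)))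
      has_integral ((2 * pi * \<i>) / (fact m) * (deriv ^^ m) h 0)) {0..1}"
    unfolding has_contour_integral
    by (simp add: vector_derivative_circlepath, simp add: circlepath)
  define k where "k x = h (exp (2 * pi * \<i> * of_real x)) / (exp (2 * pi * \<i> * of_real x)) ^ m" for x :: real
  have I: "(k has_integral ((deriv ^^ m) h 0 / fact m)) {0..1}"
  proof -
    have "((\<lambda>x::real. 1 / (2 * pi * \<i>) * (h (exp (2 * pi * \<i> * x)) / (exp (2 * pi * \<i> * x)) ^ Suc m * (2 * pi * \<i> * exp (2 * pi * \<i> * x))))
      has_integral (1 / (2 * pi * \<i>) * ((2 * pi * \<i>) / (fact m) * (deriv ^^ m) h 0))) {0..1}"
      by (rule has_integral_mult_right[OF I1])
    then show ?thesis unfolding k_def by (simp add: field_simps)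
  qed
  have nexp: "norm (exp (2 * pi * \<i> * of_real x)) = 1" for x :: real
    by simp
  have contk: "continuous_on {0..1} k"
    unfolding k_def
    by (intro continuous_intros continuous_on_compose2[OF cont]) auto
  have int: "(\<lambda>x. norm (k x)) integrable_on {0..1}"
    by (intro integrable_continuous_interval continuous_intros contk)
  have le: "norm ((deriv ^^ m) h 0 / fact m) \<le> integral {0..1} (\<lambda>x. norm (k x))"
    using integral_norm_bound_integral[OF has_integral_integrable[OF I] int] integral_unique[OF I] by auto
  have int_eq: "(\<integral>\<^sup>+x. indicator {0..1} x * ennreal (norm (k x)) \<partial>lborel) = ennreal (integral {0..1} (\<lambda>x. norm (k x)))"
  proof -
    have "(\<integral>\<^sup>+x. ennreal (indicator {0..1} x * norm (k x)) \<partial>lborel) = ennreal (integral {0..1} (\<lambda>x. norm (k x)))"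
    proof (rule nn_integral_has_integral_lborel)
      have "(\<lambda>x. indicator {0..1} x *\<^sub>R norm (k x)) \<in> borel_measurable borel"
        by (intro borel_measurable_continuous_on_indicator continuous_intros contk) auto
      then show "(\<lambda>x. indicator {0..1} x * norm (k x)) \<in> borel_measurable borel" by simp
      have "((\<lambda>x. if x \<in> {0..1} then norm (k x) else 0) has_integral (integral {0..1} (\<lambda>x. norm (k x)))) UNIV"
        using int by (subst has_integral_restrict_UNIV) auto
      then show "((\<lambda>x. indicator {0..1} x * norm (k x)) has_integral (integral {0..1} (\<lambda>x. norm (k x)))) UNIV"
        by (rule has_integral_eq[rotated]) (auto simp: indicator_def)
    qed auto
    moreover have "(\<integral>\<^sup>+x. indicator {0..1} x * ennreal (norm (k x)) \<partial>lborel) =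
        (\<integral>\<^sup>+x. ennreal (indicator {0..1} x * norm (k x)) \<partial>lborel)"
      by (intro nn_integral_cong) (auto simp: indicator_def)
    ultimately show ?thesis by simp
  qed
  have norm_k: "norm (k x) = norm (f (w + exp (2 * pi * x * \<i>) * z))" for x
  proof -
    have "norm (k x) = norm (h (exp (2 * pi * \<i> * of_real x)))"
      unfolding k_def norm_divide norm_power nexp by simp
    then show ?thesis by (simp add: h_def mult_ac add_ac)
  qed
  have coeff: "norm ((deriv ^^ m) h 0 / fact m) = norm ((deriv ^^ m) f w / fact m) * norm z ^ m"
    by (simp add: d norm_mult norm_power norm_divide)
  show ?thesis
    unfolding coeff[symmetric] norm_k[symmetric] int_eq by (rule ennreal_leI[OF le])
qed

text \<open>The bound by circle means is integrated over all \<open>z\<close> with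
  \<open>norm z \<in> T\<close>. After exchanging the integrals, rotation invariance makes the inner
  area integral independent of the angle, so polar coordinates are avoided. A disc with
  \<open>m = 0\<close> gives the area mean value inequality, an annulus gives bounds on Taylor
  coefficients.\<close>

lemma taylor_coeff_le_radial_integral:
  assumes hol: "f holomorphic_on ball w R" and T [measurable]: "T \<in> sets borel" and TR: "T \<subseteq> {..<R}"
  shows "ennreal (norm ((deriv ^^ m) f w / fact m)) * (\<integral>\<^sup>+(z::complex). indicator T (norm z) * ennreal (norm z ^ m) \<partial>lborel)
     \<le> (\<integral>\<^sup>+(z::complex). indicator T (norm z) * ennreal (norm (f (w + z))) \<partial>lborel)"
proof -
  define F where "F z = indicator (ball w R) z *\<^sub>R f z" for z
  have F [measurable]: "F \<in> borel_measurable borel"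
    unfolding F_def by (rule holomorphic_cutoff_measurable[OF hol])
  let ?G = "\<lambda>\<theta> z. indicator {0..1::real} \<theta> * (indicator T (norm z) * ennreal (norm (F (w + exp (2 * pi * \<theta> * \<i>) * z))))"
  have Feq: "indicator T (norm z) * ennreal (norm (F (w + c * z))) = indicator T (norm z) * ennreal (norm (f (w + c * z)))"
    if "norm c = 1" for c z
    using TR that by (auto simp: F_def indicator_def dist_norm norm_mult)
  have "ennreal (norm ((deriv ^^ m) f w / fact m)) * (\<integral>\<^sup>+(z::complex). indicator T (norm z) * ennreal (norm z ^ m) \<partial>lborel)
      = (\<integral>\<^sup>+(z::complex). indicator T (norm z) * ennreal (norm ((deriv ^^ m) f w / fact m) * norm z ^ m) \<partial>lborel)"
    by (subst nn_integral_cmult[symmetric]) (auto simp: ennreal_mult' mult_ac intro!: nn_integral_cong)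
  also have "\<dots> \<le> (\<integral>\<^sup>+z. \<integral>\<^sup>+\<theta>. ?G \<theta> z \<partial>lborel \<partial>lborel)"
  proof (rule nn_integral_mono)
    fix z :: complex
    show "indicator T (norm z) * ennreal (norm ((deriv ^^ m) f w / fact m) * norm z ^ m) \<le> (\<integral>\<^sup>+\<theta>. ?G \<theta> z \<partial>lborel)"
    proof (cases "norm z \<in> T")
      case True
      then have z: "norm z < R" using TR by auto
      have "norm (F (w + exp (2 * pi * \<theta> * \<i>) * z)) = norm (f (w + exp (2 * pi * \<theta> * \<i>) * z))" for \<theta> :: real
        using z by (simp add: F_def dist_norm norm_mult)
      then show ?thesis using taylor_coeff_le_circle_mean[OF hol z, of m] True by simp
    qed simp
  qed
  also have "\<dots> = (\<integral>\<^sup>+\<theta>. \<integral>\<^sup>+z. ?G \<theta> z \<partial>lborel \<partial>lborel)"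
    by (rule lborel_pair.Fubini'[symmetric]) measurable
  also have "\<dots> = (\<integral>\<^sup>+\<theta>. indicator {0..1::real} \<theta> * (\<integral>\<^sup>+z. indicator T (norm z) * ennreal (norm (F (w + z))) \<partial>lborel) \<partial>lborel)"
  proof (rule nn_integral_cong)
    fix \<theta> :: real
    have n: "norm (exp (2 * pi * \<theta> * \<i>)) = 1" by simp
    have "(\<integral>\<^sup>+z. ?G \<theta> z \<partial>lborel) = indicator {0..1::real} \<theta> * (\<integral>\<^sup>+z. indicator T (norm z) * ennreal (norm (F (w + exp (2 * pi * \<theta> * \<i>) * z))) \<partial>lborel)"
      by (rule nn_integral_cmult) measurable
    also have "(\<integral>\<^sup>+z. indicator T (norm z) * ennreal (norm (F (w + exp (2 * pi * \<theta> * \<i>) * z))) \<partial>lborel)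
      = (\<integral>\<^sup>+z. indicator T (norm (exp (2 * pi * \<theta> * \<i>) * z)) * ennreal (norm (F (w + exp (2 * pi * \<theta> * \<i>) * z))) \<partial>lborel)"
      by (simp add: norm_mult)
    also have "\<dots> = (\<integral>\<^sup>+z. indicator T (norm z) * ennreal (norm (F (w + z))) \<partial>lborel)"
      by (rule nn_integral_rotate[OF _ n, where f="\<lambda>z. indicator T (norm z) * ennreal (norm (F (w + z)))"]) measurable
    finally show "(\<integral>\<^sup>+z. ?G \<theta> z \<partial>lborel) = indicator {0..1::real} \<theta> * (\<integral>\<^sup>+z. indicator T (norm z) * ennreal (norm (F (w + z))) \<partial>lborel)" .
  qed
  also have "\<dots> = (\<integral>\<^sup>+z. indicator T (norm z) * ennreal (norm (F (w + z))) \<partial>lborel)"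
    by (subst nn_integral_multc) auto
  also have "\<dots> = (\<integral>\<^sup>+z. indicator T (norm z) * ennreal (norm (f (w + z))) \<partial>lborel)"
    using Feq[of 1] by simp
  finally show ?thesis .
qed

lemma ball_measurable [measurable]: "ball (w :: 'a :: euclidean_space) r \<in> sets borel"
  by simp

lemma area_mean_value:
  assumes hol: "f holomorphic_on ball w r" and r: "r > 0"
  shows "ennreal (pi * r\<^sup>2 * norm (f w)) \<le> (\<integral>\<^sup>+z. indicator (ball w r) z * ennreal (norm (f z)) \<partial>lborel)"
proof -
  define F where "F z = indicator (ball w r) z *\<^sub>R f z" for z
  have F [measurable]: "F \<in> borel_measurable borel"
    unfolding F_def by (rule holomorphic_cutoff_measurable[OF hol])
  have "(\<integral>\<^sup>+(z::complex). indicator {..<r} (norm z) * ennreal (norm z ^ 0) \<partial>lborel) = emeasure lborel (ball (0::complex) r)"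
    by (subst nn_integral_indicator[symmetric]) (simp, intro nn_integral_cong, auto simp: indicator_def)
  also have "\<dots> = ennreal (pi * r\<^sup>2)"
    using r by (simp add: emeasure_ball unit_ball_vol_2)
  finally have "ennreal (norm (f w)) * ennreal (pi * r\<^sup>2) \<le>
      (\<integral>\<^sup>+(z::complex). indicator {..<r} (norm z) * ennreal (norm (f (w + z))) \<partial>lborel)"
    using taylor_coeff_le_radial_integral[OF hol, of "{..<r}" 0] by simp
  also have "\<dots> = (\<integral>\<^sup>+(z::complex). indicator (ball w r) (w + z) * ennreal (norm (F (w + z))) \<partial>lborel)"
    by (intro nn_integral_cong) (auto simp: indicator_def dist_norm F_def)
  also have "\<dots> = (\<integral>\<^sup>+z. indicator (ball w r) z * ennreal (norm (F z)) \<partial>distr lborel borel (\<lambda>z. w + z))"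
    by (subst nn_integral_distr) auto
  also have "\<dots> = (\<integral>\<^sup>+z. indicator (ball w r) z * ennreal (norm (f z)) \<partial>lborel)"
    by (subst lborel_distr_plus) (auto simp: indicator_def F_def intro!: nn_integral_cong)
  finally show ?thesis
    by (simp add: ennreal_mult'[symmetric] mult.commute)
qed

section \<open>Sub-mean-value inequality for arbitrary positive powers\<close>

text \<open>Stands in for Hoelder's inequality when a first power is replaced by a
  \<open>p\<close>-th power: above the threshold \<open>A\<close> the factor
  \<open>x powr (1 - p)\<close> is at most \<open>A powr (1 - p)\<close>. The parameter
  \<open>A\<close> stays free so that the two terms can be balanced later.\<close>

lemma le_add_powr:
  fixes A x p :: real
  assumes A: "A > 0" and p: "p \<ge> 1" and x: "x \<ge> 0"
  shows "x \<le> A + A powr (1 - p) * x powr p"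
proof (cases "x \<le> A")
  case False
  then have "x = x powr (1 - p) * x powr p" using A by (simp add: powr_add[symmetric])
  also have "\<dots> \<le> A powr (1 - p) * x powr p"
    using False A p by (intro mult_right_mono powr_mono2') auto
  finally show ?thesis using A by simp
next
  case True
  then show ?thesis by (rule order_trans) simp
qed

text \<open>Take \<open>A\<close> to be half of \<open>norm (f w)\<close> in the inequality above, so that the constant term is absorbed.\<close>
lemma submean_powr_ge_1:
  assumes hol: "f holomorphic_on ball w r" and r: "r > 0" and p: "p \<ge> 1"
  shows "ennreal (norm (f w) powr p * r\<^sup>2) \<le>
    ennreal (2 powr p) * (\<integral>\<^sup>+z. indicator (ball w r) z * ennreal (norm (f z) powr p) \<partial>lborel)"
proof (cases "f w = 0 \<or> (\<integral>\<^sup>+z. indicator (ball w r) z * ennreal (norm (f z) powr p) \<partial>lborel) = \<infinity>")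
  case True
  then show ?thesis by (auto simp: ennreal_mult_top)
next
  case False
  then obtain i where i: "i \<ge> 0" "(\<integral>\<^sup>+z. indicator (ball w r) z * ennreal (norm (f z) powr p) \<partial>lborel) = ennreal i"
    by (metis ennreal_cases infinity_ennreal_def)
  define A where "A = norm (f w) / 2"
  have A: "A > 0" using False by (simp add: A_def)
  define F where "F z = indicator (ball w r) z *\<^sub>R f z" for z
  have F [measurable]: "F \<in> borel_measurable borel"
    unfolding F_def by (rule holomorphic_cutoff_measurable[OF hol])
  have le: "x \<le> A + A powr (1 - p) * x powr p" if "x \<ge> 0" for x
    using le_add_powr[OF A p that] .
  have "ennreal (pi * r\<^sup>2 * norm (f w)) \<le> (\<integral>\<^sup>+z. indicator (ball w r) z * ennreal (norm (f z)) \<partial>lborel)"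
    by (rule area_mean_value[OF hol r])
  also have "\<dots> \<le> (\<integral>\<^sup>+z. ennreal A * indicator (ball w r) z + ennreal (A powr (1 - p)) * (indicator (ball w r) z * ennreal (norm (F z) powr p)) \<partial>lborel)"
    using le[of "norm (f _)"] A
    by (intro nn_integral_mono) (auto simp: indicator_def F_def ennreal_mult'[symmetric] ennreal_plus[symmetric] simp del: ennreal_plus)
  also have "\<dots> = ennreal A * emeasure lborel (ball w r) + ennreal (A powr (1 - p)) * (\<integral>\<^sup>+z. (indicator (ball w r) z * ennreal (norm (F z) powr p)) \<partial>lborel)"
    by (simp add: nn_integral_add nn_integral_cmult nn_integral_cmult_indicator)
  also have "(\<integral>\<^sup>+z. (indicator (ball w r) z * ennreal (norm (F z) powr p)) \<partial>lborel) = ennreal i"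
    unfolding i(2)[symmetric] by (auto intro!: nn_integral_cong simp: indicator_def F_def)
  also have "emeasure lborel (ball w r) = ennreal (pi * r\<^sup>2)"
    using r by (simp add: emeasure_ball unit_ball_vol_2)
  finally have "pi * r\<^sup>2 * norm (f w) \<le> A * (pi * r\<^sup>2) + A powr (1 - p) * i"
    using A i by (simp add: ennreal_mult'[symmetric] ennreal_plus[symmetric] del: ennreal_plus)
  then have "A * (pi * r\<^sup>2) \<le> A powr (1 - p) * i" by (simp add: A_def field_simps)
  then have "A powr (p - 1) * (A * (pi * r\<^sup>2)) \<le> A powr (p - 1) * (A powr (1 - p) * i)"
    by (intro mult_left_mono) auto
  then have "A powr p * (pi * r\<^sup>2) \<le> i"
    using A by (simp add: powr_diff field_simps)
  moreover have "A powr p * r\<^sup>2 \<le> A powr p * (pi * r\<^sup>2)"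
    using pi_ge_two by (intro mult_left_mono) (auto simp: mult_le_cancel_right1)
  ultimately have "A powr p * r\<^sup>2 \<le> i" by linarith
  then have "norm (f w) powr p * r\<^sup>2 \<le> 2 powr p * i"
    by (simp add: A_def powr_divide field_simps)
  then show ?thesis using i by (simp add: ennreal_mult'[symmetric])
qed

text \<open>The value at the centre is compared with a maximum point of \<open>norm (f z) powr p * (r - dist w z)\<^sup>2\<close>:
  around it \<open>norm (f z) powr p\<close> is at most four times its value there, which turns the mean value
  inequality for the first power into one for the power \<open>p\<close>.\<close>
lemma submean_powr_le_1:
  assumes hol: "f holomorphic_on ball w r" and cont: "continuous_on (cball w r) f"
    and r: "r > 0" and p: "0 < p" "p \<le> 1"
  shows "ennreal (norm (f w) powr p * r\<^sup>2) \<le>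
    ennreal (4 powr (1 / p)) * (\<integral>\<^sup>+z. indicator (ball w r) z * ennreal (norm (f z) powr p) \<partial>lborel)"
proof (cases "f w = 0 \<or> (\<integral>\<^sup>+z. indicator (ball w r) z * ennreal (norm (f z) powr p) \<partial>lborel) = \<infinity>")
  case True
  then show ?thesis by (auto simp: ennreal_mult_top)
next
  case False
  then obtain i where i: "i \<ge> 0" "(\<integral>\<^sup>+z. indicator (ball w r) z * ennreal (norm (f z) powr p) \<partial>lborel) = ennreal i"
    by (metis ennreal_cases infinity_ennreal_def)
  define F where "F z = indicator (ball w r) z *\<^sub>R f z" for z
  have F [measurable]: "F \<in> borel_measurable borel"
    unfolding F_def by (rule holomorphic_cutoff_measurable[OF hol])
  define \<phi> where "\<phi> z = norm (f z) powr p * (r - dist w z)\<^sup>2" for z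
  have "continuous_on (cball w r) \<phi>"
    unfolding \<phi>_def using p by (intro continuous_intros cont continuous_on_powr') auto
  then obtain z0 where z0: "z0 \<in> cball w r" and max: "\<And>z. z \<in> cball w r \<Longrightarrow> \<phi> z \<le> \<phi> z0"
    using continuous_attains_sup[of "cball w r" \<phi>] r by auto
  define d where "d = r - dist w z0"
  have "0 < \<phi> w" using False r by (simp add: \<phi>_def)
  also have w_le: "\<phi> w \<le> \<phi> z0" using max r by auto
  finally have pos: "0 < \<phi> z0" .
  then have f0: "norm (f z0) > 0" by (auto simp: \<phi>_def)
  have d: "d > 0" using pos z0 by (cases "d = 0") (auto simp: \<phi>_def d_def)
  have sub: "ball z0 (d/2) \<subseteq> ball w r"
  proof
    fix z assume "z \<in> ball z0 (d/2)"
    then show "z \<in> ball w r" using dist_triangle[of w z z0] d by (simp add: d_def)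
  qed
  \<comment> \<open>The half radius keeps \<open>r - dist w z\<close> at least \<open>d / 2\<close>;
    squaring this loss gives the factor 4.\<close>
  have le4: "norm (f z) powr p \<le> 4 * norm (f z0) powr p" if z: "z \<in> ball z0 (d/2)" for z
  proof -
    have dz: "d / 2 \<le> r - dist w z" using dist_triangle[of w z z0] z by (simp add: d_def)
    have "norm (f z) powr p * (d/2)\<^sup>2 \<le> \<phi> z"
      unfolding \<phi>_def using dz d by (intro mult_left_mono power_mono) auto
    also have "\<dots> \<le> norm (f z0) powr p * d\<^sup>2"
      using max[of z] sub z by (auto simp: \<phi>_def d_def)
    finally show ?thesis using d by (simp add: field_simps power2_eq_square)
  qed
  \<comment> \<open>\<open>K\<close> bounds \<open>norm (f z) powr (1 - p)\<close> on the half ball;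
    monotonicity of this power is where \<open>p \<le> 1\<close> enters.\<close>
  define K where "K = (4 powr (1 / p) * norm (f z0)) powr (1 - p)"
  have le: "norm (f z) \<le> K * norm (f z) powr p" if z: "z \<in> ball z0 (d/2)" for z
  proof -
    have "norm (f z) = (norm (f z) powr p) powr (1 / p)" using p by (simp add: powr_powr)
    also have "\<dots> \<le> (4 * norm (f z0) powr p) powr (1 / p)"
      using le4[OF z] p by (intro powr_mono2) auto
    also have "\<dots> = 4 powr (1 / p) * norm (f z0)" using p by (simp add: powr_mult powr_powr)
    finally have *: "norm (f z) \<le> 4 powr (1 / p) * norm (f z0)" .
    have "norm (f z) = norm (f z) powr (1 - p) * norm (f z) powr p"
      by (cases "f z = 0") (auto simp: powr_add[symmetric])
    also have "\<dots> \<le> K * norm (f z) powr p"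
      unfolding K_def using * p by (intro mult_right_mono powr_mono2) auto
    finally show ?thesis .
  qed
  have "ennreal (pi * (d/2)\<^sup>2 * norm (f z0)) \<le> (\<integral>\<^sup>+z. indicator (ball z0 (d/2)) z * ennreal (norm (f z)) \<partial>lborel)"
    by (rule area_mean_value[OF holomorphic_on_subset[OF hol sub]]) (use d in auto)
  also have "\<dots> \<le> (\<integral>\<^sup>+z. ennreal K * (indicator (ball w r) z * ennreal (norm (F z) powr p)) \<partial>lborel)"
    using le sub by (intro nn_integral_mono) (auto simp: indicator_def F_def ennreal_mult'[symmetric] K_def)
  also have "\<dots> = ennreal K * (\<integral>\<^sup>+z. indicator (ball w r) z * ennreal (norm (F z) powr p) \<partial>lborel)"
    by (rule nn_integral_cmult) auto
  also have "(\<integral>\<^sup>+z. (indicator (ball w r) z * ennreal (norm (F z) powr p)) \<partial>lborel) = ennreal i"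
    unfolding i(2)[symmetric] by (auto intro!: nn_integral_cong simp: indicator_def F_def)
  finally have "pi * (d/2)\<^sup>2 * norm (f z0) \<le> K * i"
    using i by (simp add: ennreal_mult'[symmetric] K_def)
  then have "norm (f z0) powr (p - 1) * (pi * (d/2)\<^sup>2 * norm (f z0)) \<le> norm (f z0) powr (p - 1) * (K * i)"
    by (intro mult_left_mono) auto
  moreover have "norm (f z0) powr (p - 1) * (pi * (d/2)\<^sup>2 * norm (f z0)) = pi * (d/2)\<^sup>2 * norm (f z0) powr p"
    using f0 by (simp add: powr_diff)
  moreover have "norm (f z0) powr (p - 1) * (K * i) = 4 powr (1 / p - 1) * i"
  proof -
    have "(4 powr (1 / p)) powr (1 - p) = (4::real) powr (1 / p - 1)"
      using p by (simp add: powr_powr diff_divide_distrib right_diff_distrib)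
    moreover have "norm (f z0) powr (p - 1) * norm (f z0) powr (1 - p) = 1"
      using f0 by (simp add: powr_add[symmetric])
    ultimately show ?thesis
      by (simp add: K_def powr_mult)
  qed
  ultimately have "pi * (d/2)\<^sup>2 * norm (f z0) powr p \<le> 4 powr (1 / p - 1) * i" by simp
  moreover have "1 * ((d/2)\<^sup>2 * norm (f z0) powr p) \<le> pi * ((d/2)\<^sup>2 * norm (f z0) powr p)"
    using pi_ge_two by (intro mult_right_mono) auto
  ultimately have "norm (f z0) powr p * d\<^sup>2 \<le> 4 powr (1 / p) * i"
    by (simp add: powr_diff power2_eq_square field_simps)
  with w_le have "norm (f w) powr p * r\<^sup>2 \<le> 4 powr (1 / p) * i"
    by (simp add: \<phi>_def d_def)
  then show ?thesis using i by (simp add: ennreal_mult'[symmetric])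
qed

lemma submean_powr:
  assumes p: "0 < p"
  obtains C where "C > 0" "\<And>f w r. \<lbrakk>f holomorphic_on ball w r; continuous_on (cball w r) f; r > 0\<rbrakk> \<Longrightarrow>
    ennreal (norm (f w) powr p * r\<^sup>2) \<le> ennreal C * (\<integral>\<^sup>+z. indicator (ball w r) z * ennreal (norm (f z) powr p) \<partial>lborel)"
proof (cases "p \<ge> 1")
  case True
  show ?thesis by (rule that[of "2 powr p"]) (use submean_powr_ge_1[OF _ _ True] in auto)
next
  case False
  then have "p \<le> 1" by simp
  then show ?thesis by (intro that[of "4 powr (1 / p)"]) (use submean_powr_le_1[OF _ _ _ p] in auto)
qed

subsection \<open>Weighted area measure on the disc\<close>

text \<open>The restriction to the open disc is built into the measure space, so functions
  holomorphic only there are measurable without a cut-off. The normalising factors 1/\<pi> and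
  \<alpha> + 1 are left out and return in \<open>bergman_norm_eq\<close>.\<close>

definition disc_weight :: "real \<Rightarrow> complex measure" where
  "disc_weight a = density (restrict_space lborel (ball 0 1)) (\<lambda>z. ennreal ((1 - norm z ^ 2) powr a))"

lemma sets_disc_weight [measurable_cong, simp]: "sets (disc_weight a) = sets (restrict_space borel (ball 0 1))"
  by (simp add: disc_weight_def sets_restrict_space)

lemma space_disc_weight [simp]: "space (disc_weight a) = ball 0 1"
  by (simp add: disc_weight_def space_restrict_space)

lemma measurable_disc_weightI:
  "f \<in> borel_measurable borel \<Longrightarrow> f \<in> borel_measurable (disc_weight a)"
  by (simp add: measurable_restrict_space1 cong: measurable_cong_sets)

lemma holomorphic_measurable_disc_weight:
  "f holomorphic_on ball 0 1 \<Longrightarrow> f \<in> borel_measurable (disc_weight a)"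
  using borel_measurable_continuous_on_restrict[OF holomorphic_on_imp_continuous_on, of f "ball 0 1"]
  by (simp cong: measurable_cong_sets)

lemma nn_integral_disc_weight:
  assumes "g \<in> borel_measurable (disc_weight a)"
  shows "(\<integral>\<^sup>+z. g z \<partial>disc_weight a) = (\<integral>\<^sup>+z. indicator (ball 0 1) z * (ennreal ((1 - norm z ^ 2) powr a) * g z) \<partial>lborel)"
proof -
  have "g \<in> borel_measurable (restrict_space lborel (ball 0 1))"
    using assms by (simp add: disc_weight_def)
  then have "(\<integral>\<^sup>+z. g z \<partial>disc_weight a) = (\<integral>\<^sup>+z. ennreal ((1 - norm z ^ 2) powr a) * g z \<partial>restrict_space lborel (ball 0 1))"
    unfolding disc_weight_def
    by (intro nn_integral_density) (auto intro!: measurable_restrict_space1)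
  also have "\<dots> = (\<integral>\<^sup>+z. indicator (ball 0 1) z * (ennreal ((1 - norm z ^ 2) powr a) * g z) \<partial>lborel)"
    by (subst nn_integral_restrict_space) (auto simp: mult.commute)
  finally show ?thesis .
qed

abbreviation disc_energy :: "real \<Rightarrow> real \<Rightarrow> (complex \<Rightarrow> complex) \<Rightarrow> ennreal" where
  "disc_energy p a g \<equiv> \<integral>\<^sup>+z. ennreal (norm (g z) powr p) \<partial>disc_weight a"

lemma bergman_int_eq:
  assumes "f holomorphic_on ball 0 1"
  shows "bergman_int p a f = ennreal (1 / pi) * disc_energy p a f"
proof -
  define F where "F z = indicator (ball 0 1) z *\<^sub>R f z" for z
  have [measurable]: "F \<in> borel_measurable borel"
    unfolding F_def by (rule holomorphic_cutoff_measurable[OF assms])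
  have [measurable]: "f \<in> borel_measurable (disc_weight a)"
    by (rule holomorphic_measurable_disc_weight) fact
  have "bergman_int p a f = (\<integral>\<^sup>+z. ennreal (1 / pi) * (indicator (ball 0 1) z * (ennreal ((1 - norm z ^ 2) powr a) * ennreal (norm (F z) powr p))) \<partial>lborel)"
    unfolding bergman_int_def
    by (intro nn_integral_cong) (auto simp: F_def indicator_def ennreal_mult'[symmetric] mult_ac)
  also have "\<dots> = ennreal (1 / pi) * (\<integral>\<^sup>+z. (indicator (ball 0 1) z * (ennreal ((1 - norm z ^ 2) powr a) * ennreal (norm (F z) powr p))) \<partial>lborel)"
    by (rule nn_integral_cmult) measurable
  also have "(\<integral>\<^sup>+z. (indicator (ball 0 1) z * (ennreal ((1 - norm z ^ 2) powr a) * ennreal (norm (F z) powr p))) \<partial>lborel)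
      = disc_energy p a f"
    by (subst nn_integral_disc_weight) (auto intro!: nn_integral_cong simp: F_def indicator_def)
  finally show ?thesis .
qed

text \<open>The weight exponent may have either sign, so both endpoints compete for the extremum of
  \<open>x powr a\<close>.\<close>

lemma powr_between:
  fixes x :: real
  assumes "0 < l" "l \<le> x" "x \<le> u"
  shows powr_between_lower: "min (l powr a) (u powr a) \<le> x powr a"
    and powr_between_upper: "x powr a \<le> max (l powr a) (u powr a)"
proof -
  show "min (l powr a) (u powr a) \<le> x powr a"
  proof (cases "a \<ge> 0")
    case True then show ?thesis using assms powr_mono2[of a l x] by auto
  next
    case False then show ?thesis using assms powr_mono2'[of a x u] by auto
  qed
  show "x powr a \<le> max (l powr a) (u powr a)"
  proof (cases "a \<ge> 0")
    case True then show ?thesis using assms powr_mono2[of a x u] by auto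
  next
    case False then show ?thesis using assms powr_mono2'[of a l x] by auto
  qed
qed

text \<open>The sub-mean-value property is used on the ball whose radius is half the distance to the
  circle; there the weight is comparable to its value at the centre. The integral on the right is
  kept local, since it will be summed over dyadic shells and also followed along balls shrinking to
  the point 1.\<close>

lemma pointwise_bound:
  assumes p: "0 < p"
  obtains C where "C > 0" "\<And>g z. \<lbrakk>g holomorphic_on ball 0 1; z \<in> ball 0 1\<rbrakk> \<Longrightarrow>
    ennreal (norm (g z) powr p * (1 - norm z) powr (a + 2)) \<le>
      ennreal C * (\<integral>\<^sup>+\<zeta>. indicator (ball z ((1 - norm z) / 2)) \<zeta> * ennreal (norm (g \<zeta>) powr p) \<partial>disc_weight a)"
proof -
  obtain C where C: "C > 0" "\<And>f w r. \<lbrakk>f holomorphic_on ball w r; continuous_on (cball w r) f; r > 0\<rbrakk> \<Longrightarrow>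
    ennreal (norm (f w) powr p * r\<^sup>2) \<le> ennreal C * (\<integral>\<^sup>+z. indicator (ball w r) z * ennreal (norm (f z) powr p) \<partial>lborel)"
    by (rule submean_powr[OF p]) (rule that, assumption+)
  \<comment> \<open>On that ball \<open>1 - norm \<zeta> ^ 2\<close> lies between \<rho>/2 and 3
    \<rho>, whence one constant for each sign of \<open>a\<close>.\<close>
  define c :: real where "c = min ((1/2) powr a) (3 powr a)"
  have c: "c > 0" by (auto simp: c_def)
  show ?thesis
  proof (rule that[of "4 * C / c"])
    show "4 * C / c > 0" using C c by auto
    fix g z assume hol: "g holomorphic_on ball 0 1" and z: "z \<in> ball (0::complex) 1"
    have [measurable]: "g \<in> borel_measurable (disc_weight a)"
      by (rule holomorphic_measurable_disc_weight) fact
    have [measurable]: "(\<lambda>\<zeta>. indicator (ball z r) \<zeta> :: ennreal) \<in> borel_measurable (disc_weight a)" for r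
      by (rule measurable_disc_weightI) simp
    define \<rho> where "\<rho> = 1 - norm z"
    have \<rho>: "\<rho> > 0" using z by (simp add: \<rho>_def)
    have near: "\<zeta> \<in> ball 0 1 \<and> c * \<rho> powr a \<le> (1 - norm \<zeta> ^ 2) powr a" if "\<zeta> \<in> cball z (\<rho> / 2)" for \<zeta>
    proof -
      have d: "dist z \<zeta> \<le> \<rho> / 2" using that by simp
      have n1: "norm \<zeta> \<le> norm z + \<rho> / 2"
        using d norm_triangle_ineq[of z "\<zeta> - z"] by (simp add: dist_norm norm_minus_commute)
      have n2: "norm z \<le> norm \<zeta> + \<rho> / 2"
        using d norm_triangle_ineq[of \<zeta> "z - \<zeta>"] by (simp add: dist_norm)
      have l: "\<rho> / 2 \<le> 1 - norm \<zeta>" "1 - norm \<zeta> \<le> 3 * \<rho> / 2"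
        using n1 n2 \<rho>_def by linarith+
      have lt: "norm \<zeta> < 1" using l \<rho> by linarith
      have "1 - norm \<zeta> ^ 2 = (1 - norm \<zeta>) * (1 + norm \<zeta>)" by (simp add: power2_eq_square algebra_simps)
      moreover have "(1 - norm \<zeta>) * 1 \<le> (1 - norm \<zeta>) * (1 + norm \<zeta>)"
        using lt by (intro mult_left_mono) auto
      moreover have "(1 - norm \<zeta>) * (1 + norm \<zeta>) \<le> (1 - norm \<zeta>) * 2"
        using lt by (intro mult_left_mono) auto
      ultimately have b: "\<rho> / 2 \<le> 1 - norm \<zeta> ^ 2" "1 - norm \<zeta> ^ 2 \<le> 3 * \<rho>" using l by auto
      have "c * \<rho> powr a \<le> (1/2) powr a * \<rho> powr a" "c * \<rho> powr a \<le> 3 powr a * \<rho> powr a"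
        by (auto simp: c_def intro!: mult_right_mono)
      moreover have "(1/2) powr a * \<rho> powr a = (\<rho> / 2) powr a" "3 powr a * \<rho> powr a = (3 * \<rho>) powr a"
        using powr_mult[of "1/2" \<rho> a] powr_mult[of 3 \<rho> a] by simp_all
      ultimately have "c * \<rho> powr a \<le> min ((\<rho> / 2) powr a) ((3 * \<rho>) powr a)"
        by simp
      also have "\<dots> \<le> (1 - norm \<zeta> ^ 2) powr a"
        by (rule powr_between_lower) (use b \<rho> in auto)
      finally show ?thesis using lt by simp
    qed
    have sub: "cball z (\<rho> / 2) \<subseteq> ball 0 1" using near by auto
    then have subb: "ball z (\<rho> / 2) \<subseteq> ball 0 1" by auto
    have "ennreal (c * \<rho> powr a) * ennreal (norm (g z) powr p * (\<rho> / 2)\<^sup>2) \<le> ennreal (c * \<rho> powr a) * (ennreal C * (\<integral>\<^sup>+\<zeta>. indicator (ball z (\<rho> / 2)) \<zeta> * ennreal (norm (g \<zeta>) powr p) \<partial>lborel))"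
      using \<rho> by (intro mult_left_mono C(2) holomorphic_on_subset[OF hol subb] continuous_on_subset[OF holomorphic_on_imp_continuous_on[OF hol] sub]) auto
    also have "\<dots> = ennreal C * (ennreal (c * \<rho> powr a) * (\<integral>\<^sup>+\<zeta>. indicator (ball z (\<rho> / 2)) \<zeta> * ennreal (norm (g \<zeta>) powr p) \<partial>lborel))"
      by (simp add: mult_ac)
    also have "ennreal (c * \<rho> powr a) * (\<integral>\<^sup>+\<zeta>. indicator (ball z (\<rho> / 2)) \<zeta> * ennreal (norm (g \<zeta>) powr p) \<partial>lborel)
        = (\<integral>\<^sup>+\<zeta>. ennreal (c * \<rho> powr a) * (indicator (ball z (\<rho> / 2)) \<zeta> * ennreal (norm (g \<zeta>) powr p)) \<partial>lborel)"
    proof (rule nn_integral_cmult[symmetric])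
      define F where "F z = indicator (ball 0 1) z *\<^sub>R g z" for z
      have [measurable]: "F \<in> borel_measurable borel"
        unfolding F_def by (rule holomorphic_cutoff_measurable[OF hol])
      have "(\<lambda>\<zeta>. indicator (ball z (\<rho> / 2)) \<zeta> * ennreal (norm (g \<zeta>) powr p)) = (\<lambda>\<zeta>. indicator (ball z (\<rho> / 2)) \<zeta> * ennreal (norm (F \<zeta>) powr p))"
        using subb by (auto simp: fun_eq_iff F_def indicator_def)
      then show "(\<lambda>\<zeta>. indicator (ball z (\<rho> / 2)) \<zeta> * ennreal (norm (g \<zeta>) powr p)) \<in> borel_measurable lborel"
        by simp
    qed
    also have "\<dots> \<le> (\<integral>\<^sup>+\<zeta>. indicator (ball z (\<rho> / 2)) \<zeta> * ennreal (norm (g \<zeta>) powr p) \<partial>disc_weight a)"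
    proof (subst nn_integral_disc_weight)
      show "(\<lambda>\<zeta>. indicator (ball z (\<rho> / 2)) \<zeta> * ennreal (norm (g \<zeta>) powr p)) \<in> borel_measurable (disc_weight a)"
        by measurable
      have "ennreal (c * \<rho> powr a) * ennreal (norm (g \<zeta>) powr p) \<le> ennreal ((1 - norm \<zeta> ^ 2) powr a) * ennreal (norm (g \<zeta>) powr p)"
        if "\<zeta> \<in> ball z (\<rho> / 2)" for \<zeta>
        using near[of \<zeta>] that by (intro mult_right_mono ennreal_leI) auto
      then show "(\<integral>\<^sup>+\<zeta>. ennreal (c * \<rho> powr a) * (indicator (ball z (\<rho> / 2)) \<zeta> * ennreal (norm (g \<zeta>) powr p)) \<partial>lborel)
        \<le> (\<integral>\<^sup>+\<zeta>. indicator (ball 0 1) \<zeta> * (ennreal ((1 - norm \<zeta> ^ 2) powr a) * (indicator (ball z (\<rho> / 2)) \<zeta> * ennreal (norm (g \<zeta>) powr p))) \<partial>lborel)"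
        using subb by (intro nn_integral_mono) (auto simp: indicator_def)
    qed
    finally have main: "ennreal (c * \<rho> powr a) * ennreal (norm (g z) powr p * (\<rho> / 2)\<^sup>2) \<le>
       ennreal C * (\<integral>\<^sup>+\<zeta>. indicator (ball z (\<rho> / 2)) \<zeta> * ennreal (norm (g \<zeta>) powr p) \<partial>disc_weight a)"
      by (simp add: mult_left_mono)
    have "norm (g z) powr p * \<rho> powr (a + 2) = (4 / c) * (c * \<rho> powr a * (norm (g z) powr p * (\<rho> / 2)\<^sup>2))"
      using \<rho> c by (simp add: powr_add power2_eq_square powr_numeral)
    then have "ennreal (norm (g z) powr p * \<rho> powr (a + 2)) = ennreal (4 / c) * (ennreal (c * \<rho> powr a) * ennreal (norm (g z) powr p * (\<rho> / 2)\<^sup>2))"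
      using c by (simp add: ennreal_mult'[symmetric])
    also have "\<dots> \<le> ennreal (4 / c) * (ennreal C * (\<integral>\<^sup>+\<zeta>. indicator (ball z (\<rho> / 2)) \<zeta> * ennreal (norm (g \<zeta>) powr p) \<partial>disc_weight a))"
      by (rule mult_left_mono[OF main]) auto
    also have "\<dots> = ennreal (4 * C / c) * (\<integral>\<^sup>+\<zeta>. indicator (ball z (\<rho> / 2)) \<zeta> * ennreal (norm (g \<zeta>) powr p) \<partial>disc_weight a)"
      using c C by (simp add: mult.assoc[symmetric] ennreal_mult'[symmetric])
    finally show "ennreal (norm (g z) powr p * (1 - norm z) powr (a + 2)) \<le>
      ennreal (4 * C / c) * (\<integral>\<^sup>+\<zeta>. indicator (ball z ((1 - norm z) / 2)) \<zeta> * ennreal (norm (g \<zeta>) powr p) \<partial>disc_weight a)"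
      by (simp add: \<rho>_def)
  qed
qed

section \<open>Mass of the weighted measure near the boundary point 1\<close>

lemma nn_integral_powr_0:
  assumes a: "a > -1" and x: "x \<ge> 0"
  shows "(\<integral>\<^sup>+v. ennreal (indicator {0<..x} v * v powr a) \<partial>lborel) = ennreal (x powr (a + 1) / (a + 1))"
proof (rule nn_integral_has_integral_lborel)
  have "((\<lambda>v. v powr a) has_integral (x powr (a + 1) / (a + 1))) {0..x}"
    by (rule has_integral_powr_from_0[OF a x])
  then have "((\<lambda>v. v powr a) has_integral (x powr (a + 1) / (a + 1))) {0<..x}"
    by (rule has_integral_spike_set_eq[THEN iffD1, rotated 2])
       (rule negligible_subset[of "{0}"], auto)+
  then have "((\<lambda>v. if v \<in> {0<..x} then v powr a else 0) has_integral (x powr (a + 1) / (a + 1))) UNIV"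
    by (subst has_integral_restrict_UNIV)
  then show "((\<lambda>v. indicator {0<..x} v * v powr a) has_integral (x powr (a + 1) / (a + 1))) UNIV"
    by (rule has_integral_eq[rotated]) (auto simp: indicator_def)
qed auto

text \<open>On the horizontal line at height \<open>y\<close> the weight is the power
  \<open>a\<close> of (c + u)(c - u), with c the square root of 1 - y^2. Since Re z is at least 1/2,
  the factor c + u stays between 1/2 and 2, while 0 < c - u \<le> x; the remaining power of c - u is
  integrable because \<open>a > -1\<close>. The height contributes one more factor
  \<open>x\<close>.\<close>

lemma disc_weight_corner:
  assumes a: "a > -1" and x: "x > 0"
  shows "(\<integral>\<^sup>+z. ennreal ((1 - norm z ^ 2) powr a) * indicator {z. norm z < 1 \<and> 1/2 \<le> Re z \<and> 1 - x \<le> Re z \<and> \<bar>Im z\<bar> \<le> x} z \<partial>lborel)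
    \<le> ennreal (2 * max ((1/2) powr a) (2 powr a) / (a + 1) * x powr (a + 2))"
proof -
  define K :: real where "K = max ((1/2) powr a) (2 powr a)"
  have K: "K > 0" by (auto simp: K_def less_max_iff_disj)
  let ?g = "\<lambda>z. ennreal ((1 - norm z ^ 2) powr a) * indicator {z. norm z < 1 \<and> 1/2 \<le> Re z \<and> 1 - x \<le> Re z \<and> \<bar>Im z\<bar> \<le> x} z"
  have inner: "(\<integral>\<^sup>+u. ?g (Complex u y) \<partial>lborel) \<le> ennreal (K * (x powr (a + 1) / (a + 1))) * indicator {-x..x} y" for y
  proof (cases "\<bar>y\<bar> < 1 \<and> \<bar>y\<bar> \<le> x")
    case False
    then have "?g (Complex u y) = 0" for u
      using abs_Im_le_cmod[of "Complex u y"] by (auto simp: indicator_def)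
    then have "(\<integral>\<^sup>+u. ?g (Complex u y) \<partial>lborel) = (\<integral>\<^sup>+(u::real). 0 \<partial>lborel)"
      by (intro nn_integral_cong)
    then show ?thesis by (simp only: nn_integral_const mult_zero_left zero_le)
  next
    case True
    define c where "c = sqrt (1 - y\<^sup>2)"
    have y2: "y\<^sup>2 < 1" using True by (simp add: abs_square_less_1)
    have c: "0 < c" "c \<le> 1" "c\<^sup>2 = 1 - y\<^sup>2" using y2 by (auto simp: c_def)
    have le: "?g (Complex u y) \<le> ennreal K * ennreal (indicator {0<..x} (c - u) * (c - u) powr a)" for u
    proof (cases "norm (Complex u y) < 1 \<and> 1/2 \<le> u \<and> 1 - x \<le> u")
      case T: True
      have n2: "norm (Complex u y) ^ 2 = u\<^sup>2 + y\<^sup>2" by (simp add: cmod_power2)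
      have "norm (Complex u y) ^ 2 < 1" using T by (simp add: abs_square_less_1)
      then have "u\<^sup>2 < c\<^sup>2" using n2 c by simp
      then have uc: "u < c" using c by (intro power_less_imp_less_base[of u 2 c]) auto
      have "1 - norm (Complex u y) ^ 2 = (c + u) * (c - u)"
        using n2 c by (simp add: power2_eq_square algebra_simps)
      then have "(1 - norm (Complex u y) ^ 2) powr a = (c + u) powr a * (c - u) powr a"
        using uc c T by (simp add: powr_mult)
      also have "\<dots> \<le> K * (c - u) powr a"
        unfolding K_def using uc c T by (intro mult_right_mono powr_between_upper) auto
      finally show ?thesis using T uc c K by (auto simp: indicator_def ennreal_mult'[symmetric])
    qed auto
    have "(\<integral>\<^sup>+u. ?g (Complex u y) \<partial>lborel) \<le> (\<integral>\<^sup>+u. ennreal K * ennreal (indicator {0<..x} (c - u) * (c - u) powr a) \<partial>lborel)"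
      by (intro nn_integral_mono le)
    also have "\<dots> = ennreal K * (\<integral>\<^sup>+u. ennreal (indicator {0<..x} (c - u) * (c - u) powr a) \<partial>lborel)"
      by (rule nn_integral_cmult) measurable
    also have "(\<integral>\<^sup>+u. ennreal (indicator {0<..x} (c - u) * (c - u) powr a) \<partial>lborel) = (\<integral>\<^sup>+u. ennreal (indicator {0<..x} u * u powr a) \<partial>lborel)"
      using nn_integral_real_affine[of "\<lambda>u. ennreal (indicator {0<..x} u * u powr a)" "-1" c] by simp
    also have "\<dots> = ennreal (x powr (a + 1) / (a + 1))"
      using a x by (intro nn_integral_powr_0) auto
    finally show ?thesis using True K by (simp add: indicator_def ennreal_mult'[symmetric] abs_le_iff)
  qed
  have "(\<integral>\<^sup>+z. ?g z \<partial>lborel) = (\<integral>\<^sup>+y. \<integral>\<^sup>+u. ?g (Complex u y) \<partial>lborel \<partial>lborel)"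
    by (rule nn_integral_complex) measurable
  also have "\<dots> \<le> (\<integral>\<^sup>+y. ennreal (K * (x powr (a + 1) / (a + 1))) * indicator {-x..x} y \<partial>lborel)"
    by (intro nn_integral_mono inner)
  also have "\<dots> = ennreal (K * (x powr (a + 1) / (a + 1))) * ennreal (2 * x)"
    using x by (subst nn_integral_cmult_indicator) auto
  also have "\<dots> = ennreal (2 * K / (a + 1) * x powr (a + 2))"
  proof -
    have "x powr (a + 2) = x powr (a + 1) * x"
      using x by (simp add: powr_add power2_eq_square powr_numeral)
    then show ?thesis using K a x by (subst ennreal_mult'[symmetric]) (auto simp: field_simps)
  qed
  finally show ?thesis by (simp add: K_def)
qed

lemma emeasure_disc_weight:
  assumes "A \<in> sets borel" "A \<subseteq> ball 0 1"
  shows "emeasure (disc_weight a) A = (\<integral>\<^sup>+z. ennreal ((1 - norm z ^ 2) powr a) * indicator A z \<partial>lborel)"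
proof -
  have A: "A \<in> sets (disc_weight a)"
    using assms by (auto simp: sets_restrict_space_iff)
  have "emeasure (disc_weight a) A = (\<integral>\<^sup>+z. indicator A z \<partial>disc_weight a)"
    by (rule nn_integral_indicator[OF A, symmetric])
  also have "\<dots> = (\<integral>\<^sup>+z. indicator (ball 0 1) z * (ennreal ((1 - norm z ^ 2) powr a) * indicator A z) \<partial>lborel)"
    by (rule nn_integral_disc_weight) (use A in simp)
  also have "\<dots> = (\<integral>\<^sup>+z. ennreal ((1 - norm z ^ 2) powr a) * indicator A z \<partial>lborel)"
    using assms by (intro nn_integral_cong) (auto simp: indicator_def)
  finally show ?thesis .
qed

text \<open>Outside the square of half-width 1/2 the disc is covered by four rotated copies of the
  corner region with \<open>x = 1\<close>, one for each fourth root of unity; on the square the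
  weight is bounded.\<close>

lemma disc_weight_finite:
  assumes a: "a > -1"
  shows "emeasure (disc_weight a) (ball 0 1) < \<infinity>"
proof -
  let ?w = "\<lambda>z::complex. ennreal ((1 - norm z ^ 2) powr a)"
  let ?H = "\<lambda>c z::complex. indicator {z. norm z < 1 \<and> 1/2 \<le> Re (c * z)} z :: ennreal"
  have corner: "(\<integral>\<^sup>+z. ?w z * ?H c z \<partial>lborel) < \<infinity>" if c: "norm c = 1" for c
  proof -
    have m: "(\<lambda>z. ?w z * indicator {z. norm z < 1 \<and> 1/2 \<le> Re z \<and> 1 - 1 \<le> Re z \<and> \<bar>Im z\<bar> \<le> 1} z) \<in> borel_measurable borel"
      by measurable
    have "(\<integral>\<^sup>+z. ?w z * ?H c z \<partial>lborel) =
        (\<integral>\<^sup>+z. ?w (c * z) * indicator {z. norm z < 1 \<and> 1/2 \<le> Re z \<and> 1 - 1 \<le> Re z \<and> \<bar>Im z\<bar> \<le> 1} (c * z) \<partial>lborel)"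
    proof (intro nn_integral_cong)
      fix z :: complex
      show "?w z * ?H c z = ?w (c * z) * indicator {z. norm z < 1 \<and> 1/2 \<le> Re z \<and> 1 - 1 \<le> Re z \<and> \<bar>Im z\<bar> \<le> 1} (c * z)"
        using abs_Im_le_cmod[of "c * z"] c by (auto simp: indicator_def norm_mult simp del: times_complex.sel)
    qed
    also have "\<dots> = (\<integral>\<^sup>+z. ?w z * indicator {z. norm z < 1 \<and> 1/2 \<le> Re z \<and> 1 - 1 \<le> Re z \<and> \<bar>Im z\<bar> \<le> 1} z \<partial>lborel)"
      by (rule nn_integral_rotate[OF m c])
    also have "\<dots> \<le> ennreal (2 * max ((1/2) powr a) (2 powr a) / (a + 1) * 1 powr (a + 2))"
      by (rule disc_weight_corner[OF a]) simp
    also have "\<dots> < \<infinity>" by simp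
    finally show ?thesis .
  qed
  define L :: real where "L = max ((1/4) powr a) (1 powr a)"
  have cover: "?w z * indicator (ball 0 1) z \<le>
      ennreal L * indicator (ball 0 1) z + (?w z * ?H 1 z + (?w z * ?H (-1) z + (?w z * ?H \<i> z + ?w z * ?H (-\<i>) z)))" for z
  proof (cases "norm z < 1")
    case False then show ?thesis by simp
  next
    case True
    show ?thesis
    proof (cases "1/2 \<le> Re z \<or> 1/2 \<le> - Re z \<or> 1/2 \<le> - Im z \<or> 1/2 \<le> Im z")
      case T: True
      have "?w z \<le> ?w z * ?H 1 z + (?w z * ?H (-1) z + (?w z * ?H \<i> z + ?w z * ?H (-\<i>) z))"
        using T True by (auto simp: indicator_def intro: add_increasing2 add_increasing)
      then show ?thesis using True by (simp add: add_increasing)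
    next
      case F: False
      have r: "(Re z)\<^sup>2 \<le> (1/2)\<^sup>2" "(Im z)\<^sup>2 \<le> (1/2)\<^sup>2"
        using F by (auto simp: abs_le_square_iff[symmetric])
      then have "1/4 \<le> 1 - norm z ^ 2" unfolding cmod_power2 by (simp add: power2_eq_square)
      then have "(1 - norm z ^ 2) powr a \<le> L"
        unfolding L_def by (intro powr_between_upper) auto
      then have "?w z \<le> ennreal L" by (rule ennreal_leI)
      then show ?thesis using True by (simp add: add_increasing2)
    qed
  qed
  have "emeasure (disc_weight a) (ball 0 1) = (\<integral>\<^sup>+z. ?w z * indicator (ball 0 1) z \<partial>lborel)"
    by (rule emeasure_disc_weight) auto
  also have "\<dots> \<le> (\<integral>\<^sup>+z. ennreal L * indicator (ball 0 1) z + (?w z * ?H 1 z + (?w z * ?H (-1) z + (?w z * ?H \<i> z + ?w z * ?H (-\<i>) z))) \<partial>lborel)"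
    by (intro nn_integral_mono cover)
  also have "\<dots> = (\<integral>\<^sup>+(z::complex). ennreal L * indicator (ball 0 1) z \<partial>lborel) + ((\<integral>\<^sup>+z. ?w z * ?H 1 z \<partial>lborel) + ((\<integral>\<^sup>+z. ?w z * ?H (-1) z \<partial>lborel) + ((\<integral>\<^sup>+z. ?w z * ?H \<i> z \<partial>lborel) + (\<integral>\<^sup>+z. ?w z * ?H (-\<i>) z \<partial>lborel))))"
  proof -
    have m: "(\<lambda>z. ?w z * ?H c z) \<in> borel_measurable lborel" for c
      by measurable
    have m0: "(\<lambda>z::complex. ennreal L * indicator (ball 0 1) z) \<in> borel_measurable lborel"
      by measurable
    show ?thesis
      by (simp only: nn_integral_add m m0 borel_measurable_add)
  qed
  also have "\<dots> < \<infinity>"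
    using corner[of 1] corner[of "-1"] corner[of \<i>] corner[of "-\<i>"]
    by (auto simp: nn_integral_cmult_indicator emeasure_ball ennreal_mult_less_top)
  finally show ?thesis .
qed

text \<open>For small \<open>x\<close> this is the corner estimate. For \<open>x > 1/2\<close> the
  total mass suffices, since \<open>(2 * x) powr (a + 2)\<close> is then at least 1.\<close>

lemma disc_weight_near_1:
  assumes a: "a > -1"
  obtains C where "C > 0" "\<And>x. x > 0 \<Longrightarrow>
    emeasure (disc_weight a) {z \<in> ball 0 1. norm (1 - z) \<le> x} \<le> ennreal (C * x powr (a + 2))"
proof -
  define C1 :: real where "C1 = 2 * max ((1/2) powr a) (2 powr a) / (a + 1)"
  define C2 where "C2 = enn2real (emeasure (disc_weight a) (ball 0 1)) * 2 powr (a + 2)"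
  have C1: "C1 > 0" using a by (auto simp: C1_def less_max_iff_disj)
  have C2: "C2 \<ge> 0" by (simp add: C2_def)
  show ?thesis
  proof (rule that[of "C1 + C2"])
    show "C1 + C2 > 0" using C1 C2 by simp
    fix x :: real assume x: "x > 0"
    have me: "{z \<in> ball 0 1. norm (1 - z :: complex) \<le> x} \<in> sets borel" by measurable
    show "emeasure (disc_weight a) {z \<in> ball 0 1. norm (1 - z) \<le> x} \<le> ennreal ((C1 + C2) * x powr (a + 2))"
    proof (cases "x \<le> 1/2")
      case True
      have "emeasure (disc_weight a) {z \<in> ball 0 1. norm (1 - z) \<le> x} = (\<integral>\<^sup>+(z::complex). ennreal ((1 - norm z ^ 2) powr a) * indicator {z \<in> ball 0 1. norm (1 - z) \<le> x} z \<partial>lborel)"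
        by (rule emeasure_disc_weight[OF me]) auto
      also have "\<dots> \<le> (\<integral>\<^sup>+z. ennreal ((1 - norm z ^ 2) powr a) * indicator {z. norm z < 1 \<and> 1/2 \<le> Re z \<and> 1 - x \<le> Re z \<and> \<bar>Im z\<bar> \<le> x} z \<partial>lborel)"
      proof (intro nn_integral_mono mult_left_mono)
        fix z :: complex
        have "z \<in> {z. norm z < 1 \<and> 1/2 \<le> Re z \<and> 1 - x \<le> Re z \<and> \<bar>Im z\<bar> \<le> x}" if "z \<in> {z \<in> ball 0 1. norm (1 - z) \<le> x}"
          using complex_Re_le_cmod[of "1 - z"] abs_Im_le_cmod[of "1 - z"] True that by auto
        then show "indicator {z \<in> ball 0 1. norm (1 - z) \<le> x} z \<le> (indicator {z. norm z < 1 \<and> 1/2 \<le> Re z \<and> 1 - x \<le> Re z \<and> \<bar>Im z\<bar> \<le> x} z :: ennreal)"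
          by (auto simp: indicator_def)
      qed auto
      also have "\<dots> \<le> ennreal (C1 * x powr (a + 2))"
        unfolding C1_def by (rule disc_weight_corner[OF a x])
      also have "\<dots> \<le> ennreal ((C1 + C2) * x powr (a + 2))"
        using C2 by (intro ennreal_leI mult_right_mono) auto
      finally show ?thesis .
    next
      case False
      have "emeasure (disc_weight a) {z \<in> ball 0 1. norm (1 - z) \<le> x} \<le> emeasure (disc_weight a) (ball 0 1)"
        by (rule emeasure_mono) (auto simp: sets_restrict_space_iff)
      also have "\<dots> = ennreal (enn2real (emeasure (disc_weight a) (ball 0 1)))"
        using disc_weight_finite[OF a] by simp
      also have "\<dots> \<le> ennreal ((C1 + C2) * x powr (a + 2))"
      proof (rule ennreal_leI)
        have "1 \<le> (2 * x) powr (a + 2)" using False a by (intro ge_one_powr_ge_zero) auto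
        then have "enn2real (emeasure (disc_weight a) (ball 0 1)) * 1 \<le> enn2real (emeasure (disc_weight a) (ball 0 1)) * (2 * x) powr (a + 2)"
          by (intro mult_left_mono) auto
        also have "\<dots> = C2 * x powr (a + 2)" using x by (simp add: C2_def powr_mult)
        also have "\<dots> \<le> (C1 + C2) * x powr (a + 2)" using C1 by (intro mult_right_mono) auto
        finally show "enn2real (emeasure (disc_weight a) (ball 0 1)) \<le> (C1 + C2) * x powr (a + 2)" by simp
      qed
      finally show ?thesis .
    qed
  qed
qed

text \<open>The upper bound 2 is the diameter of the disc: with \<open>y = norm (1 - z)\<close> the
  index never becomes negative.\<close>

lemma dyadic_index:
  fixes y :: real
  assumes "0 < y" "y \<le> 2"
  obtains k :: nat where "2 powr (- real k) < y" "y \<le> 2 powr (1 - real k)"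
proof -
  define k where "k = nat \<lfloor>1 - log 2 y\<rfloor>"
  have "log 2 y \<le> 1" using assms by (simp add: log_le_iff)
  then have k: "real k \<le> 1 - log 2 y" "1 - log 2 y < real k + 1"
    unfolding k_def by (linarith, linarith)
  have "2 powr (- real k) < 2 powr (log 2 y)" using k by (intro powr_less_mono) auto
  moreover have "2 powr (log 2 y) \<le> 2 powr (1 - real k)" using k by (intro powr_mono) auto
  ultimately show ?thesis using assms that by simp
qed

text \<open>Each point of the disc lies in an annulus 2^(-k) < |1 - z| \<le> 2^(1 - k), and this
  annulus sits in a disc about 1 of mass at most a constant times 2^(-k (a + 2)). An integral is
  thereby reduced to a series over \<open>k\<close>.\<close>

lemma disc_weight_dyadic:
  assumes a: "a > -1"
  obtains C where "C > 0" "\<And>g v. \<lbrakk>\<forall>k. v k \<ge> 0; summable (\<lambda>k. v k * 2 powr (- real k * (a + 2)));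
      \<forall>z\<in>ball 0 1. \<forall>k. 2 powr (- real k) < norm (1 - z) \<longrightarrow> norm (1 - z) \<le> 2 powr (1 - real k) \<longrightarrow> g z \<le> ennreal (v k)\<rbrakk> \<Longrightarrow>
    (\<integral>\<^sup>+z. g z \<partial>disc_weight a) \<le> ennreal (C * (\<Sum>k. v k * 2 powr (- real k * (a + 2))))"
proof -
  obtain C where C: "C > 0" "\<And>x. x > 0 \<Longrightarrow>
    emeasure (disc_weight a) {z \<in> ball 0 1. norm (1 - z) \<le> x} \<le> ennreal (C * x powr (a + 2))"
    by (rule disc_weight_near_1[OF a]) (rule that, assumption+)
  show ?thesis
  proof (rule that[of "C * 2 powr (a + 2)"])
    show "C * 2 powr (a + 2) > 0" using C by simp
    fix g :: "complex \<Rightarrow> ennreal" and v :: "nat \<Rightarrow> real"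
    assume "\<forall>k. v k \<ge> 0" and sm: "summable (\<lambda>k. v k * 2 powr (- real k * (a + 2)))"
      and gv': "\<forall>z\<in>ball 0 1. \<forall>k. 2 powr (- real k) < norm (1 - z) \<longrightarrow> norm (1 - z) \<le> 2 powr (1 - real k) \<longrightarrow> g z \<le> ennreal (v k)"
    then have v: "\<And>k. v k \<ge> 0" by blast
    have gv: "g z \<le> ennreal (v k)"
      if "z \<in> ball 0 1" "2 powr (- real k) < norm (1 - z)" "norm (1 - z) \<le> 2 powr (1 - real k)" for z k
      using gv' that by blast
    let ?A = "\<lambda>k::nat. {z \<in> ball 0 1. norm (1 - z :: complex) \<le> 2 powr (1 - real k)}"
    have A: "?A k \<in> sets (disc_weight a)" for k
    proof -
      have "?A k \<in> sets borel" by measurable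
      then show ?thesis by (auto simp: sets_restrict_space_iff)
    qed
    have "(\<integral>\<^sup>+z. g z \<partial>disc_weight a) \<le> (\<integral>\<^sup>+z. (\<Sum>k. ennreal (v k) * indicator (?A k) z) \<partial>disc_weight a)"
    proof (rule nn_integral_mono)
      fix z assume "z \<in> space (disc_weight a)"
      then have z: "z \<in> ball 0 1" by simp
      have "0 < norm (1 - z)" using z by auto
      moreover have "norm (1 - z) \<le> 2" using z norm_triangle_ineq4[of 1 z] by simp
      ultimately obtain k :: nat where k: "2 powr (- real k) < norm (1 - z)" "norm (1 - z) \<le> 2 powr (1 - real k)"
        using dyadic_index by blast
      define T where "T j = ennreal (v j) * indicator (?A j) z" for j
      have "g z \<le> T k"
        using gv[OF z k] k z by (simp add: T_def)
      also have "T k = sum T {k}" by simp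
      also have "\<dots> \<le> suminf T" by (rule sum_le_suminf) auto
      finally show "g z \<le> (\<Sum>k. ennreal (v k) * indicator (?A k) z)" by (simp only: T_def[abs_def])
    qed
    also have "\<dots> = (\<Sum>k. \<integral>\<^sup>+z. ennreal (v k) * indicator (?A k) z \<partial>disc_weight a)"
      using A by (intro nn_integral_suminf) auto
    also have "\<dots> = (\<Sum>k. ennreal (v k) * emeasure (disc_weight a) (?A k))"
      using A by (simp add: nn_integral_cmult_indicator)
    also have "\<dots> \<le> (\<Sum>k. ennreal (C * 2 powr (a + 2) * (v k * 2 powr (- real k * (a + 2)))))"
    proof (intro suminf_le summableI)
      fix k
      have "ennreal (v k) * emeasure (disc_weight a) (?A k) \<le> ennreal (v k) * ennreal (C * (2 powr (1 - real k)) powr (a + 2))"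
        by (intro mult_left_mono C(2)) auto
      also have "\<dots> = ennreal (v k * (C * (2 powr (1 - real k)) powr (a + 2)))"
        using v by (simp add: ennreal_mult'[symmetric])
      also have "v k * (C * (2 powr (1 - real k)) powr (a + 2)) = C * 2 powr (a + 2) * (v k * 2 powr (- real k * (a + 2)))"
      proof -
        have "(2 powr (1 - real k)) powr (a + 2) = 2 powr ((a + 2) + (- real k * (a + 2)))"
          by (simp add: powr_powr algebra_simps)
        also have "\<dots> = 2 powr (a + 2) * 2 powr (- real k * (a + 2))" by (rule powr_add)
        finally show ?thesis by simp
      qed
      finally show "ennreal (v k) * emeasure (disc_weight a) (?A k) \<le> ennreal (C * 2 powr (a + 2) * (v k * 2 powr (- real k * (a + 2))))" .
    qed
    also have "\<dots> = ennreal (\<Sum>k. C * 2 powr (a + 2) * (v k * 2 powr (- real k * (a + 2))))"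
      using C v by (intro suminf_ennreal2 summable_mult sm) auto
    also have "\<dots> = ennreal (C * 2 powr (a + 2) * (\<Sum>k. v k * 2 powr (- real k * (a + 2))))"
      by (subst suminf_mult[OF sm]) simp
    finally show "(\<integral>\<^sup>+z. g z \<partial>disc_weight a) \<le> ennreal (C * 2 powr (a + 2) * (\<Sum>k. v k * 2 powr (- real k * (a + 2))))" .
  qed
qed

subsection \<open>Dyadic decompositions\<close>

definition decay :: "real \<Rightarrow> nat \<Rightarrow> nat \<Rightarrow> real" where
  "decay c k i = 2 powr (- c * \<bar>real i - real k\<bar>)"

lemma decay_pos [simp]: "decay c k i > 0" "decay c k i \<ge> 0"
  by (auto simp: decay_def)

lemma decay_commute: "decay c k i = decay c i k"
  by (simp add: decay_def abs_minus_commute)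

lemma decay_le_1: "c \<ge> 0 \<Longrightarrow> decay c k i \<le> 1"
  using powr_mono[of "- c * \<bar>real i - real k\<bar>" 0 "2::real"] by (simp add: decay_def)

text \<open>The two sides of the diagonal are geometric sums with ratio \<open>2 powr (- c)\<close>,
  the one below \<open>k\<close> in reverse order; hence the bound is independent of
  \<open>k\<close>.\<close>

lemma decay_sum:
  assumes c: "c > 0"
  shows "summable (decay c k)" "(\<Sum>i. decay c k i) \<le> 2 / (1 - 2 powr (-c))"
proof -
  define r :: real where "r = 2 powr (-c)"
  have r: "0 < r" "r < 1" using c by (auto simp: r_def powr_less_one)
  have rp: "r ^ j = 2 powr (- c * real j)" for j
    by (simp add: r_def powr_realpow[symmetric] powr_powr)
  have shift: "decay c k (i + k) = r ^ i" for i
    by (simp add: decay_def rp)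
  have "summable (\<lambda>i. decay c k (i + k))" using r by (simp add: shift)
  then show sm: "summable (decay c k)" by (simp only: summable_iff_shift)
  have sg: "summable (\<lambda>i. r ^ i)" "(\<Sum>i. r ^ i) = 1 / (1 - r)" using r by (auto simp: suminf_geometric)
  have "(\<Sum>i. decay c k i) = (\<Sum>i. r ^ i) + (\<Sum>i<k. decay c k i)"
    using suminf_split_initial_segment[OF sm, of k] by (simp add: shift)
  also have "(\<Sum>i<k. decay c k i) = (\<Sum>i<k. r ^ Suc (k - Suc i))"
    by (intro sum.cong) (auto simp: decay_def rp of_nat_diff simp del: power_Suc)
  also have "\<dots> = (\<Sum>i<k. r ^ Suc i)" by (rule sum.nat_diff_reindex)
  also have "\<dots> \<le> (\<Sum>i<k. r ^ i)" using r by (intro sum_mono) (auto intro: power_decreasing simp del: power_Suc)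
  also have "\<dots> \<le> (\<Sum>i. r ^ i)" using r sg by (intro sum_le_suminf) auto
  finally show "(\<Sum>i. decay c k i) \<le> 2 / (1 - 2 powr (-c))" using sg by (simp add: r_def)
qed

text \<open>Splitting the kernel into two equal factors replaces the use of Hoelder's inequality by a
  supremum, so that every exponent \<open>q > 0\<close> is allowed.\<close>
lemma decay_convolution:
  assumes q: "q > 0" and c: "c > 0"
  obtains C where "C > 0" "\<And>e. \<lbrakk>\<forall>i. e i \<ge> 0; summable (\<lambda>i. e i powr q)\<rbrakk> \<Longrightarrow>
      (\<forall>k. summable (\<lambda>i. e i * decay c k i)) \<and> summable (\<lambda>k. (\<Sum>i. e i * decay c k i) powr q) \<and>
      (\<Sum>k. (\<Sum>i. e i * decay c k i) powr q) \<le> C * (\<Sum>i. e i powr q)"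
proof -
  define L where "L b = 2 / (1 - 2 powr (-b))" for b :: real
  have Lpos: "L b > 0" if "b > 0" for b using that by (simp add: L_def powr_less_one)
  \<comment> \<open>Half of the rate \<open>c\<close>, times \<open>q\<close>: the rate of the half
    kernel after it is raised to the power \<open>q\<close>.\<close>
  define \<kappa> where "\<kappa> = c * q / 2"
  have \<kappa>: "\<kappa> > 0" using q c by (simp add: \<kappa>_def)
  show ?thesis
  proof (rule that[of "L (c/2) powr q * L \<kappa>"])
    show "L (c/2) powr q * L \<kappa> > 0" using Lpos[of "c/2"] Lpos[OF \<kappa>] c by simp
    fix e :: "nat \<Rightarrow> real" assume "\<forall>i. e i \<ge> 0" and sm: "summable (\<lambda>i. e i powr q)"
    then have e: "\<And>i. e i \<ge> 0" by blast
    \<comment> \<open>\<open>S k powr (1/q)\<close> dominates every single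
      \<open>e i * decay (c/2) k i\<close>, hence their supremum; the other half of the kernel is
      left for the summation over \<open>i\<close>.\<close>
    define S where "S k = (\<Sum>i. e i powr q * decay \<kappa> k i)" for k
    have smS: "summable (\<lambda>i. e i powr q * decay \<kappa> k i)" for k
      by (rule summable_comparison_test'[OF sm, of 0]) (use decay_le_1[of \<kappa> k] \<kappa> in \<open>auto intro!: mult_left_le\<close>)
    have S0: "S k \<ge> 0" for k unfolding S_def by (intro suminf_nonneg smS) auto
    have term_le: "e i * decay c k i \<le> S k powr (1/q) * decay (c/2) k i" for i k
    proof -
      have "e i powr q * decay \<kappa> k i = (\<Sum>i\<in>{i}. e i powr q * decay \<kappa> k i)" by simp
      also have "\<dots> \<le> S k" unfolding S_def by (intro sum_le_suminf smS) auto
      finally have "(e i powr q * decay \<kappa> k i) powr (1/q) \<le> S k powr (1/q)"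
        using q by (intro powr_mono2) auto
      also have "(e i powr q * decay \<kappa> k i) powr (1/q) = e i * decay (c/2) k i"
        using q e by (simp add: powr_mult powr_powr decay_def \<kappa>_def)
      finally have "e i * decay (c/2) k i * decay (c/2) k i \<le> S k powr (1/q) * decay (c/2) k i"
        by (intro mult_right_mono) auto
      moreover have "decay c k i = decay (c/2) k i * decay (c/2) k i"
        by (simp add: decay_def powr_add[symmetric])
      ultimately show ?thesis by (simp add: mult.assoc)
    qed
    have smd: "summable (\<lambda>i. S k powr (1/q) * decay (c/2) k i)" for k
      using c by (intro summable_mult decay_sum) auto
    have sm1: "summable (\<lambda>i. e i * decay c k i)" for k
      by (rule summable_comparison_test'[OF smd, of 0]) (use term_le e in \<open>auto simp: abs_mult\<close>)
    have le1: "(\<Sum>i. e i * decay c k i) powr q \<le> L (c/2) powr q * S k" for k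
    proof -
      have "(\<Sum>i. e i * decay c k i) \<le> (\<Sum>i. S k powr (1/q) * decay (c/2) k i)"
        by (intro suminf_le term_le sm1 smd)
      also have "\<dots> = S k powr (1/q) * (\<Sum>i. decay (c/2) k i)"
        using c by (intro suminf_mult decay_sum) auto
      also have "\<dots> \<le> S k powr (1/q) * L (c/2)"
        unfolding L_def using c by (intro mult_left_mono decay_sum) auto
      finally have "(\<Sum>i. e i * decay c k i) powr q \<le> (S k powr (1/q) * L (c/2)) powr q"
        using q e by (intro powr_mono2 suminf_nonneg sm1) auto
      also have "\<dots> = L (c/2) powr q * S k"
        using q S0 Lpos[of "c/2"] c by (simp add: powr_mult powr_powr)
      finally show ?thesis .
    qed
    \<comment> \<open>The sums are exchanged; the kernel is symmetric, so its sum over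
      \<open>k\<close> obeys the same bound as its sum over \<open>i\<close>.\<close>
    have sumS: "(\<Sum>k<n. S k) \<le> L \<kappa> * (\<Sum>i. e i powr q)" for n
    proof -
      have "(\<Sum>k<n. S k) = (\<Sum>i. \<Sum>k<n. e i powr q * decay \<kappa> k i)"
        unfolding S_def by (rule suminf_sum[symmetric]) (rule smS)
      also have "\<dots> \<le> (\<Sum>i. L \<kappa> * e i powr q)"
      proof (rule suminf_le)
        show "summable (\<lambda>i. \<Sum>k<n. e i powr q * decay \<kappa> k i)" by (intro summable_sum smS)
        show "summable (\<lambda>i. L \<kappa> * e i powr q)" by (intro summable_mult sm)
        fix i
        have "(\<Sum>k<n. decay \<kappa> k i) = (\<Sum>k<n. decay \<kappa> i k)" by (simp add: decay_commute)
        also have "\<dots> \<le> (\<Sum>k. decay \<kappa> i k)" by (intro sum_le_suminf decay_sum \<kappa>) auto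
        also have "\<dots> \<le> L \<kappa>" unfolding L_def by (rule decay_sum[OF \<kappa>])
        finally have "e i powr q * (\<Sum>k<n. decay \<kappa> k i) \<le> e i powr q * L \<kappa>" by (intro mult_left_mono) auto
        then show "(\<Sum>k<n. e i powr q * decay \<kappa> k i) \<le> L \<kappa> * e i powr q"
          by (simp add: sum_distrib_left mult.commute)
      qed
      also have "\<dots> = L \<kappa> * (\<Sum>i. e i powr q)" by (rule suminf_mult[OF sm])
      finally show ?thesis .
    qed
    have part: "(\<Sum>k<n. (\<Sum>i. e i * decay c k i) powr q) \<le> L (c/2) powr q * L \<kappa> * (\<Sum>i. e i powr q)" for n
    proof -
      have "(\<Sum>k<n. (\<Sum>i. e i * decay c k i) powr q) \<le> (\<Sum>k<n. L (c/2) powr q * S k)"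
        by (intro sum_mono le1)
      also have "\<dots> = L (c/2) powr q * (\<Sum>k<n. S k)" by (simp add: sum_distrib_left)
      also have "\<dots> \<le> L (c/2) powr q * (L \<kappa> * (\<Sum>i. e i powr q))"
        by (intro mult_left_mono sumS) auto
      finally show ?thesis by (simp add: mult.assoc)
    qed
    have sm2: "summable (\<lambda>k. (\<Sum>i. e i * decay c k i) powr q)"
      by (rule summableI_nonneg_bounded[OF _ part]) auto
    show "(\<forall>k. summable (\<lambda>i. e i * decay c k i)) \<and> summable (\<lambda>k. (\<Sum>i. e i * decay c k i) powr q) \<and>
      (\<Sum>k. (\<Sum>i. e i * decay c k i) powr q) \<le> L (c/2) powr q * L \<kappa> * (\<Sum>i. e i powr q)"
      using sm1 sm2 suminf_le_const[OF sm2 part] by blast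
  qed
qed

section \<open>Dyadic blocks of [0,1) and Carleson conditions\<close>

definition dyadic_block :: "nat \<Rightarrow> real set" where
  "dyadic_block i = {1 - 2 powr (- real i) ..< 1 - 2 powr (- real (Suc i))}"

lemma dyadic_block_measurable [measurable]: "dyadic_block i \<in> sets borel"
  by (simp add: dyadic_block_def)

lemma dyadic_block_subset: "dyadic_block i \<subseteq> {1 - 2 powr (- real i)..<1}" "dyadic_block i \<subseteq> {0..<1}"
proof -
  have "2 powr (- real i) \<le> 1" using powr_mono[of "- real i" 0 "2::real"] by simp
  moreover have "0 < 2 powr (- real (Suc i))" by simp
  ultimately show "dyadic_block i \<subseteq> {1 - 2 powr (- real i)..<1}" "dyadic_block i \<subseteq> {0..<1}"
    unfolding dyadic_block_def by auto
qed

lemma dyadic_block_cover: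
  assumes "t \<in> {0..<1}" obtains i where "t \<in> dyadic_block i"
proof -
  obtain k :: nat where k: "2 powr (- real k) < 1 - t" "1 - t \<le> 2 powr (1 - real k)"
    using dyadic_index[of "1 - t"] assms by auto
  have "k \<noteq> 0" using k assms by (intro notI) auto
  then obtain i where "k = Suc i" by (cases k) auto
  then show ?thesis using k that[of i] by (auto simp: dyadic_block_def)
qed

lemma dyadic_block_mem: "t \<in> dyadic_block i \<longleftrightarrow> 2 powr (- real i) \<ge> 1 - t \<and> 1 - t > 2 powr (- real i) / 2"
proof -
  have "2 powr (- real (Suc i)) = 2 powr (- real i) / (2::real)"
    by (simp add: powr_diff powr_minus_divide)
  then show ?thesis by (auto simp: dyadic_block_def)
qed

lemma nn_integral_dyadic:
  assumes mu: "measure_on_01 \<mu>" and fin: "emeasure \<mu> {0..<1} < \<infinity>"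
    and \<Phi>: "\<And>i. \<Phi> i \<ge> 0" and sm: "summable (\<lambda>i. \<Phi> i * measure \<mu> (dyadic_block i))"
    and le: "\<And>t i. t \<in> dyadic_block i \<Longrightarrow> \<phi> t \<le> ennreal (\<Phi> i)"
  shows "(\<integral>\<^sup>+t. \<phi> t \<partial>\<mu>) \<le> ennreal (\<Sum>i. \<Phi> i * measure \<mu> (dyadic_block i))"
proof -
  have sets: "sets \<mu> = sets borel" and null: "emeasure \<mu> (UNIV - {0..<1}) = 0"
    using mu by (auto simp: measure_on_01_def)
  have sp: "space \<mu> = UNIV" using sets_eq_imp_space_eq[OF sets] by simp
  have AE: "AE t in \<mu>. t \<in> {0..<1}"
    by (rule AE_I[OF _ null]) (auto simp: sets sp)
  have m: "ennreal (measure \<mu> (dyadic_block i)) = emeasure \<mu> (dyadic_block i)" for i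
  proof -
    have "emeasure \<mu> (dyadic_block i) \<le> emeasure \<mu> {0..<1}"
      by (intro emeasure_mono dyadic_block_subset) (simp add: sets)
    then show ?thesis using fin by (intro emeasure_eq_ennreal_measure[symmetric]) (auto simp: top_unique)
  qed
  have "(\<integral>\<^sup>+t. \<phi> t \<partial>\<mu>) \<le> (\<integral>\<^sup>+t. (\<Sum>i. ennreal (\<Phi> i) * indicator (dyadic_block i) t) \<partial>\<mu>)"
  proof (rule nn_integral_mono_AE, use AE in eventually_elim)
    case (elim t)
    then obtain i where i: "t \<in> dyadic_block i" by (rule dyadic_block_cover)
    define T where "T j = ennreal (\<Phi> j) * indicator (dyadic_block j) t" for j
    have "\<phi> t \<le> T i" using le[OF i] i by (simp add: T_def)
    also have "T i = sum T {i}" by simp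
    also have "\<dots> \<le> suminf T" by (rule sum_le_suminf) auto
    finally show ?case by (simp only: T_def[abs_def])
  qed
  also have "\<dots> = (\<Sum>i. \<integral>\<^sup>+t. ennreal (\<Phi> i) * indicator (dyadic_block i) t \<partial>\<mu>)"
    by (intro nn_integral_suminf) (simp add: sets cong: measurable_cong_sets)
  also have "\<dots> = (\<Sum>i. ennreal (\<Phi> i * measure \<mu> (dyadic_block i)))"
    using \<Phi> by (simp add: nn_integral_cmult_indicator sets m ennreal_mult')
  also have "\<dots> = ennreal (\<Sum>i. \<Phi> i * measure \<mu> (dyadic_block i))"
    using \<Phi> by (intro suminf_ennreal2 sm) auto
  finally show ?thesis .
qed

lemma carleson_finite:
  assumes "carleson \<mu> s" shows "emeasure \<mu> {0..<1} < \<infinity>"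
proof -
  obtain C where "emeasure \<mu> {0..<1} \<le> ennreal (C * (1 - 0) powr s)"
    using assms unfolding carleson_def by (metis order_refl zero_less_one)
  then show ?thesis by (metis ennreal_less_top infinity_ennreal_def order_le_less_trans)
qed

text \<open>Whatever \<open>p\<close> is, one clause of the condition applies, and its Carleson
  bound at t = 0 bounds the total mass. Finiteness of the measure on [0,1) in turn makes all moments
  finite.\<close>

lemma cond_W_finite:
  assumes "cond_W \<mu> p \<alpha>" shows "emeasure \<mu> {0..<1} < \<infinity>"
  using assms carleson_finite unfolding cond_W_def by (metis linorder_le_cases)

text \<open>Near 1 the choice \<epsilon> = 1 suffices. At distance at least \<delta> from 1 the
  factor \<open>(1 - t) powr s\<close> is bounded below, and the total mass is absorbed in the
  constant.\<close>

lemma vanishing_carleson_imp_carleson: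
  assumes van: "vanishing_carleson \<mu> s" and fin: "emeasure \<mu> {0..<1} < \<infinity>"
    and sets: "sets \<mu> = sets borel" and s: "s \<ge> 0"
  shows "carleson \<mu> s"
proof -
  obtain \<delta> where \<delta>: "\<delta> > 0" and le: "\<And>t. 1 - \<delta> < t \<Longrightarrow> t < 1 \<Longrightarrow> emeasure \<mu> {t..<1} \<le> ennreal (1 * (1 - t) powr s)"
    using van unfolding vanishing_carleson_def by (meson zero_less_one)
  define M where "M = enn2real (emeasure \<mu> {0..<1})"
  define C where "C = max 1 (M / \<delta> powr s)"
  have "emeasure \<mu> {t..<1} \<le> ennreal (C * (1 - t) powr s)" if t: "0 \<le> t" "t < 1" for t
  proof (cases "1 - \<delta> < t")
    case True
    have "emeasure \<mu> {t..<1} \<le> ennreal (1 * (1 - t) powr s)" using le True t by auto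
    also have "\<dots> \<le> ennreal (C * (1 - t) powr s)" by (intro ennreal_leI mult_right_mono) (auto simp: C_def)
    finally show ?thesis .
  next
    case False
    have "emeasure \<mu> {t..<1} \<le> emeasure \<mu> {0..<1}" using t by (intro emeasure_mono) (auto simp: sets)
    also have "\<dots> = ennreal M" using fin by (simp add: M_def)
    also have "\<dots> \<le> ennreal (C * (1 - t) powr s)"
    proof (rule ennreal_leI)
      have "M = M / \<delta> powr s * \<delta> powr s" using \<delta> by simp
      also have "\<dots> \<le> C * (1 - t) powr s"
        using False \<delta> s by (intro mult_mono powr_mono2) (auto simp: C_def M_def)
      finally show "M \<le> C * (1 - t) powr s" .
    qed
    finally show ?thesis .
  qed
  then show ?thesis unfolding carleson_def by blast
qed

lemma measure_dyadic_block_le: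
  assumes sets: "sets \<mu> = sets borel" and le: "emeasure \<mu> {1 - 2 powr (- real i)..<1} \<le> ennreal (C * (2 powr (- real i)) powr s)"
    and C: "C \<ge> 0"
  shows "measure \<mu> (dyadic_block i) \<le> C * 2 powr (- real i * s)"
proof -
  have "emeasure \<mu> (dyadic_block i) \<le> emeasure \<mu> {1 - 2 powr (- real i)..<1}"
    by (intro emeasure_mono dyadic_block_subset) (auto simp: sets)
  also note le
  finally show ?thesis using C unfolding measure_def by (intro enn2real_leI) (auto simp: powr_powr)
qed

lemma carleson_dyadic:
  assumes sets: "sets \<mu> = sets borel" and "carleson \<mu> s"
  obtains C where "C > 0" "\<And>i. measure \<mu> (dyadic_block i) \<le> C * 2 powr (- real i * s)"
proof -
  obtain C where C: "\<And>t. 0 \<le> t \<Longrightarrow> t < 1 \<Longrightarrow> emeasure \<mu> {t..<1} \<le> ennreal (C * (1 - t) powr s)"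
    using assms unfolding carleson_def by blast
  show ?thesis
  proof (rule that[of "max 1 C"])
    fix i
    have "2 powr (- real i) \<le> 1" using powr_mono[of "- real i" 0 "2::real"] by simp
    then have "emeasure \<mu> {1 - 2 powr (- real i)..<1} \<le> ennreal (C * (1 - (1 - 2 powr (- real i))) powr s)"
      by (intro C) auto
    also have "\<dots> \<le> ennreal (max 1 C * (2 powr (- real i)) powr s)"
      by (intro ennreal_leI) (auto intro: mult_right_mono)
    finally show "measure \<mu> (dyadic_block i) \<le> max 1 C * 2 powr (- real i * s)"
      by (intro measure_dyadic_block_le[OF sets]) auto
  qed simp
qed

subsection \<open>Integral representation of the Hankel operator\<close>

text \<open>The Taylor coefficients of (1 - w) powr (- b), which are the Gamma factor in
  \<open>mu_coef\<close>.\<close>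

definition binomial_weight :: "real \<Rightarrow> nat \<Rightarrow> real" where
  "binomial_weight b n = Gamma (real n + b) / (fact n * Gamma b)"

lemma binomial_weight_nonneg: "b > 0 \<Longrightarrow> binomial_weight b n \<ge> 0"
  unfolding binomial_weight_def
  by (intro divide_nonneg_nonneg mult_nonneg_nonneg less_imp_le[OF Gamma_real_pos]) auto

lemma binomial_weight_0:
  assumes "b > 0" shows "binomial_weight b 0 = 1"
  using Gamma_real_pos[OF assms] by (simp add: binomial_weight_def)

text \<open>Differentiating (1 - w) powr (- b) turns the exponent \<open>b\<close> into
  \<open>b + 1\<close> and produces the factor \<open>b\<close>; this is the same fact for
  coefficients.\<close>

lemma binomial_weight_Suc:
  assumes "b > 0"
  shows "real (Suc n) * binomial_weight b (Suc n) = b * binomial_weight (b + 1) n"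
proof -
  have "b \<notin> \<int>\<^sub>\<le>\<^sub>0" using assms by (auto elim: nonpos_Ints_cases)
  then have "Gamma (b + 1) = b * Gamma b" by (rule Gamma_plus1)
  moreover define G where "G = Gamma (real n + (b + 1))"
  moreover have "real (Suc n) + b = real n + (b + 1)" by simp
  ultimately show ?thesis using assms Gamma_real_pos[of b]
    unfolding binomial_weight_def by (simp only: G_def[symmetric]) (simp add: field_simps del: of_nat_Suc)
qed

lemma binomial_weight_sums:
  fixes w :: complex
  assumes b: "b > 0" and w: "norm w < 1"
  shows "(\<lambda>n. of_real (binomial_weight b n) * w ^ n) sums ((1 - w) powr (- of_real b))"
proof -
  have nb: "b \<notin> \<int>\<^sub>\<le>\<^sub>0" using b by (auto elim: nonpos_Ints_cases)
  have "(- complex_of_real b gchoose n) * (- w) ^ n = of_real (binomial_weight b n) * w ^ n" for n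
  proof -
    have "- complex_of_real b gchoose n = (-1) ^ n * of_real (pochhammer b n / fact n)"
      unfolding gbinomial_pochhammer by (simp add: pochhammer_of_real)
    also have "pochhammer b n / fact n = binomial_weight b n"
      by (simp add: pochhammer_Gamma[OF nb] binomial_weight_def add.commute mult.commute)
    finally show ?thesis
      by (simp add: power_mult_distrib[symmetric] mult_ac)
  qed
  then show ?thesis
    using gen_binomial_complex[of "- w" "- of_real b"] w by simp
qed

lemma binomial_weight_summable:
  assumes b: "b > 0" and x: "0 \<le> x" "x < 1"
  shows "summable (\<lambda>n. binomial_weight b n * x ^ n)"
proof -
  have "summable (\<lambda>n. of_real (binomial_weight b n * x ^ n) :: complex)"
    using binomial_weight_sums[of b "of_real x"] b x by (simp add: sums_iff)
  then show ?thesis by (simp only: summable_of_real_iff)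
qed

text \<open>Since 1 - z = (1 - t z) - (1 - t) z and 1 - t \<le> |1 - t z|, the number |1 - z| is at
  most twice |1 - t z|.\<close>

lemma norm_one_minus_mult_ge:
  fixes z :: complex
  assumes t: "0 \<le> t" "t \<le> 1" and z: "norm z \<le> 1"
  shows "max (1 - t) (norm (1 - z)) / 2 \<le> norm (1 - of_real t * z)"
proof -
  have "t * norm z \<le> t * 1" using t z by (intro mult_left_mono) auto
  then have 1: "1 - t \<le> norm (1 - of_real t * z)"
    using norm_triangle_ineq2[of 1 "of_real t * z"] t by (simp add: norm_mult)
  have "norm (1 - z) \<le> norm (1 - of_real t * z) + norm (of_real (1 - t) * z)"
    using norm_triangle_ineq4[of "1 - of_real t * z" "of_real (1 - t) * z"] by (simp add: algebra_simps)
  also have "norm (of_real (1 - t) * z) \<le> (1 - t) * 1"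
    using t z by (simp only: norm_mult norm_of_real) (intro mult_mono, auto)
  finally show ?thesis using 1 t by auto
qed

text \<open>The restriction to the radius is cut off outside the disc, where \<open>f\<close> is arbitrary and need not
  be measurable.\<close>
definition radial :: "(complex \<Rightarrow> complex) \<Rightarrow> real \<Rightarrow> complex" where
  "radial f t = indicator {0..<1} t *\<^sub>R f (of_real t)"

lemma radial_eq [simp]: "t \<in> {0..<1} \<Longrightarrow> radial f t = f (of_real t)"
  by (simp add: radial_def)

lemma radial_measurable:
  assumes "f holomorphic_on ball 0 1"
  shows "radial f \<in> borel_measurable borel"
  unfolding radial_def[abs_def]
  by (intro borel_measurable_continuous_on_indicator
        continuous_on_compose2[OF holomorphic_on_imp_continuous_on[OF assms]])
     (auto intro!: continuous_intros)

text \<open>That \<open>\<mu>\<close> is carried by [0,1) is kept as an almost-everywhere statement,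
  the form in which integrals consume it.\<close>

locale measure_01 = finite_measure \<mu> for \<mu> :: "real measure" +
  assumes sets_mu [measurable_cong, simp]: "sets \<mu> = sets borel"
    and AE_01: "AE t in \<mu>. t \<in> {0..<1}"
begin

lemma space_mu [simp]: "space \<mu> = UNIV"
  using sets_eq_imp_space_eq[OF sets_mu] by simp

lemma AE_01I: "(\<And>t. t \<in> {0..<1} \<Longrightarrow> P t) \<Longrightarrow> AE t in \<mu>. P t"
  using AE_01 by (auto elim!: eventually_mono simp del: atLeastLessThan_iff)

lemma integrable_bounded:
  fixes h :: "real \<Rightarrow> 'b :: {banach, second_countable_topology}"
  assumes "h \<in> borel_measurable borel" "\<And>t. t \<in> {0..<1} \<Longrightarrow> norm (h t) \<le> B"
  shows "integrable \<mu> h"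
  by (rule integrable_const_bound[where B=B])
     (use assms in \<open>auto cong: measurable_cong_sets intro!: AE_01I\<close>)

lemma integrable_power: "integrable \<mu> (\<lambda>t. t ^ n)"
  by (rule integrable_bounded[where B=1]) (auto simp: power_le_one norm_power)

lemma moment_nonneg: "(\<integral>t. t ^ n \<partial>\<mu>) \<ge> 0"
  by (rule integral_nonneg_AE) (auto intro!: AE_01I)

lemma moment_antimono: "(\<integral>t. t ^ (n + k) \<partial>\<mu>) \<le> (\<integral>t. t ^ k \<partial>\<mu>)"
  by (rule integral_mono_AE[OF integrable_power integrable_power])
     (auto intro!: AE_01I power_decreasing)

context
  fixes f :: "complex \<Rightarrow> complex" and b :: real
  assumes b: "b > 0" and hol: "f holomorphic_on ball 0 1"
    and sm: "summable (\<lambda>k. norm (taylor_coeff f k) * (\<integral>t. t ^ k \<partial>\<mu>))"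
begin

private lemma taylor_sums:
  assumes "norm z < 1" shows "(\<lambda>k. taylor_coeff f k * z ^ k) sums f z"
  using holomorphic_power_series[OF hol, of z] assms by (simp add: taylor_coeff_def)

private lemma taylor_abs_summable:
  assumes "t \<in> {0..<1}" shows "summable (\<lambda>k. norm (taylor_coeff f k) * t ^ k)"
proof -
  have "summable (\<lambda>k. norm (taylor_coeff f k * of_real t ^ k))"
  proof (rule powser_insidea)
    have n: "norm (complex_of_real ((1 + t) / 2)) = (1 + t) / 2"
      using assms by (subst norm_of_real) auto
    show "summable (\<lambda>k. taylor_coeff f k * of_real ((1 + t) / 2) ^ k)"
      using taylor_sums[of "of_real ((1 + t) / 2)"] assms unfolding n by (simp add: sums_iff)
    show "norm (complex_of_real t) < norm (complex_of_real ((1 + t) / 2))"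
      using assms unfolding n by simp
  qed
  then show ?thesis using assms by (simp add: norm_mult norm_power)
qed

text \<open>The power series of \<open>f\<close> is integrated term by term: the L1 norms of the
  terms are dominated by the summability hypothesis of the context, as t^n \<le> 1 on [0,1). That
  hypothesis is later verified by \<open>dirichlet_summable\<close> for the source space and by
  \<open>test_fun_summable\<close> for the test functions.\<close>

private lemma moment_expansion:
  shows "integrable \<mu> (\<lambda>t. of_real (t ^ n) * radial f t)"
    and "(\<lambda>k. of_real (\<integral>t. t ^ (n + k) \<partial>\<mu>) * taylor_coeff f k) sums (\<integral>t. of_real (t ^ n) * radial f t \<partial>\<mu>)"
proof -
  define h where "h k t = complex_of_real (t ^ (n + k)) * taylor_coeff f k" for k and t :: real
  have inth: "integrable \<mu> (h k)" for k
    unfolding h_def by (intro integrable_mult_left integrable_of_real integrable_power)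
  have valh: "(\<integral>t. h k t \<partial>\<mu>) = of_real (\<integral>t. t ^ (n + k) \<partial>\<mu>) * taylor_coeff f k" for k
  proof -
    have "(\<integral>t. h k t \<partial>\<mu>) = (\<integral>t. complex_of_real (t ^ (n + k)) \<partial>\<mu>) * taylor_coeff f k"
      unfolding h_def by (rule integral_mult_left_zero)
    then show ?thesis by (simp only: integral_complex_of_real)
  qed
  have normh: "(\<integral>t. norm (h k t) \<partial>\<mu>) = (\<integral>t. t ^ (n + k) \<partial>\<mu>) * norm (taylor_coeff f k)" for k
  proof -
    have "(\<integral>t. norm (h k t) \<partial>\<mu>) = (\<integral>t. t ^ (n + k) * norm (taylor_coeff f k) \<partial>\<mu>)"
    proof (rule integral_cong_AE)
      show "AE t in \<mu>. norm (h k t) = t ^ (n + k) * norm (taylor_coeff f k)"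
        using AE_01 by eventually_elim (auto simp: h_def norm_mult norm_power)
    qed (use inth in auto)
    also have "\<dots> = (\<integral>t. t ^ (n + k) \<partial>\<mu>) * norm (taylor_coeff f k)"
      by (rule integral_mult_left_zero)
    finally show ?thesis .
  qed
  have AEs: "AE t in \<mu>. summable (\<lambda>k. norm (h k t))"
    using AE_01
  proof eventually_elim
    case (elim t)
    have "norm (h k t) = t ^ n * (norm (taylor_coeff f k) * t ^ k)" for k
      using elim by (simp add: h_def norm_mult norm_power power_add mult_ac)
    then show ?case by (simp only:) (intro summable_mult taylor_abs_summable elim)
  qed
  have smh: "summable (\<lambda>k. \<integral>t. norm (h k t) \<partial>\<mu>)"
    by (rule summable_comparison_test'[OF sm, of 0])
       (auto simp: normh abs_mult moment_nonneg mult.commute intro!: mult_left_mono moment_antimono)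
  have sumh: "(\<Sum>k. h k t) = of_real (t ^ n) * f (of_real t)" if t: "t \<in> {0..<1}" for t
  proof -
    have "(\<lambda>k. of_real (t ^ n) * (taylor_coeff f k * of_real t ^ k)) sums (of_real (t ^ n) * f (of_real t))"
      using t by (intro sums_mult taylor_sums) auto
    moreover have "of_real (t ^ n) * (taylor_coeff f k * of_real t ^ k) = h k t" for k
      by (simp add: h_def power_add mult_ac)
    ultimately show ?thesis by (simp add: sums_iff)
  qed
  have AEeq: "AE t in \<mu>. (\<Sum>k. h k t) = of_real (t ^ n) * radial f t"
    using AE_01 by eventually_elim (simp add: sumh)
  have meas: "(\<lambda>t. of_real (t ^ n) * radial f t) \<in> borel_measurable \<mu>"
    using radial_measurable[OF hol] by (intro borel_measurable_times) (auto cong: measurable_cong_sets)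
  have meas2: "(\<lambda>t. \<Sum>k. h k t) \<in> borel_measurable \<mu>"
    using integrable_suminf[OF inth AEs smh] by simp
  show "integrable \<mu> (\<lambda>t. of_real (t ^ n) * radial f t)"
    using integrable_suminf[OF inth AEs smh] integrable_cong_AE[OF meas2 meas AEeq] by simp
  have "(\<lambda>k. \<integral>t. h k t \<partial>\<mu>) sums (\<integral>t. (\<Sum>k. h k t) \<partial>\<mu>)"
    by (rule sums_integral[OF inth AEs smh])
  then show "(\<lambda>k. of_real (\<integral>t. t ^ (n + k) \<partial>\<mu>) * taylor_coeff f k) sums (\<integral>t. of_real (t ^ n) * radial f t \<partial>\<mu>)"
    using integral_cong_AE[OF meas2 meas AEeq] by (simp add: valh)
qed

lemma integrable_radial: "integrable \<mu> (radial f)"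
  using moment_expansion(1)[of 0] by simp

private definition "moment n = (\<integral>t. of_real (t ^ n) * radial f t \<partial>\<mu>)"

private lemma norm_moment_le: "norm (moment n) \<le> (\<integral>t. norm (radial f t) \<partial>\<mu>)"
proof -
  have "norm (moment n) \<le> (\<integral>t. norm (of_real (t ^ n) * radial f t) \<partial>\<mu>)"
    unfolding moment_def by (rule integral_norm_bound)
  also have "\<dots> \<le> (\<integral>t. norm (radial f t) \<partial>\<mu>)"
  proof (rule integral_mono_AE[OF integrable_norm[OF moment_expansion(1)] integrable_norm[OF integrable_radial]], rule AE_01I)
    fix t :: real assume "t \<in> {0..<1}"
    then have "t ^ n * norm (radial f t) \<le> 1 * norm (radial f t)"
      by (intro mult_right_mono power_le_one) auto
    then show "norm (of_real (t ^ n) * radial f t) \<le> norm (radial f t)"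
      using \<open>t \<in> {0..<1}\<close> by (simp add: norm_mult norm_power)
  qed
  finally show ?thesis .
qed

lemma H_coeff_eq: "H_coeff \<mu> b f n = of_real (binomial_weight b n) * (\<integral>t. of_real (t ^ n) * radial f t \<partial>\<mu>)"
  and H_coeff_summable: "summable (\<lambda>k. of_real (mu_coef \<mu> b n k) * taylor_coeff f k)"
proof -
  have "(\<lambda>k. of_real (binomial_weight b n) * (of_real (\<integral>t. t ^ (n + k) \<partial>\<mu>) * taylor_coeff f k)) sums
      (of_real (binomial_weight b n) * (\<integral>t. of_real (t ^ n) * radial f t \<partial>\<mu>))"
    by (intro sums_mult moment_expansion)
  then have "(\<lambda>k. of_real (mu_coef \<mu> b n k) * taylor_coeff f k) sums
      (of_real (binomial_weight b n) * (\<integral>t. of_real (t ^ n) * radial f t \<partial>\<mu>))"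
    by (simp add: mu_coef_def binomial_weight_def mult.assoc)
  then show "H_coeff \<mu> b f n = of_real (binomial_weight b n) * (\<integral>t. of_real (t ^ n) * radial f t \<partial>\<mu>)"
    "summable (\<lambda>k. of_real (mu_coef \<mu> b n k) * taylor_coeff f k)"
    by (auto simp: H_coeff_def sums_iff)
qed

text \<open>The free index map and exponent serve two series: that of the operator, with
  \<open>c = b\<close>, and that of its derivative, with \<open>c = b + 1\<close> and
  \<open>Suc\<close>.\<close>

private lemma weighted_moment_summable:
  assumes "norm z < 1" "c > 0"
  shows "summable (\<lambda>n. of_real (binomial_weight c n) * moment (g n) * z ^ n)"
proof (rule summable_comparison_test'[where N=0])
  show "summable (\<lambda>n. (\<integral>t. norm (radial f t) \<partial>\<mu>) * (binomial_weight c n * norm z ^ n))"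
    using assms by (intro summable_mult binomial_weight_summable) auto
  fix n
  have "norm (of_real (binomial_weight c n) * moment (g n) * z ^ n) = norm (moment (g n)) * (binomial_weight c n * norm z ^ n)"
    using binomial_weight_nonneg[OF assms(2)] by (simp add: norm_mult norm_power)
  also have "\<dots> \<le> (\<integral>t. norm (radial f t) \<partial>\<mu>) * (binomial_weight c n * norm z ^ n)"
    using binomial_weight_nonneg[OF assms(2)] by (intro mult_right_mono norm_moment_le) auto
  finally show "norm (of_real (binomial_weight c n) * moment (g n) * z ^ n) \<le> (\<integral>t. norm (radial f t) \<partial>\<mu>) * (binomial_weight c n * norm z ^ n)" .
qed

private lemma Hankel_sums:
  assumes "norm z < 1"
  shows "(\<lambda>n. H_coeff \<mu> b f n * z ^ n) sums Hankel \<mu> b f z"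
  using weighted_moment_summable[OF assms b, of "\<lambda>n. n"]
  by (simp add: Hankel_def H_coeff_eq moment_def sums_iff)

lemma H_defined: "H_defined \<mu> b f"
  unfolding H_defined_def using H_coeff_summable Hankel_sums by (auto simp: sums_iff)

lemma Hankel_holomorphic: "Hankel \<mu> b f holomorphic_on ball 0 1"
  by (rule power_series_holomorphic[where a="H_coeff \<mu> b f"]) (use Hankel_sums in auto)

lemma Hankel_0: "Hankel \<mu> b f 0 = (\<integral>t. radial f t \<partial>\<mu>)"
  using b by (simp add: Hankel_def H_coeff_eq binomial_weight_0)

private lemma deriv_Hankel_sums:
  assumes z: "norm z < 1"
  shows "(\<lambda>n. of_real b * (of_real (binomial_weight (b + 1) n) * moment (Suc n) * z ^ n)) sums deriv (Hankel \<mu> b f) z"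
proof -
  have "((\<lambda>z. \<Sum>n. H_coeff \<mu> b f n * z ^ n) has_field_derivative (\<Sum>n. diffs (H_coeff \<mu> b f) n * z ^ n)) (at z)"
    by (rule termdiffs_strong'[where K=1]) (use z Hankel_sums in \<open>auto simp: sums_iff\<close>)
  then have "(Hankel \<mu> b f has_field_derivative (\<Sum>n. diffs (H_coeff \<mu> b f) n * z ^ n)) (at z)"
    by (simp add: Hankel_def[abs_def])
  then have "deriv (Hankel \<mu> b f) z = (\<Sum>n. diffs (H_coeff \<mu> b f) n * z ^ n)"
    by (rule DERIV_imp_deriv)
  also have "(\<lambda>n. diffs (H_coeff \<mu> b f) n * z ^ n) = (\<lambda>n. of_real b * (of_real (binomial_weight (b + 1) n) * moment (Suc n) * z ^ n))"
  proof
    fix n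
    have "diffs (H_coeff \<mu> b f) n = of_real (real (Suc n) * binomial_weight b (Suc n)) * moment (Suc n)"
      by (simp add: diffs_def H_coeff_eq moment_def mult.assoc)
    also have "\<dots> = of_real b * of_real (binomial_weight (b + 1) n) * moment (Suc n)"
      unfolding binomial_weight_Suc[OF b] by simp
    finally show "diffs (H_coeff \<mu> b f) n * z ^ n = of_real b * (of_real (binomial_weight (b + 1) n) * moment (Suc n) * z ^ n)"
      by (simp add: mult_ac)
  qed
  finally show ?thesis
    using summable_mult[OF weighted_moment_summable[OF z, of "b + 1" Suc], of "of_real b"] b by (simp add: sums_iff)
qed

text \<open>The binomial series of the kernel is summed under the integral; for fixed |z| < 1 its
  terms are dominated by \<open>norm (radial f t)\<close> times a convergent numerical series. The
  factor \<open>t\<close> stems from the index shift under differentiation, which by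
  \<open>binomial_weight_Suc\<close> also raises the exponent to \<open>b + 1\<close>.\<close>

lemma deriv_Hankel:
  assumes z: "norm z < 1"
  shows "integrable \<mu> (\<lambda>t. of_real t * radial f t * (1 - of_real t * z) powr (- of_real (b + 1)))"
    and "deriv (Hankel \<mu> b f) z = of_real b * (\<integral>t. of_real t * radial f t * (1 - of_real t * z) powr (- of_real (b + 1)) \<partial>\<mu>)"
proof -
  define c where "c = binomial_weight (b + 1)"
  have c0: "c n \<ge> 0" for n using b by (simp add: c_def binomial_weight_nonneg)
  define h where "h n t = of_real (c n) * z ^ n * (of_real (t ^ Suc n) * radial f t)" for n t
  let ?k = "\<lambda>t. of_real t * radial f t * (1 - of_real t * z) powr (- of_real (b + 1))"
  have inth: "integrable \<mu> (h n)" for n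
    unfolding h_def by (intro integrable_mult_right moment_expansion)
  have valh: "(\<integral>t. h n t \<partial>\<mu>) = of_real (c n) * moment (Suc n) * z ^ n" for n
  proof -
    have "(\<integral>t. h n t \<partial>\<mu>) = of_real (c n) * z ^ n * moment (Suc n)"
      unfolding h_def moment_def by (rule integral_mult_right_zero)
    then show ?thesis by (simp only: mult_ac)
  qed
  have nh: "norm (h n t) \<le> norm (radial f t) * (c n * norm z ^ n)" if "t \<in> {0..<1}" for n t
  proof -
    have "norm (h n t) = (c n * norm z ^ n * norm (radial f t)) * t ^ Suc n"
      using that c0 by (simp add: h_def norm_mult norm_power)
    also have "\<dots> \<le> (c n * norm z ^ n * norm (radial f t)) * 1"
      using that c0 by (intro mult_left_mono power_le_one) auto
    finally show ?thesis by (simp add: mult_ac)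
  qed
  have smc: "summable (\<lambda>n. c n * norm z ^ n)"
    unfolding c_def using z b by (intro binomial_weight_summable) auto
  have AEs: "AE t in \<mu>. summable (\<lambda>n. norm (h n t))"
    using AE_01
  proof eventually_elim
    case (elim t)
    show ?case
      by (rule summable_comparison_test'[OF summable_mult[OF smc, of "norm (radial f t)"], of 0]) (use nh[OF elim] in auto)
  qed
  have smh: "summable (\<lambda>n. \<integral>t. norm (h n t) \<partial>\<mu>)"
  proof (rule summable_comparison_test'[OF summable_mult[OF smc, of "\<integral>t. norm (radial f t) \<partial>\<mu>"], of 0])
    fix n
    have "(\<integral>t. norm (h n t) \<partial>\<mu>) \<le> (\<integral>t. norm (radial f t) * (c n * norm z ^ n) \<partial>\<mu>)"
      by (rule integral_mono_AE)
         (use nh in \<open>auto intro!: AE_01I integrable_norm inth integrable_mult_left integrable_radial\<close>)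
    also have "\<dots> = (\<integral>t. norm (radial f t) \<partial>\<mu>) * (c n * norm z ^ n)"
      by (rule integral_mult_left_zero)
    finally show "norm (\<integral>t. norm (h n t) \<partial>\<mu>) \<le> (\<integral>t. norm (radial f t) \<partial>\<mu>) * (c n * norm z ^ n)"
      by simp
  qed
  have AEeq: "AE t in \<mu>. (\<Sum>n. h n t) = ?k t"
    using AE_01
  proof eventually_elim
    case (elim t)
    have "norm (of_real t * z) < 1"
    proof -
      have "t * norm z \<le> 1 * norm z" using elim by (intro mult_right_mono) auto
      then show ?thesis using z elim by (simp add: norm_mult)
    qed
    then have "(\<lambda>n. of_real t * radial f t * (of_real (c n) * (of_real t * z) ^ n)) sums ?k t"
      unfolding c_def using b by (intro sums_mult binomial_weight_sums) auto
    moreover have "of_real t * radial f t * (of_real (c n) * (of_real t * z) ^ n) = h n t" for n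
      by (simp add: h_def power_mult_distrib mult_ac)
    ultimately show ?case by (simp add: sums_iff)
  qed
  have meas: "?k \<in> borel_measurable \<mu>"
  proof -
    have [measurable]: "radial f \<in> borel_measurable borel" by (rule radial_measurable[OF hol])
    show ?thesis by measurable
  qed
  have meas2: "(\<lambda>t. \<Sum>n. h n t) \<in> borel_measurable \<mu>"
    using integrable_suminf[OF inth AEs smh] by simp
  show "integrable \<mu> ?k"
    using integrable_suminf[OF inth AEs smh] integrable_cong_AE[OF meas2 meas AEeq] by simp
  have "(\<lambda>n. of_real b * (\<integral>t. h n t \<partial>\<mu>)) sums (of_real b * (\<integral>t. (\<Sum>n. h n t) \<partial>\<mu>))"
    by (intro sums_mult sums_integral[OF inth AEs smh])
  then show "deriv (Hankel \<mu> b f) z = of_real b * (\<integral>t. ?k t \<partial>\<mu>)"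
    using deriv_Hankel_sums[OF z] integral_cong_AE[OF meas2 meas AEeq]
    by (simp add: valh c_def sums_iff)
qed

text \<open>The kernel is replaced by a quantity depending only on the sizes of \<open>1 - t\<close>
  and \<open>norm (1 - z)\<close>, which is constant up to a bounded factor on products of dyadic
  pieces.\<close>

lemma norm_deriv_Hankel_le:
  assumes z: "norm z < 1"
  shows "ennreal (norm (deriv (Hankel \<mu> b f) z)) \<le>
    ennreal (b * 2 powr (b + 1)) * (\<integral>\<^sup>+t. ennreal (norm (radial f t) * max (1 - t) (norm (1 - z)) powr (- (b + 1))) \<partial>\<mu>)"
proof -
  let ?k = "\<lambda>t. of_real t * radial f t * (1 - of_real t * z) powr (- of_real (b + 1))"
  have [measurable]: "radial f \<in> borel_measurable borel" by (rule radial_measurable[OF hol])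
  have "ennreal (norm (\<integral>t. ?k t \<partial>\<mu>)) \<le> (\<integral>\<^sup>+t. ennreal (norm (?k t)) \<partial>\<mu>)"
    by (rule integral_norm_bound_ennreal[OF deriv_Hankel(1)[OF z]])
  also have "\<dots> \<le> (\<integral>\<^sup>+t. ennreal (2 powr (b + 1)) * ennreal (norm (radial f t) * max (1 - t) (norm (1 - z)) powr (- (b + 1))) \<partial>\<mu>)"
  proof (rule nn_integral_mono_AE, use AE_01 in eventually_elim)
    case (elim t)
    define m where "m = max (1 - t) (norm (1 - z))"
    have m: "m > 0" using elim by (auto simp: m_def)
    have le: "m / 2 \<le> norm (1 - of_real t * z)"
      unfolding m_def using elim z by (intro norm_one_minus_mult_ge) auto
    have "norm (?k t) = t * (norm (radial f t) * norm (1 - of_real t * z) powr (- (b + 1)))"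
      using elim by (subst norm_mult, subst norm_powr_real_powr') (auto simp: norm_mult)
    also have "\<dots> \<le> 1 * (norm (radial f t) * (m / 2) powr (- (b + 1)))"
      using elim le m b by (intro mult_mono powr_mono2') auto
    also have "(m / 2) powr (- (b + 1)) = 2 powr (b + 1) * m powr (- (b + 1))"
      using m by (simp add: powr_divide powr_minus_divide del: minus_add_distrib)
    finally show ?case by (simp add: ennreal_mult'[symmetric] m_def mult_ac ennreal_leI)
  qed
  also have "\<dots> = ennreal (2 powr (b + 1)) * (\<integral>\<^sup>+t. ennreal (norm (radial f t) * max (1 - t) (norm (1 - z)) powr (- (b + 1))) \<partial>\<mu>)"
    by (rule nn_integral_cmult) measurable
  finally have "ennreal b * ennreal (norm (\<integral>t. ?k t \<partial>\<mu>)) \<le> ennreal b * (ennreal (2 powr (b + 1)) * (\<integral>\<^sup>+t. ennreal (norm (radial f t) * max (1 - t) (norm (1 - z)) powr (- (b + 1))) \<partial>\<mu>))"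
    by (rule mult_left_mono) simp
  then show ?thesis
    using b by (simp add: deriv_Hankel(2)[OF z] norm_mult ennreal_mult' mult.assoc)
qed

end

end

subsection \<open>Dirichlet type spaces\<close>

lemma in_dirichlet_deriv:
  assumes "in_dirichlet p \<alpha> f"
  shows "f holomorphic_on ball 0 1" "deriv f holomorphic_on ball 0 1"
    "disc_energy p \<alpha> (deriv f) < \<infinity>"
proof -
  show "f holomorphic_on ball 0 1" "deriv f holomorphic_on ball 0 1"
    using assms by (auto simp: in_dirichlet_def in_bergman_def)
  then show "disc_energy p \<alpha> (deriv f) < \<infinity>"
    using assms by (auto simp: in_dirichlet_def in_bergman_def bergman_int_eq ennreal_mult_less_top)
qed

lemma in_dirichletI:
  assumes "f holomorphic_on ball 0 1" "disc_energy p \<alpha> (deriv f) < \<infinity>"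
  shows "in_dirichlet p \<alpha> f"
proof -
  have "deriv f holomorphic_on ball 0 1" using assms by (intro holomorphic_deriv) auto
  then show ?thesis using assms
    by (auto simp: in_dirichlet_def in_bergman_def bergman_int_eq ennreal_mult_less_top)
qed

lemma bergman_norm_eq:
  assumes g: "g holomorphic_on ball 0 1"
    and J: "disc_energy p \<alpha> g = ennreal J" and "J \<ge> 0"
  shows "bergman_norm p \<alpha> g = ((\<alpha> + 1) * (J / pi)) powr (1 / p)"
proof -
  have "bergman_int p \<alpha> g = ennreal (J / pi)"
    unfolding bergman_int_eq[OF g] J using \<open>J \<ge> 0\<close> by (simp add: ennreal_mult'[symmetric])
  then show ?thesis using \<open>J \<ge> 0\<close> by (simp add: bergman_norm_def)
qed

lemma dirichlet_norm_le_imp: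
  assumes f: "in_dirichlet p \<alpha> f" and M: "dirichlet_norm p \<alpha> f \<le> M" and p: "p > 0" and \<alpha>: "\<alpha> > -1"
  shows "norm (f 0) \<le> M" "disc_energy p \<alpha> (deriv f) \<le> ennreal (pi * M powr p / (\<alpha> + 1))"
proof -
  obtain J where J: "J \<ge> 0" "disc_energy p \<alpha> (deriv f) = ennreal J"
    using in_dirichlet_deriv(3)[OF f] by (cases "disc_energy p \<alpha> (deriv f)") auto
  have n: "bergman_norm p \<alpha> (deriv f) = ((\<alpha> + 1) * (J / pi)) powr (1 / p)"
    by (rule bergman_norm_eq[OF in_dirichlet_deriv(2)[OF f] J(2,1)])
  then have "bergman_norm p \<alpha> (deriv f) \<ge> 0" by simp
  with M show "norm (f 0) \<le> M" unfolding dirichlet_norm_def by linarith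
  have "((\<alpha> + 1) * (J / pi)) powr (1 / p) \<le> M"
    using M n norm_ge_zero[of "f 0"] unfolding dirichlet_norm_def by linarith
  then have "(((\<alpha> + 1) * (J / pi)) powr (1 / p)) powr p \<le> M powr p"
    using p by (intro powr_mono2) auto
  then have "(\<alpha> + 1) * (J / pi) \<le> M powr p" using p J \<alpha> by (simp add: powr_powr)
  then have "J \<le> pi * M powr p / (\<alpha> + 1)" using \<alpha> by (simp add: field_simps)
  then show "disc_energy p \<alpha> (deriv f) \<le> ennreal (pi * M powr p / (\<alpha> + 1))"
    unfolding J(2) by (rule ennreal_leI)
qed

lemma dirichlet_norm_leI:
  assumes f: "f holomorphic_on ball 0 1" and J: "disc_energy p \<alpha> (deriv f) \<le> ennreal J"
    and "J \<ge> 0" and p: "p > 0" and \<alpha>: "\<alpha> > -1"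
  shows "in_dirichlet p \<alpha> f" "dirichlet_norm p \<alpha> f \<le> norm (f 0) + ((\<alpha> + 1) * (J / pi)) powr (1 / p)"
proof -
  have g: "deriv f holomorphic_on ball 0 1" using f by (intro holomorphic_deriv) auto
  obtain J' where J': "J' \<ge> 0" "disc_energy p \<alpha> (deriv f) = ennreal J'"
    using J by (cases "disc_energy p \<alpha> (deriv f)") (auto simp: top_unique)
  then have "J' \<le> J" using J \<open>J \<ge> 0\<close> by simp
  show "in_dirichlet p \<alpha> f"
    by (rule in_dirichletI[OF f]) (simp add: J')
  show "dirichlet_norm p \<alpha> f \<le> norm (f 0) + ((\<alpha> + 1) * (J / pi)) powr (1 / p)"
    unfolding dirichlet_norm_def bergman_norm_eq[OF g J'(2,1)]
    using \<open>J' \<le> J\<close> J'(1) \<alpha> p by (intro add_left_mono powr_mono2 mult_left_mono divide_right_mono) auto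
qed

section \<open>Functions on the radius, measured block by block\<close>

text \<open>The shells are dyadic shells enlarged to three octaves; two of them with a common point
  have indices at most 3 apart.\<close>

lemma dyadic_overlap:
  fixes y :: real
  shows "(\<Sum>i<n. indicator {2 powr (- real i - 2)..2 powr (1 - real i)} y :: ennreal) \<le> 4"
proof -
  define S where "S = {i::nat. y \<in> {2 powr (- real i - 2)..2 powr (1 - real i)}}"
  have "card ({..<n} \<inter> S) \<le> 4"
  proof (cases "S = {}")
    case False
    define i0 where "i0 = (LEAST i. i \<in> S)"
    have i0: "i0 \<in> S" using False unfolding i0_def by (metis LeastI ex_in_conv)
    have "S \<subseteq> {i0..i0 + 3}"
    proof
      fix i assume i: "i \<in> S"
      have "i0 \<le> i" unfolding i0_def using i by (rule Least_le)
      moreover have "2 powr (- real i0 - 2) \<le> y" "y \<le> 2 powr (1 - real i)"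
        using i i0 by (auto simp: S_def)
      then have "2 powr (- real i0 - 2) \<le> (2::real) powr (1 - real i)" by (rule order_trans)
      then have "- real i0 - 2 \<le> 1 - real i" by (simp only: powr_le_cancel_iff)
      ultimately show "i \<in> {i0..i0 + 3}" by simp
    qed
    then have "card ({..<n} \<inter> S) \<le> card {i0..i0 + 3}" by (intro card_mono) auto
    then show ?thesis by simp
  qed simp
  moreover have "(\<Sum>i<n. indicator {2 powr (- real i - 2)..2 powr (1 - real i)} y :: ennreal) = of_nat (card ({..<n} \<inter> S))"
  proof -
    have "(\<Sum>i<n. indicator {2 powr (- real i - 2)..2 powr (1 - real i)} y :: ennreal) = (\<Sum>i<n. if i \<in> S then 1 else 0)"
      by (intro sum.cong) (auto simp: S_def indicator_def)
    also have "\<dots> = (\<Sum>i\<in>{..<n} \<inter> S. 1)" by (simp only: sum.inter_restrict[symmetric] finite_lessThan)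
    finally show ?thesis by simp
  qed
  ultimately show ?thesis
    by (metis of_nat_mono of_nat_numeral)
qed

text \<open>For \<open>t\<close> in the \<open>i\<close>-th interval the ball of
  \<open>pointwise_bound\<close> stays inside the \<open>i\<close>-th enlarged shell, so the energy
  of that shell controls \<open>b i powr p\<close>, and bounded overlap bounds the sum of these
  energies. The intervals are closed because the endpoints are needed when increments of a primitive
  are summed along the radius.\<close>

lemma radial_dyadic_bound:
  assumes p: "p > 0" and a: "a > -1"
  obtains C where "C > 0" "\<And>g J. \<lbrakk>g holomorphic_on ball 0 1; J \<ge> 0;
      disc_energy p a g \<le> ennreal J\<rbrakk> \<Longrightarrow>
    \<exists>b. (\<forall>i. b i \<ge> 0) \<and> (\<forall>n. (\<Sum>i<n. b i powr p) \<le> C * J) \<and>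
      (\<forall>i. \<forall>t\<in>{1 - 2 powr (- real i) .. 1 - 2 powr (- real (Suc i))}. norm (g (of_real t)) \<le> b i * 2 powr (real i * ((a + 2) / p)))"
proof -
  obtain C where C: "C > 0" "\<And>g z. \<lbrakk>g holomorphic_on ball 0 1; z \<in> ball 0 1\<rbrakk> \<Longrightarrow>
    ennreal (norm (g z) powr p * (1 - norm z) powr (a + 2)) \<le>
      ennreal C * (\<integral>\<^sup>+\<zeta>. indicator (ball z ((1 - norm z) / 2)) \<zeta> * ennreal (norm (g \<zeta>) powr p) \<partial>disc_weight a)"
    by (rule pointwise_bound[OF p]) (rule that, assumption+)
  define D where "D = C * 2 powr (a + 2)"
  have D: "D > 0" using C by (simp add: D_def)
  show ?thesis
  proof (rule that[of "4 * D"])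
    show "4 * D > 0" using D by simp
    fix g :: "complex \<Rightarrow> complex" and J :: real
    assume hol: "g holomorphic_on ball 0 1" and J: "J \<ge> 0" "disc_energy p a g \<le> ennreal J"
    have [measurable]: "g \<in> borel_measurable (disc_weight a)"
      by (rule holomorphic_measurable_disc_weight) fact
    let ?E = "\<lambda>i::nat. {2 powr (- real i - 2)..2 powr (1 - real i)}"
    have [measurable]: "(\<lambda>z. indicator (?E i) (1 - norm z) :: ennreal) \<in> borel_measurable (disc_weight a)" for i
      by (rule measurable_disc_weightI) measurable
    let ?I = "\<lambda>i. \<integral>\<^sup>+z. indicator (?E i) (1 - norm z) * ennreal (norm (g z) powr p) \<partial>disc_weight a"
    have sumI: "(\<Sum>i<n. ?I i) \<le> ennreal (4 * J)" for n
    proof -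
      have "(\<Sum>i<n. ?I i) = (\<integral>\<^sup>+z. (\<Sum>i<n. indicator (?E i) (1 - norm z) * ennreal (norm (g z) powr p)) \<partial>disc_weight a)"
        by (subst nn_integral_sum) auto
      also have "\<dots> = (\<integral>\<^sup>+z. (\<Sum>i<n. indicator (?E i) (1 - norm z)) * ennreal (norm (g z) powr p) \<partial>disc_weight a)"
        by (simp only: sum_distrib_right)
      also have "\<dots> \<le> (\<integral>\<^sup>+z. 4 * ennreal (norm (g z) powr p) \<partial>disc_weight a)"
        by (intro nn_integral_mono mult_right_mono dyadic_overlap) auto
      also have "\<dots> = 4 * disc_energy p a g"
        by (rule nn_integral_cmult) measurable
      also have "\<dots> \<le> 4 * ennreal J" by (intro mult_left_mono J) auto
      also have "\<dots> = ennreal (4 * J)" by (simp add: ennreal_mult')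
      finally show ?thesis .
    qed
    have Ifin: "?I i < \<infinity>" for i
    proof -
      have "?I i = sum ?I {i}" by simp
      also have "\<dots> \<le> (\<Sum>i<Suc i. ?I i)" by (intro sum_mono2) auto
      also have "\<dots> \<le> ennreal (4 * J)" by (rule sumI)
      also have "\<dots> < \<infinity>" by simp
      finally show ?thesis .
    qed
    define j where "j i = enn2real (?I i)" for i
    have j: "?I i = ennreal (j i)" "j i \<ge> 0" for i
      using Ifin[of i] by (auto simp: j_def)
    have sumj: "(\<Sum>i<n. j i) \<le> 4 * J" for n
      using sumI[of n] J(1) j(2) by (simp add: j(1) sum_ennreal)
    define b where "b i = (D * j i) powr (1 / p)" for i
    have bp: "b i powr p = D * j i" for i
      using p D j by (simp add: b_def powr_powr)
    show "\<exists>b. (\<forall>i. b i \<ge> 0) \<and> (\<forall>n. (\<Sum>i<n. b i powr p) \<le> 4 * D * J) \<and>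
      (\<forall>i. \<forall>t\<in>{1 - 2 powr (- real i) .. 1 - 2 powr (- real (Suc i))}. norm (g (of_real t)) \<le> b i * 2 powr (real i * ((a + 2) / p)))"
    proof (intro exI[of _ b] conjI allI ballI)
      show "b i \<ge> 0" for i by (simp add: b_def)
      show "(\<Sum>i<n. b i powr p) \<le> 4 * D * J" for n
        using mult_left_mono[OF sumj[of n], of D] D by (simp add: bp sum_distrib_left[symmetric] mult_ac)
      fix i :: nat and t :: real
      assume t: "t \<in> {1 - 2 powr (- real i) .. 1 - 2 powr (- real (Suc i))}"
      have le1: "2 powr (- real i) \<le> (1::real)" using powr_mono[of "- real i" 0 "2::real"] by simp
      have gt0: "0 < 2 powr (- real (Suc i))" by simp
      define \<rho> where "\<rho> = 1 - t"
      have \<rho>: "2 powr (- real (Suc i)) \<le> \<rho>" "\<rho> \<le> 2 powr (- real i)" "0 < \<rho>" "\<rho> \<le> 1"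
        using t[unfolded atLeastAtMost_iff] le1 gt0 unfolding \<rho>_def by linarith+
      have nt: "norm (complex_of_real t) = t" using \<rho> by (simp add: \<rho>_def)
      have "(2 powr (- real (Suc i))) powr (a + 2) \<le> \<rho> powr (a + 2)"
        using \<rho> a by (intro powr_mono2) auto
      then have low: "2 powr (- real (Suc i) * (a + 2)) \<le> \<rho> powr (a + 2)" by (simp add: powr_powr)
      have sub: "indicator (ball (of_real t) (\<rho> / 2)) \<zeta> \<le> (indicator (?E i) (1 - norm \<zeta>) :: ennreal)" for \<zeta> :: complex
      proof (cases "\<zeta> \<in> ball (of_real t) (\<rho> / 2)")
        case True
        then have d: "dist (of_real t) \<zeta> < \<rho> / 2" by simp
        have "norm \<zeta> \<le> t + \<rho> / 2"
          using d norm_triangle_ineq[of "of_real t" "\<zeta> - of_real t"] nt by (simp add: dist_norm norm_minus_commute)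
        moreover have "t \<le> norm \<zeta> + \<rho> / 2"
          using d norm_triangle_ineq[of \<zeta> "of_real t - \<zeta>"] nt by (simp add: dist_norm)
        ultimately have r: "\<rho> / 2 \<le> 1 - norm \<zeta>" "1 - norm \<zeta> \<le> 2 * \<rho>"
          using \<rho> \<rho>_def by linarith+
        \<comment> \<open>The shell has to accommodate \<rho>/2 \<le> 1 - |\<zeta>| \<le> 2 \<rho>,
          where \<rho> itself ranges from 2^(-i-1) to 2^(-i).\<close>
        have e1: "2 powr (- real i - 2) = 2 powr (- real (Suc i)) / (2::real)"
          by (simp add: powr_diff powr_minus_divide powr_add)
        have e2: "2 powr (1 - real i) = 2 * (2::real) powr (- real i)"
          by (simp add: powr_diff powr_minus_divide)
        have "1 - norm \<zeta> \<in> ?E i" unfolding e1 e2 using r \<rho> by (auto simp del: of_nat_Suc)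
        then show ?thesis using True by (simp add: indicator_def)
      qed simp
      have "ennreal (norm (g t) powr p * \<rho> powr (a + 2)) \<le> ennreal C * (\<integral>\<^sup>+\<zeta>. indicator (ball (of_real t) (\<rho> / 2)) \<zeta> * ennreal (norm (g \<zeta>) powr p) \<partial>disc_weight a)"
        using C(2)[OF hol, of "of_real t"] nt \<rho> by (simp add: \<rho>_def)
      also have "\<dots> \<le> ennreal C * ?I i"
        by (intro mult_left_mono nn_integral_mono mult_right_mono sub) auto
      also have "\<dots> = ennreal (C * j i)" using C j by (simp add: ennreal_mult')
      finally have "norm (g t) powr p * \<rho> powr (a + 2) \<le> C * j i" using C j(2)[of i] by simp
      moreover have "norm (g t) powr p * 2 powr (- real (Suc i) * (a + 2)) \<le> norm (g t) powr p * \<rho> powr (a + 2)"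
        by (intro mult_left_mono low) auto
      ultimately have "norm (g t) powr p * 2 powr (- real (Suc i) * (a + 2)) \<le> C * j i" by linarith
      moreover have "(2::real) powr (- real (Suc i) * (a + 2)) = 1 / (2 powr (a + 2) * 2 powr (real i * (a + 2)))"
      proof -
        have "(2::real) powr (- real (Suc i) * (a + 2)) = 2 powr (- ((a + 2) + real i * (a + 2)))"
          by (simp add: algebra_simps)
        then show ?thesis by (simp only: powr_minus_divide powr_add)
      qed
      ultimately have "norm (g t) powr p \<le> C * j i * (2 powr (a + 2) * 2 powr (real i * (a + 2)))"
        by (simp add: pos_divide_le_eq del: of_nat_Suc)
      then have "norm (g t) powr p \<le> D * j i * 2 powr (real i * (a + 2))"
        by (simp add: D_def mult_ac)
      then have "(norm (g t) powr p) powr (1 / p) \<le> (D * j i * 2 powr (real i * (a + 2))) powr (1 / p)"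
        using p by (intro powr_mono2) auto
      then show "norm (g t) \<le> b i * 2 powr (real i * ((a + 2) / p))"
        using p D j by (simp add: b_def powr_mult powr_powr)
    qed
  qed
qed

lemma half_powr_Suc: "(2::real) powr (- real (Suc i)) = 2 powr (- real i) / 2"
  by (simp add: powr_diff powr_minus_divide)

text \<open>Increments of \<open>f\<close> are summed from one block endpoint to the next. The
  length of a block, at most 2^(-i), lowers the exponent from \<kappa> + 1 to \<kappa> = N/p. As
  \<kappa> > 0, the sum of b_l 2^(l \<kappa>) over l \<le> i, divided by 2^(i \<kappa>), is
  dominated by a convolution with the decay kernel. The constant \<open>A\<close> is fixed before
  \<open>f\<close>, as compactness requires uniformity on bounded sets.\<close>

lemma dirichlet_dyadic_bound:
  assumes p: "p > 0" and pq: "p \<le> q" and \<alpha>: "\<alpha> > p - 1"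
  obtains A where "\<And>f. \<lbrakk>f holomorphic_on ball 0 1; norm (f 0) \<le> M;
      disc_energy p \<alpha> (deriv f) \<le> ennreal J\<rbrakk> \<Longrightarrow>
    \<exists>x. (\<forall>i. x i \<ge> 0) \<and> summable (\<lambda>i. x i powr q) \<and> (\<Sum>i. x i powr q) \<le> A \<and>
      (\<forall>i. \<forall>t\<in>dyadic_block i. norm (f (of_real t)) \<le> x i * 2 powr (real i * ((\<alpha> + 2 - p) / p)))"
proof -
  have \<alpha>1: "\<alpha> > -1" using p \<alpha> by simp
  have q: "q > 0" using p pq by simp
  obtain C where C: "C > 0" "\<And>g J. \<lbrakk>g holomorphic_on ball 0 1; J \<ge> 0;
      disc_energy p \<alpha> g \<le> ennreal J\<rbrakk> \<Longrightarrow>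
    \<exists>b. (\<forall>i. b i \<ge> 0) \<and> (\<forall>n. (\<Sum>i<n. b i powr p) \<le> C * J) \<and>
      (\<forall>i. \<forall>t\<in>{1 - 2 powr (- real i) .. 1 - 2 powr (- real (Suc i))}. norm (g (of_real t)) \<le> b i * 2 powr (real i * ((\<alpha> + 2) / p)))"
    by (rule radial_dyadic_bound[OF p \<alpha>1]) (rule that, assumption+)
  define \<kappa> where "\<kappa> = (\<alpha> + 2 - p) / p"
  have \<kappa>: "\<kappa> > 0" using p \<alpha> by (simp add: \<kappa>_def)
  have \<kappa>1: "(\<alpha> + 2) / p = \<kappa> + 1" using p by (simp add: \<kappa>_def field_simps)
  obtain K where K: "K > 0" "\<And>e. \<lbrakk>\<forall>i. e i \<ge> 0; summable (\<lambda>i. e i powr q)\<rbrakk> \<Longrightarrow>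
      (\<forall>k. summable (\<lambda>i. e i * decay \<kappa> k i)) \<and> summable (\<lambda>k. (\<Sum>i. e i * decay \<kappa> k i) powr q) \<and>
      (\<Sum>k. (\<Sum>i. e i * decay \<kappa> k i) powr q) \<le> K * (\<Sum>i. e i powr q)"
    by (rule decay_convolution[OF q \<kappa>]) (rule that, assumption+)
  \<comment> \<open>\<open>max 0\<close> covers a negative \<open>J\<close>, for which
    \<open>ennreal J\<close> is 0.\<close>
  define B where "B = C * max 0 J"
  have B: "B \<ge> 0" using C by (simp add: B_def)
  \<comment> \<open>The first summand is the l^q bound deduced from the l^p bound \<open>B\<close>
    by means of \<open>b i \<le> B powr (1 / p)\<close>. The second belongs to index 0, to which the
    value at the origin is charged.\<close>
  define A where "A = K * (B powr (q / p) + (B powr (1 / p) + M) powr q)"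
  show ?thesis
  proof (rule that[of A])
    fix f assume hol: "f holomorphic_on ball 0 1" and M: "norm (f 0) \<le> M"
      and J: "disc_energy p \<alpha> (deriv f) \<le> ennreal J"
    have hold: "deriv f holomorphic_on ball 0 1" using hol by (intro holomorphic_deriv) auto
    have "disc_energy p \<alpha> (deriv f) \<le> ennreal (max 0 J)"
      using J by (rule order_trans) (intro ennreal_leI, simp)
    then obtain b where b0: "\<And>i. b i \<ge> 0" and bsum: "\<And>n. (\<Sum>i<n. b i powr p) \<le> B" and
      bder: "\<And>i t. t\<in>{1 - 2 powr (- real i) .. 1 - 2 powr (- real (Suc i))} \<Longrightarrow> norm (deriv f (of_real t)) \<le> b i * 2 powr (real i * (\<kappa> + 1))"
      using C(2)[OF hold, of "max 0 J"] unfolding \<kappa>1 B_def by fastforce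
    define e where "e i = b i + (if i = 0 then norm (f 0) else 0)" for i :: nat
    have e0: "e i \<ge> 0" for i using b0[of i] by (simp add: e_def)
    have bp: "b i powr p \<le> B" for i
    proof -
      have "b i powr p = (\<Sum>j\<in>{i}. b j powr p)" by simp
      also have "\<dots> \<le> (\<Sum>j<Suc i. b j powr p)" by (intro sum_mono2) auto
      also have "\<dots> \<le> B" by (rule bsum)
      finally show ?thesis .
    qed
    have b1: "b i \<le> B powr (1 / p)" for i
    proof -
      have "b i = (b i powr p) powr (1 / p)" using p b0[of i] by (simp add: powr_powr)
      also have "\<dots> \<le> B powr (1 / p)" using p bp by (intro powr_mono2) auto
      finally show ?thesis .
    qed
    have bq: "b i powr q \<le> B powr ((q - p) / p) * b i powr p" for i
    proof -
      have "b i powr q = b i powr (q - p) * b i powr p" by (simp add: powr_add[symmetric])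
      also have "\<dots> \<le> (B powr (1 / p)) powr (q - p) * b i powr p"
        using b0 b1 pq by (intro mult_right_mono powr_mono2) auto
      also have "(B powr (1 / p)) powr (q - p) = B powr ((q - p) / p)" by (simp add: powr_powr)
      finally show ?thesis .
    qed
    have part: "(\<Sum>i<n. e i powr q) \<le> B powr (q / p) + (B powr (1 / p) + M) powr q" for n
    proof -
      have "(\<Sum>i<n. e i powr q) \<le> (\<Sum>i<n. b i powr q + (if i = 0 then (B powr (1 / p) + M) powr q else 0))"
      proof (rule sum_mono)
        fix i
        show "e i powr q \<le> b i powr q + (if i = 0 then (B powr (1 / p) + M) powr q else 0)"
        proof (cases "i = 0")
          case True
          have "e i powr q \<le> (B powr (1 / p) + M) powr q"
            using e0[of i] b1[of i] M True q by (intro powr_mono2) (auto simp: e_def)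
          then show ?thesis using True by (simp add: add_increasing)
        qed (simp add: e_def)
      qed
      also have "\<dots> = (\<Sum>i<n. b i powr q) + (\<Sum>i<n. if i = 0 then (B powr (1 / p) + M) powr q else 0)"
        by (rule sum.distrib)
      also have "(\<Sum>i<n. if i = 0 then (B powr (1 / p) + M) powr q else 0) \<le> (B powr (1 / p) + M) powr q"
        by (simp add: sum.delta)
      also have "(\<Sum>i<n. b i powr q) \<le> (\<Sum>i<n. B powr ((q - p) / p) * b i powr p)"
        by (intro sum_mono bq)
      also have "\<dots> \<le> B powr ((q - p) / p) * B"
        using bsum by (simp add: sum_distrib_left[symmetric] mult_left_mono)
      also have "\<dots> = B powr (q / p)"
      proof (cases "B = 0")
        case False
        then have "B powr ((q - p) / p) * B = B powr ((q - p) / p) * B powr 1" using B by simp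
        also have "\<dots> = B powr ((q - p) / p + 1)" by (simp add: powr_add)
        also have "(q - p) / p + 1 = q / p" using p by (simp add: field_simps)
        finally show ?thesis .
      qed simp
      finally show ?thesis by simp
    qed
    have sme: "summable (\<lambda>i. e i powr q)"
      by (rule summableI_nonneg_bounded[OF _ part]) auto
    define x where "x k = (\<Sum>i. e i * decay \<kappa> k i)" for k
    have conv: "\<And>k. summable (\<lambda>i. e i * decay \<kappa> k i)" "summable (\<lambda>k. x k powr q)" "(\<Sum>k. x k powr q) \<le> K * (\<Sum>i. e i powr q)"
      using K(2)[of e, OF _ sme] e0 unfolding x_def by auto
    have x0: "x k \<ge> 0" for k
      unfolding x_def by (intro suminf_nonneg conv(1)) (use e0 in auto)
    have xA: "(\<Sum>k. x k powr q) \<le> A"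
    proof -
      note conv(3)
      also have "K * (\<Sum>i. e i powr q) \<le> A"
        unfolding A_def using K by (intro mult_left_mono suminf_le_const[OF sme part]) auto
      finally show ?thesis .
    qed
    define F where "F i = norm (f 0) + (\<Sum>l<i. b l * 2 powr (real l * \<kappa>))" for i
    have step: "norm (f (of_real v) - f (of_real u)) \<le> b i * 2 powr (real i * \<kappa>)"
      if uv: "u = 1 - 2 powr (- real i)" "v \<in> {1 - 2 powr (- real i) .. 1 - 2 powr (- real (Suc i))}" for u v i
    proof -
      have le1: "2 powr (- real i) \<le> (1::real)" using powr_mono[of "- real i" 0 "2::real"] by simp
      have gt0: "0 < 2 powr (- real (Suc i))" by simp
      have uv01: "0 \<le> u" "u \<le> v" "v < 1" using uv(1) uv(2)[unfolded atLeastAtMost_iff] le1 gt0 by linarith+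
      have "norm (f (of_real v) - f (of_real u)) \<le> (b i * 2 powr (real i * (\<kappa> + 1))) * norm (complex_of_real v - of_real u)"
      proof (rule field_differentiable_bound[where S="closed_segment (of_real u) (of_real v)" and f'="deriv f"])
        fix z assume "z \<in> closed_segment (complex_of_real u) (of_real v)"
        then obtain w where w: "z = of_real w" "u \<le> w" "w \<le> v"
          using uv01 by (auto simp: closed_segment_of_real closed_segment_eq_real_ivl)
        then have z: "z \<in> ball 0 1" using uv01 by simp
        show "(f has_field_derivative deriv f z) (at z within closed_segment (of_real u) (of_real v))"
          by (rule has_field_derivative_at_within[OF holomorphic_derivI[OF hol open_ball z]])
        show "norm (deriv f z) \<le> b i * 2 powr (real i * (\<kappa> + 1))"
          unfolding w(1) using w uv by (intro bder) auto
      qed auto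
      also have "norm (complex_of_real v - of_real u) = v - u"
        using uv01 by (metis abs_of_nonneg diff_ge_0_iff_ge norm_of_real of_real_diff)
      also have "(b i * 2 powr (real i * (\<kappa> + 1))) * (v - u) \<le> (b i * 2 powr (real i * (\<kappa> + 1))) * 2 powr (- real i)"
        using uv(1) uv01 b0[of i] by (intro mult_left_mono) auto
      also have "\<dots> = b i * (2 powr (real i * (\<kappa> + 1)) * 2 powr (- real i))" by simp
      also have "2 powr (real i * (\<kappa> + 1)) * 2 powr (- real i) = (2::real) powr (real i * \<kappa>)"
        by (simp only: powr_add[symmetric]) (simp add: algebra_simps)
      finally show ?thesis .
    qed
    have endp: "norm (f (of_real (1 - 2 powr (- real i)))) \<le> F i" for i
    proof (induction i)
      case (Suc i)
      have "2 powr (- real (Suc i)) \<le> (2::real) powr (- real i)" by simp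
      then have "norm (f (of_real (1 - 2 powr (- real (Suc i)))) - f (of_real (1 - 2 powr (- real i)))) \<le> b i * 2 powr (real i * \<kappa>)"
        by (intro step) (auto simp del: of_nat_Suc)
      then show ?case using Suc norm_triangle_sub[of "f (of_real (1 - 2 powr (- real (Suc i))))" "f (of_real (1 - 2 powr (- real i)))"]
        by (simp add: F_def del: of_nat_Suc)
    qed (simp add: F_def)
    \<comment> \<open>Only the half l \<le> i of the kernel is used: there
      \<open>decay \<kappa> i l\<close> times 2^(i \<kappa>) is exactly 2^(l \<kappa>).\<close>
    have Fx: "F (Suc i) \<le> x i * 2 powr (real i * \<kappa>)" for i
    proof -
      have "(\<Sum>l<Suc i. e l * decay \<kappa> i l) \<le> x i"
        unfolding x_def using e0 by (intro sum_le_suminf conv(1)) auto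
      then have "(\<Sum>l<Suc i. e l * decay \<kappa> i l) * 2 powr (real i * \<kappa>) \<le> x i * 2 powr (real i * \<kappa>)"
        by (intro mult_right_mono) auto
      also have "(\<Sum>l<Suc i. e l * decay \<kappa> i l) * 2 powr (real i * \<kappa>) = (\<Sum>l<Suc i. e l * 2 powr (real l * \<kappa>))"
        unfolding sum_distrib_right
      proof (rule sum.cong)
        fix l assume "l \<in> {..<Suc i}"
        then have "decay \<kappa> i l * 2 powr (real i * \<kappa>) = 2 powr (real l * \<kappa>)"
          unfolding decay_def powr_add[symmetric] by (auto simp: algebra_simps)
        then show "e l * decay \<kappa> i l * 2 powr (real i * \<kappa>) = e l * 2 powr (real l * \<kappa>)" by simp
      qed simp
      also have "\<dots> = F (Suc i)"
        unfolding F_def sum.lessThan_Suc_shift by (simp add: e_def)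
      finally show ?thesis .
    qed
    show "\<exists>x. (\<forall>i. x i \<ge> 0) \<and> summable (\<lambda>i. x i powr q) \<and> (\<Sum>i. x i powr q) \<le> A \<and>
      (\<forall>i. \<forall>t\<in>dyadic_block i. norm (f (of_real t)) \<le> x i * 2 powr (real i * ((\<alpha> + 2 - p) / p)))"
    proof (intro exI[of _ x] conjI allI ballI x0 conv(2) xA)
      fix i t assume t: "t \<in> dyadic_block i"
      then have "norm (f (of_real t) - f (of_real (1 - 2 powr (- real i)))) \<le> b i * 2 powr (real i * \<kappa>)"
        by (intro step) (auto simp: dyadic_block_def simp del: of_nat_Suc)
      then have "norm (f (of_real t)) \<le> F (Suc i)"
        using endp[of i] norm_triangle_sub[of "f (of_real t)" "f (of_real (1 - 2 powr (- real i)))"]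
        by (simp add: F_def)
      also note Fx
      finally show "norm (f (of_real t)) \<le> x i * 2 powr (real i * ((\<alpha> + 2 - p) / p))"
        by (simp add: \<kappa>_def)
    qed
  qed
qed

section \<open>Growth of Taylor coefficients\<close>

text \<open>On the annulus \<open>1 - norm z ^ 2\<close> lies between 1/k and 4/k; the minimum
  accounts for both signs of \<open>a\<close>.\<close>

lemma nn_integral_annulus_le:
  assumes k: "k \<ge> 4" and g: "g holomorphic_on ball 0 1"
  shows "ennreal (min 1 (4 powr a) * real k powr (-a)) *
      (\<integral>\<^sup>+z. indicator {1 - 2 / real k..<1 - 1 / real k} (norm z) * ennreal (norm (g z) powr p) \<partial>lborel)
    \<le> disc_energy p a g"
proof -
  let ?T = "{1 - 2 / real k..<1 - 1 / real k}"
  define G where "G z = indicator (ball 0 1) z *\<^sub>R g z" for z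
  have [measurable]: "G \<in> borel_measurable borel"
    unfolding G_def by (rule holomorphic_cutoff_measurable[OF g])
  have [measurable]: "g \<in> borel_measurable (disc_weight a)"
    by (rule holomorphic_measurable_disc_weight) fact
  have k0: "real k > 0" using k by simp
  have T1: "z \<in> ball 0 1" if "norm z \<in> ?T" for z :: complex
  proof -
    have "norm z < 1 - 1 / real k" using that by simp
    also have "\<dots> < 1" using k0 by simp
    finally show ?thesis by simp
  qed
  have w: "min 1 (4 powr a) * real k powr (-a) \<le> (1 - norm z ^ 2) powr a" if z: "norm z \<in> ?T" for z :: complex
  proof -
    have eq: "1 - norm z ^ 2 = (1 - norm z) * (1 + norm z)" by (simp add: power2_eq_square algebra_simps)
    have z1: "norm z < 1" using T1[OF z] by simp
    have "1 / real k * 1 \<le> (1 - norm z) * (1 + norm z)" using z z1 k0 by (intro mult_mono) auto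
    moreover have "(1 - norm z) * (1 + norm z) \<le> 2 / real k * 2" using z z1 by (intro mult_mono) auto
    ultimately have b: "1 / real k \<le> 1 - norm z ^ 2" "1 - norm z ^ 2 \<le> 4 / real k" unfolding eq by auto
    have "min 1 (4 powr a) * real k powr (-a) \<le> min ((1 / real k) powr a) ((4 / real k) powr a)"
    proof -
      have "(1 / real k) powr a = 1 * real k powr (-a)" "(4 / real k) powr a = 4 powr a * real k powr (-a)"
        using k0 by (simp_all add: powr_divide powr_minus_divide)
      moreover have "min 1 (4 powr a) * real k powr (-a) \<le> 1 * real k powr (-a)"
        "min 1 (4 powr a) * real k powr (-a) \<le> 4 powr a * real k powr (-a)"
        by (intro mult_right_mono; simp)+
      ultimately show ?thesis by simp
    qed
    also have "\<dots> \<le> (1 - norm z ^ 2) powr a" using k0 b by (intro powr_between_lower) auto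
    finally show ?thesis .
  qed
  have "ennreal (min 1 (4 powr a) * real k powr (-a)) *
      (\<integral>\<^sup>+z. indicator ?T (norm z) * ennreal (norm (g z) powr p) \<partial>lborel)
     = ennreal (min 1 (4 powr a) * real k powr (-a)) *
      (\<integral>\<^sup>+z. indicator ?T (norm z) * ennreal (norm (G z) powr p) \<partial>lborel)"
  proof -
    have "indicator ?T (norm z) * ennreal (norm (g z) powr p) = indicator ?T (norm z) * ennreal (norm (G z) powr p)" for z
      by (cases "norm z \<in> ?T") (use T1[of z] in \<open>auto simp: G_def simp del: atLeastLessThan_iff\<close>)
    then show ?thesis by simp
  qed
  also have "\<dots> = (\<integral>\<^sup>+z. ennreal (min 1 (4 powr a) * real k powr (-a)) * (indicator ?T (norm z) * ennreal (norm (G z) powr p)) \<partial>lborel)"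
    by (rule nn_integral_cmult[symmetric]) measurable
  also have "\<dots> \<le> (\<integral>\<^sup>+z. indicator (ball 0 1) z * (ennreal ((1 - norm z ^ 2) powr a) * ennreal (norm (g z) powr p)) \<partial>lborel)"
  proof (rule nn_integral_mono)
    fix z :: complex
    show "ennreal (min 1 (4 powr a) * real k powr (-a)) * (indicator ?T (norm z) * ennreal (norm (G z) powr p)) \<le>
      indicator (ball 0 1) z * (ennreal ((1 - norm z ^ 2) powr a) * ennreal (norm (g z) powr p))"
    proof (cases "norm z \<in> ?T")
      case True
      then show ?thesis using T1[OF True] w[OF True]
        by (simp add: G_def mult_right_mono ennreal_leI del: atLeastLessThan_iff)
    qed simp
  qed
  also have "\<dots> = disc_energy p a g"
    by (subst nn_integral_disc_weight) auto
  finally show ?thesis .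
qed

lemma taylor_coeff_deriv:
  assumes "k > 0"
  shows "(deriv ^^ (k - 1)) (deriv f) 0 / fact (k - 1) = of_nat k * taylor_coeff f k"
proof -
  obtain m where m: "k = Suc m" using assms by (cases k) auto
  have f: "(of_nat (fact (Suc m)) :: complex) = of_nat (Suc m) * fact m"
    by (simp add: algebra_simps)
  have nz: "(of_nat (Suc m) :: complex) \<noteq> 0" by (simp del: of_nat_Suc)
  have d: "(deriv ^^ Suc m) f = (deriv ^^ m) (deriv f)"
    by (simp only: funpow_Suc_right o_apply)
  show ?thesis unfolding m taylor_coeff_def f d using nz by (simp del: of_nat_Suc)
qed

lemma annulus_area:
  assumes k: "k \<ge> 4"
  shows "(\<integral>\<^sup>+(z::complex). indicator {1 - 2 / real k..<1 - 1 / real k} (norm z) \<partial>lborel) =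
     ennreal (pi * ((1 - 1 / real k)\<^sup>2 - (1 - 2 / real k)\<^sup>2))"
    and "1 / real k \<le> pi * ((1 - 1 / real k)\<^sup>2 - (1 - 2 / real k)\<^sup>2)"
    and "pi * ((1 - 1 / real k)\<^sup>2 - (1 - 2 / real k)\<^sup>2) \<le> 8 / real k"
proof -
  let ?r = "1 - 2 / real k" and ?R = "1 - 1 / real k"
  have k0: "real k > 0" using k by simp
  have rR: "0 \<le> ?r" "?r \<le> ?R" using k by (auto simp: field_simps)
  have "(\<integral>\<^sup>+(z::complex). indicator {?r..<?R} (norm z) \<partial>lborel) = (\<integral>\<^sup>+z. indicator (ball (0::complex) ?R - ball 0 ?r) z \<partial>lborel)"
    by (intro nn_integral_cong) (auto simp: indicator_def)
  also have "\<dots> = emeasure lborel (ball (0::complex) ?R - ball 0 ?r)"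
    by (rule nn_integral_indicator) simp
  also have "\<dots> = emeasure lborel (ball (0::complex) ?R) - emeasure lborel (ball (0::complex) ?r)"
    using rR by (intro emeasure_Diff) (auto simp: emeasure_ball)
  also have "\<dots> = ennreal (pi * (?R\<^sup>2 - ?r\<^sup>2))"
    using rR by (simp add: emeasure_ball unit_ball_vol_2 ennreal_minus right_diff_distrib)
  finally show "(\<integral>\<^sup>+(z::complex). indicator {?r..<?R} (norm z) \<partial>lborel) = ennreal (pi * (?R\<^sup>2 - ?r\<^sup>2))" .
  have eq: "?R\<^sup>2 - ?r\<^sup>2 = (1 / real k) * (2 - 3 / real k)"
    by (simp add: power2_eq_square algebra_simps)
  have k3: "3 / real k \<le> 1" using k by (simp add: field_simps)
  have "1 * ((1 / real k) * 1) \<le> pi * ((1 / real k) * (2 - 3 / real k))"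
    using k3 pi_ge_two k0 by (intro mult_mono) auto
  then show "1 / real k \<le> pi * (?R\<^sup>2 - ?r\<^sup>2)" unfolding eq by simp
  have "pi * ((1 / real k) * (2 - 3 / real k)) \<le> 4 * ((1 / real k) * 2)"
    using k3 pi_less_4 k0 by (intro mult_mono mult_nonneg_nonneg) (linarith | simp)+
  then show "pi * (?R\<^sup>2 - ?r\<^sup>2) \<le> 8 / real k" unfolding eq by simp
qed

text \<open>The radial coefficient estimate is applied to the derivative in degree
  \<open>k - 1\<close>: on the annulus |z|^(k-1) is at least exp(-4), and the area, at least 1/k,
  cancels the factor \<open>k\<close> produced by differentiation.\<close>

lemma taylor_coeff_annulus:
  assumes k: "k \<ge> 4" and hol: "deriv f holomorphic_on ball 0 1" and B: "B \<ge> 0"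
    and le: "(\<integral>\<^sup>+z. indicator {1 - 2 / real k..<1 - 1 / real k} (norm z) * ennreal (norm (deriv f z)) \<partial>lborel) \<le> ennreal B"
  shows "norm (taylor_coeff f k) \<le> exp 4 * B"
proof -
  let ?T = "{1 - 2 / real k..<1 - 1 / real k}"
  have k0: "real k > 0" using k by simp
  have h: "0 \<le> 2 / real k" "2 / real k \<le> 1/2" using k by (auto simp: field_simps)
  \<comment> \<open>From ln(1 - x) \<ge> - x - 2 x^2 with x = 2/k, which \<open>k \<ge> 4\<close>
    keeps below 1/2, follows ln(1 - x) \<ge> - 2 x = - 4/k.\<close>
  have low: "exp (-4) \<le> (1 - 2 / real k) ^ k"
  proof -
    have "- (2 / real k) - 2 * (2 / real k)\<^sup>2 \<le> ln (1 - 2 / real k)"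
      by (rule ln_one_minus_pos_lower_bound[OF h])
    moreover have "2 * (2 / real k)\<^sup>2 \<le> 2 / real k"
      using mult_right_mono[OF h(2), of "2 * (2 / real k)"] h by (simp add: power2_eq_square)
    ultimately have "- (4 / real k) \<le> ln (1 - 2 / real k)" by linarith
    then have "real k * (- (4 / real k)) \<le> real k * ln (1 - 2 / real k)" using k0 by (intro mult_left_mono) auto
    then have "- 4 \<le> real k * ln (1 - 2 / real k)" using k0 by simp
    then have "exp (-4) \<le> exp (real k * ln (1 - 2 / real k))" by simp
    also have "\<dots> = (1 - 2 / real k) ^ k" using h by (simp add: exp_of_nat_mult)
    finally show ?thesis .
  qed
  have "ennreal (exp (-4) * (1 / real k)) \<le> ennreal (exp (-4)) * (\<integral>\<^sup>+(z::complex). indicator ?T (norm z) \<partial>lborel)"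
    unfolding annulus_area(1)[OF k]
    by (subst ennreal_mult'[symmetric]) (auto intro!: ennreal_leI mult_left_mono annulus_area(2)[OF k] simp del: times_divide_eq_right)
  also have "\<dots> = (\<integral>\<^sup>+(z::complex). ennreal (exp (-4)) * indicator ?T (norm z) \<partial>lborel)"
    by (rule nn_integral_cmult[symmetric]) measurable
  also have "\<dots> \<le> (\<integral>\<^sup>+(z::complex). indicator ?T (norm z) * ennreal (norm z ^ (k - 1)) \<partial>lborel)"
  proof (rule nn_integral_mono)
    fix z :: complex
    show "ennreal (exp (-4)) * indicator ?T (norm z) \<le> indicator ?T (norm z) * ennreal (norm z ^ (k - 1))"
    proof (cases "norm z \<in> ?T")
      case True
      have "(1 - 2 / real k) ^ k \<le> norm z ^ k" using True h by (intro power_mono) auto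
      also have "\<dots> \<le> norm z ^ (k - 1)"
      proof (rule power_decreasing)
        show "norm z \<le> 1" using True k0 by (smt (verit) atLeastLessThan_iff divide_nonneg_nonneg)
      qed auto
      finally show ?thesis using True low by (simp add: ennreal_leI)
    qed simp
  qed
  finally have "ennreal (norm (of_nat k * taylor_coeff f k)) * ennreal (exp (-4) * (1 / real k)) \<le>
      ennreal (norm (of_nat k * taylor_coeff f k)) * (\<integral>\<^sup>+(z::complex). indicator ?T (norm z) * ennreal (norm z ^ (k - 1)) \<partial>lborel)"
    by (rule mult_left_mono) simp
  also have "\<dots> \<le> (\<integral>\<^sup>+z. indicator ?T (norm z) * ennreal (norm (deriv f (0 + z))) \<partial>lborel)"
  proof -
    have T: "?T \<subseteq> {..<1}" and k1: "0 < k"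
      using k0 by (auto intro: less_trans)
    have "ennreal (norm ((deriv ^^ (k - 1)) (deriv f) 0 / fact (k - 1))) *
        (\<integral>\<^sup>+(z::complex). indicator ?T (norm z) * ennreal (norm z ^ (k - 1)) \<partial>lborel)
      \<le> (\<integral>\<^sup>+z. indicator ?T (norm z) * ennreal (norm (deriv f (0 + z))) \<partial>lborel)"
      by (rule taylor_coeff_le_radial_integral[OF hol _ T]) simp
    then show ?thesis by (simp only: taylor_coeff_deriv[OF k1])
  qed
  also have "\<dots> \<le> ennreal B" using le by simp
  finally have "norm (of_nat k * taylor_coeff f k) * (exp (-4) * (1 / real k)) \<le> B"
    using B by (simp add: ennreal_mult'[symmetric])
  then have "norm (taylor_coeff f k) * exp (-4) \<le> B" using k0 by (simp add: norm_mult)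
  then show ?thesis by (simp add: exp_minus field_simps)
qed

text \<open>The \<open>k\<close>-th coefficient is read off from the annulus at distance about \<open>1 / k\<close> from the circle. The
  exponent stays below the Carleson exponent minus one, which makes the coefficient series of the
  operator converge absolutely.\<close>
lemma taylor_coeff_growth:
  assumes p: "p > 0" and \<alpha>: "\<alpha> > p - 1" and f: "in_dirichlet p \<alpha> f" and q: "q > 1" and pq: "p \<le> q"
  obtains e C where "e + 1 < (\<alpha> + 2 - p) / p + (\<alpha> + 2 - p) * (1 - 1 / q)"
    "\<And>k. k \<ge> 4 \<Longrightarrow> norm (taylor_coeff f k) \<le> C * real k powr e"
proof -
  define g where "g = deriv f"
  have g: "g holomorphic_on ball 0 1" unfolding g_def by (rule in_dirichlet_deriv[OF f])
  define G where "G z = indicator (ball 0 1) z *\<^sub>R g z" for z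
  have [measurable]: "G \<in> borel_measurable borel"
    unfolding G_def by (rule holomorphic_cutoff_measurable[OF g])
  obtain J where J: "J \<ge> 0" "disc_energy p \<alpha> g = ennreal J"
    using in_dirichlet_deriv(3)[OF f] unfolding g_def
    by (cases "disc_energy p \<alpha> (deriv f)") auto
  define c :: real where "c = min 1 (4 powr \<alpha>)"
  have c: "c > 0" by (simp add: c_def)
  let ?T = "\<lambda>k. {1 - 2 / real k..<1 - 1 / real k}"
  have Tball: "z \<in> ball 0 1" "1 / real k \<le> 1 - norm z" if "norm z \<in> ?T k" "k \<ge> 4" for z :: complex and k
  proof -
    have z: "norm z < 1 - 1 / real k" using that by simp
    also have "\<dots> < 1" using that by simp
    finally show "z \<in> ball 0 1" by simp
    show "1 / real k \<le> 1 - norm z" using z by simp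
  qed
  have Ip: "(\<integral>\<^sup>+z. indicator (?T k) (norm z) * ennreal (norm (G z) powr p) \<partial>lborel) \<le> ennreal (J / c * real k powr \<alpha>)" if k: "k \<ge> 4" for k
  proof -
    have k0: "real k > 0" using k by simp
    have "(\<integral>\<^sup>+z. indicator (?T k) (norm z) * ennreal (norm (G z) powr p) \<partial>lborel) = (\<integral>\<^sup>+z. indicator (?T k) (norm z) * ennreal (norm (g z) powr p) \<partial>lborel)"
    proof (intro nn_integral_cong)
      fix z :: complex
      show "indicator (?T k) (norm z) * ennreal (norm (G z) powr p) = indicator (?T k) (norm z) * ennreal (norm (g z) powr p)"
        by (cases "norm z \<in> ?T k") (use Tball(1)[OF _ k, of z] in \<open>auto simp: G_def simp del: atLeastLessThan_iff\<close>)
    qed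
    also have "\<dots> = ennreal (real k powr \<alpha> / c) * (ennreal (c * real k powr (-\<alpha>)) * (\<integral>\<^sup>+z. indicator (?T k) (norm z) * ennreal (norm (g z) powr p) \<partial>lborel))"
      using c k0 by (simp add: mult.assoc[symmetric] ennreal_mult'[symmetric] powr_add[symmetric])
    also have "\<dots> \<le> ennreal (real k powr \<alpha> / c) * ennreal J"
      using nn_integral_annulus_le[OF k g, of \<alpha> p] unfolding J(2) c_def[symmetric] by (intro mult_left_mono) auto
    also have "\<dots> = ennreal (J / c * real k powr \<alpha>)"
      using c J by (simp add: ennreal_mult'[symmetric] mult.commute)
    finally show ?thesis .
  qed
  \<comment> \<open>A bound of |f'| that is affine in |f'|^p is integrated over the annulus: the
    constant meets the area, the power meets the energy. The cases \<open>p \<ge> 1\<close> and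
    \<open>p < 1\<close> differ in the choice of \<open>A\<close> and \<open>X\<close>.\<close>
  have reduce: "norm (taylor_coeff f k) \<le> exp 4 * (A * (8 / real k) + X * (J / c * real k powr \<alpha>))"
    if k: "k \<ge> 4" and A: "A \<ge> 0" and X: "X \<ge> 0"
      and le: "\<And>z. norm z \<in> ?T k \<Longrightarrow> norm (g z) \<le> A + X * norm (g z) powr p" for k A X
  proof (rule taylor_coeff_annulus[OF k, of f, folded g_def, OF g])
    show "0 \<le> A * (8 / real k) + X * (J / c * real k powr \<alpha>)" using A X J c by simp
    have "(\<integral>\<^sup>+z. indicator (?T k) (norm z) * ennreal (norm (g z)) \<partial>lborel) \<le>
       (\<integral>\<^sup>+(z::complex). ennreal A * indicator (?T k) (norm z) + ennreal X * (indicator (?T k) (norm z) * ennreal (norm (G z) powr p)) \<partial>lborel)"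
    proof (rule nn_integral_mono)
      fix z :: complex
      show "indicator (?T k) (norm z) * ennreal (norm (g z)) \<le>
        ennreal A * indicator (?T k) (norm z) + ennreal X * (indicator (?T k) (norm z) * ennreal (norm (G z) powr p))"
      proof (cases "norm z \<in> ?T k")
        case True
        then show ?thesis using le[OF True] Tball(1)[OF True k] A X
          by (simp add: G_def ennreal_mult'[symmetric] ennreal_plus[symmetric] ennreal_leI del: ennreal_plus atLeastLessThan_iff)
      qed simp
    qed
    also have "\<dots> = ennreal A * (\<integral>\<^sup>+(z::complex). indicator (?T k) (norm z) \<partial>lborel) + ennreal X * (\<integral>\<^sup>+z. indicator (?T k) (norm z) * ennreal (norm (G z) powr p) \<partial>lborel)"
      by (simp add: nn_integral_add nn_integral_cmult)
    also have "\<dots> \<le> ennreal A * ennreal (8 / real k) + ennreal X * ennreal (J / c * real k powr \<alpha>)"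
      using annulus_area(1,3)[OF k] Ip[OF k] by (intro add_mono mult_left_mono) (auto intro: ennreal_leI)
    also have "\<dots> = ennreal (A * (8 / real k) + X * (J / c * real k powr \<alpha>))"
    proof -
      have "0 \<le> A * (8 / real k)" "0 \<le> X * (J / c * real k powr \<alpha>)" using A X J c by auto
      then show ?thesis using A X by (simp only: ennreal_plus ennreal_mult'[OF A] ennreal_mult'[OF X])
    qed
    finally show "(\<integral>\<^sup>+z. indicator (?T k) (norm z) * ennreal (norm (g z)) \<partial>lborel) \<le> ennreal (A * (8 / real k) + X * (J / c * real k powr \<alpha>))" .
  qed
  have N: "\<alpha> + 2 - p > 1" using \<alpha> by simp
  show ?thesis
  proof (cases "p \<ge> 1")
    case True
    define e where "e = (\<alpha> + 1) / p - 1"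
    have "e + 1 < (\<alpha> + 2 - p) / p + (\<alpha> + 2 - p) * (1 - 1 / q)"
    proof -
      \<comment> \<open>The comparison uses 1 - 1/p \<le> 1 - 1/q, from \<open>p \<le> q\<close>;
        strictness comes from N > 1.\<close>
      have "e + 1 = (\<alpha> + 2 - p) / p + (1 - 1 / p)" using p by (simp add: e_def field_simps)
      moreover have "1 - 1 / p \<le> 1 * (1 - 1 / q)" using p pq by (simp add: frac_le)
      moreover have "1 * (1 - 1 / q) < (\<alpha> + 2 - p) * (1 - 1 / q)"
        using N q by (intro mult_strict_right_mono) auto
      ultimately show ?thesis by linarith
    qed
    moreover have "norm (taylor_coeff f k) \<le> exp 4 * (8 + J / c) * real k powr e" if k: "k \<ge> 4" for k
    proof -
      have k0: "real k > 0" using k by simp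
      \<comment> \<open>This value equalises the two terms: A/k = A^(1-p) k^\<alpha> means A^p =
        k^(\<alpha>+1).\<close>
      define A where "A = real k powr ((\<alpha> + 1) / p)"
      have A: "A > 0" using k0 by (simp add: A_def)
      have le: "x \<le> A + A powr (1 - p) * x powr p" if "x \<ge> 0" for x
        using le_add_powr[OF A True that] .
      have "norm (taylor_coeff f k) \<le> exp 4 * (A * (8 / real k) + A powr (1 - p) * (J / c * real k powr \<alpha>))"
        by (rule reduce[OF k]) (use A le in auto)
      also have "A / real k = real k powr e"
        using k0 by (simp add: A_def e_def powr_diff)
      then have "A * (8 / real k) = 8 * real k powr e" using k0 by (simp add: field_simps)
      also have "A powr (1 - p) * (J / c * real k powr \<alpha>) = J / c * real k powr e"
      proof -
        have "(\<alpha> + 1) / p * (1 - p) + \<alpha> = e" using p by (simp add: e_def field_simps)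
        then have "A powr (1 - p) * real k powr \<alpha> = real k powr e"
          by (simp add: A_def powr_powr powr_add[symmetric])
        then show ?thesis by simp
      qed
      finally show ?thesis by (simp add: algebra_simps)
    qed
    ultimately show ?thesis by (rule that)
  next
    case False
    define e where "e = (\<alpha> + 2) / p - 2"
    obtain D where D: "D > 0" "\<And>g z. \<lbrakk>g holomorphic_on ball 0 1; z \<in> ball 0 1\<rbrakk> \<Longrightarrow>
      ennreal (norm (g z) powr p * (1 - norm z) powr (\<alpha> + 2)) \<le>
        ennreal D * (\<integral>\<^sup>+\<zeta>. indicator (ball z ((1 - norm z) / 2)) \<zeta> * ennreal (norm (g \<zeta>) powr p) \<partial>disc_weight \<alpha>)"
      by (rule pointwise_bound[OF p]) (rule that, assumption+)
    have "e + 1 < (\<alpha> + 2 - p) / p + (\<alpha> + 2 - p) * (1 - 1 / q)"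
    proof -
      have "e + 1 = (\<alpha> + 2 - p) / p" using p by (simp add: e_def field_simps)
      moreover have "0 < (\<alpha> + 2 - p) * (1 - 1 / q)" using N q by (intro mult_pos_pos) auto
      ultimately show ?thesis by linarith
    qed
    moreover have "norm (taylor_coeff f k) \<le> exp 4 * ((D * J) powr ((1 - p) / p) * (J / c)) * real k powr e" if k: "k \<ge> 4" for k
    proof -
      have k0: "real k > 0" using k by simp
      \<comment> \<open>\<open>Y\<close> is the pointwise bound of \<open>norm (g z) powr p\<close>
        on the annulus. For \<open>p < 1\<close> it controls the remaining power 1 - p, so the
        constant term in \<open>reduce\<close> is taken to be 0.\<close>
      define Y where "Y = D * J * real k powr (\<alpha> + 2)"
      have Y: "Y \<ge> 0" using D J by (simp add: Y_def)
      have le: "norm (g z) \<le> 0 + Y powr ((1 - p) / p) * norm (g z) powr p" if z: "norm z \<in> ?T k" for z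
      proof -
        have "ennreal (norm (g z) powr p * (1 - norm z) powr (\<alpha> + 2)) \<le> ennreal D * ennreal J"
          unfolding J(2)[symmetric]
          by (rule order_trans[OF D(2)[OF g Tball(1)[OF z k]]])
             (auto intro!: mult_left_mono nn_integral_mono simp: indicator_def)
        then have "norm (g z) powr p * (1 - norm z) powr (\<alpha> + 2) \<le> D * J"
          using D J by (simp add: ennreal_mult'[symmetric])
        moreover have "norm (g z) powr p * (1 / real k) powr (\<alpha> + 2) \<le> norm (g z) powr p * (1 - norm z) powr (\<alpha> + 2)"
          using Tball(2)[OF z k] N p k0 by (intro mult_left_mono powr_mono2) auto
        ultimately have "norm (g z) powr p * (1 / real k) powr (\<alpha> + 2) \<le> D * J" by linarith
        then have gY: "norm (g z) powr p \<le> Y"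
          using k0 by (simp add: Y_def powr_divide field_simps)
        have "norm (g z) = norm (g z) powr (1 - p) * norm (g z) powr p"
          by (cases "g z = 0") (auto simp: powr_add[symmetric])
        also have "norm (g z) powr (1 - p) = (norm (g z) powr p) powr ((1 - p) / p)"
          using p by (simp add: powr_powr)
        also have "\<dots> * norm (g z) powr p \<le> Y powr ((1 - p) / p) * norm (g z) powr p"
          using gY False p by (intro mult_right_mono powr_mono2) auto
        finally show ?thesis by simp
      qed
      have "norm (taylor_coeff f k) \<le> exp 4 * (0 * (8 / real k) + Y powr ((1 - p) / p) * (J / c * real k powr \<alpha>))"
        by (rule reduce[OF k]) (use le in auto)
      also have "Y powr ((1 - p) / p) * (J / c * real k powr \<alpha>) = (D * J) powr ((1 - p) / p) * (J / c) * real k powr e"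
      proof -
        have "(\<alpha> + 2) * ((1 - p) / p) + \<alpha> = e" using p by (simp add: e_def field_simps)
        then have "(real k powr (\<alpha> + 2)) powr ((1 - p) / p) * real k powr \<alpha> = real k powr e"
          by (simp only: powr_powr powr_add[symmetric])
        moreover have "Y powr ((1 - p) / p) = (D * J) powr ((1 - p) / p) * (real k powr (\<alpha> + 2)) powr ((1 - p) / p)"
          unfolding Y_def by (rule powr_mult)
        ultimately show ?thesis by (simp add: mult_ac)
      qed
      finally show ?thesis by simp
    qed
    ultimately show ?thesis by (rule that)
  qed
qed

section \<open>Decay of moments and convergence of the coefficient series\<close>

text \<open>The inequality 1 + x \<le> exp x at x = y/\<sigma>, raised to the power
  \<sigma>.\<close>

lemma powr_mult_exp_le:
  fixes y \<sigma> :: real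
  assumes "y \<ge> 0" "\<sigma> > 0"
  shows "y powr \<sigma> * exp (- y) \<le> \<sigma> powr \<sigma>"
proof -
  have "y / \<sigma> \<le> exp (y / \<sigma>)" using exp_ge_add_one_self[of "y / \<sigma>"] by linarith
  then have "(y / \<sigma>) powr \<sigma> \<le> exp (y / \<sigma>) powr \<sigma>" using assms by (intro powr_mono2) auto
  also have "exp (y / \<sigma>) powr \<sigma> = exp y" using assms by (simp add: powr_def)
  finally have "y powr \<sigma> \<le> \<sigma> powr \<sigma> * exp y" using assms by (simp add: powr_divide field_simps)
  then have "y powr \<sigma> * exp (- y) \<le> \<sigma> powr \<sigma> * exp y * exp (- y)" by (intro mult_right_mono) auto
  also have "\<dots> = \<sigma> powr \<sigma>" by (simp add: mult.assoc exp_add[symmetric])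
  finally show ?thesis .
qed

context measure_01 begin

lemma measure_on_01: "measure_on_01 \<mu>"
proof -
  have "emeasure \<mu> (UNIV - {0..<1}) = 0"
    by (rule AE_iff_measurable[THEN iffD1, OF _ _ AE_01]) auto
  then show ?thesis by (simp add: measure_on_01_def)
qed

text \<open>On [0,1) the power t^k is at most a constant times (k (1 - t))^(-\<sigma>), and (1 -
  t)^(-\<sigma>) is integrable by a geometric series over the blocks because \<sigma> < s. Losing a
  little against the exponent s is harmless, since the coefficient growth leaves a gap.\<close>

lemma moment_decay:
  assumes car: "carleson \<mu> s" and \<sigma>: "0 < \<sigma>" "\<sigma> < s"
  obtains C where "C \<ge> 0" "\<And>k. k > 0 \<Longrightarrow> (\<integral>t. t ^ k \<partial>\<mu>) \<le> C * real k powr (- \<sigma>)"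
proof -
  obtain C where C: "C > 0" "\<And>i. measure \<mu> (dyadic_block i) \<le> C * 2 powr (- real i * s)"
    by (rule carleson_dyadic[OF sets_mu car]) (rule that, assumption+)
  define r :: real where "r = 2 powr (\<sigma> - s)"
  have r: "0 < r" "r < 1" using \<sigma> by (auto simp: r_def powr_less_one)
  let ?\<Phi> = "\<lambda>i. 2 powr (real (Suc i) * \<sigma>)"
  have le: "?\<Phi> i * measure \<mu> (dyadic_block i) \<le> C * 2 powr \<sigma> * r ^ i" for i
  proof -
    have "?\<Phi> i * measure \<mu> (dyadic_block i) \<le> ?\<Phi> i * (C * 2 powr (- real i * s))"
      by (intro mult_left_mono C) auto
    also have "\<dots> = C * (2 powr (real (Suc i) * \<sigma>) * 2 powr (- real i * s))" by simp
    also have "2 powr (real (Suc i) * \<sigma>) * 2 powr (- real i * s) = (2::real) powr \<sigma> * (2 powr (\<sigma> - s)) powr real i"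
      by (simp only: powr_powr powr_add[symmetric]) (simp add: algebra_simps)
    finally show ?thesis using r by (simp add: r_def powr_realpow)
  qed
  have sm: "summable (\<lambda>i. ?\<Phi> i * measure \<mu> (dyadic_block i))"
    by (rule summable_comparison_test'[where N=0 and g="\<lambda>i. C * 2 powr \<sigma> * r ^ i"])
       (use le r in \<open>auto intro!: summable_mult simp del: of_nat_Suc\<close>)
  define S where "S = (\<Sum>i. ?\<Phi> i * measure \<mu> (dyadic_block i))"
  have S0: "S \<ge> 0" unfolding S_def by (intro suminf_nonneg sm) auto
  have bound: "(\<integral>\<^sup>+t. ennreal ((1 - t) powr (- \<sigma>)) \<partial>\<mu>) \<le> ennreal S"
    unfolding S_def
  proof (rule nn_integral_dyadic[OF measure_on_01])
    show "emeasure \<mu> {0..<1} < \<infinity>" by (simp add: less_top[symmetric])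
    fix t i assume "t \<in> dyadic_block i"
    then have t: "2 powr (- real (Suc i)) < 1 - t" by (simp add: dyadic_block_mem half_powr_Suc del: of_nat_Suc)
    have "(1 - t) powr (- \<sigma>) \<le> (2 powr (- real (Suc i))) powr (- \<sigma>)"
      using t \<sigma> by (intro powr_mono2') (auto simp del: of_nat_Suc)
    then show "ennreal ((1 - t) powr (- \<sigma>)) \<le> ennreal (?\<Phi> i)"
      by (intro ennreal_leI) (simp add: powr_powr del: of_nat_Suc)
  qed (use sm in auto)
  show ?thesis
  proof (rule that[of "\<sigma> powr \<sigma> * S"])
    show "\<sigma> powr \<sigma> * S \<ge> 0" using S0 by simp
    fix k :: nat assume k: "k > 0"
    have pt: "t ^ k \<le> \<sigma> powr \<sigma> * real k powr (- \<sigma>) * (1 - t) powr (- \<sigma>)" if t: "t \<in> {0..<1}" for t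
    proof -
      have "t \<le> exp (- (1 - t))" using exp_ge_add_one_self[of "t - 1"] by simp
      then have "t ^ k \<le> exp (- (1 - t)) ^ k" using t by (intro power_mono) auto
      also have "\<dots> = exp (- (real k * (1 - t)))" by (simp add: exp_of_nat_mult[symmetric] algebra_simps)
      finally have "(real k * (1 - t)) powr \<sigma> * t ^ k \<le> (real k * (1 - t)) powr \<sigma> * exp (- (real k * (1 - t)))"
        by (intro mult_left_mono) auto
      also have "\<dots> \<le> \<sigma> powr \<sigma>" using t \<sigma> by (intro powr_mult_exp_le) auto
      finally have "real k powr \<sigma> * (1 - t) powr \<sigma> * t ^ k \<le> \<sigma> powr \<sigma>"
        by (simp only: powr_mult)
      moreover have "0 < real k powr \<sigma>" "0 < (1 - t) powr \<sigma>" using t k by auto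
      ultimately show ?thesis by (simp add: powr_minus_divide pos_le_divide_eq mult_ac)
    qed
    have "ennreal (\<integral>t. t ^ k \<partial>\<mu>) = (\<integral>\<^sup>+t. ennreal (t ^ k) \<partial>\<mu>)"
      by (rule nn_integral_eq_integral[symmetric, OF integrable_power]) (auto intro!: AE_01I)
    also have "\<dots> \<le> (\<integral>\<^sup>+t. ennreal (\<sigma> powr \<sigma> * real k powr (- \<sigma>)) * ennreal ((1 - t) powr (- \<sigma>)) \<partial>\<mu>)"
      by (rule nn_integral_mono_AE, rule AE_01I) (use pt in \<open>auto simp: ennreal_mult'[symmetric] intro!: ennreal_leI\<close>)
    also have "\<dots> = ennreal (\<sigma> powr \<sigma> * real k powr (- \<sigma>)) * (\<integral>\<^sup>+t. ennreal ((1 - t) powr (- \<sigma>)) \<partial>\<mu>)"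
      by (rule nn_integral_cmult) measurable
    also have "\<dots> \<le> ennreal (\<sigma> powr \<sigma> * real k powr (- \<sigma>)) * ennreal S"
      by (intro mult_left_mono bound) auto
    also have "\<dots> = ennreal (\<sigma> powr \<sigma> * S * real k powr (- \<sigma>))"
      using S0 by (simp add: ennreal_mult'[symmetric] mult_ac)
    finally show "(\<integral>t. t ^ k \<partial>\<mu>) \<le> \<sigma> powr \<sigma> * S * real k powr (- \<sigma>)"
      using S0 by simp
  qed
qed

lemma dirichlet_summable:
  assumes p: "p > 0" and \<alpha>: "\<alpha> > p - 1" and f: "in_dirichlet p \<alpha> f" and q: "q > 1" and pq: "p \<le> q"
    and car: "carleson \<mu> ((\<alpha> + 2 - p) / p + (\<alpha> + 2 - p) * (1 - 1 / q))"
  shows "summable (\<lambda>k. norm (taylor_coeff f k) * (\<integral>t. t ^ k \<partial>\<mu>))"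
proof -
  let ?s = "(\<alpha> + 2 - p) / p + (\<alpha> + 2 - p) * (1 - 1 / q)"
  obtain e C where e: "e + 1 < ?s" and C: "\<And>k. k \<ge> 4 \<Longrightarrow> norm (taylor_coeff f k) \<le> C * real k powr e"
    by (rule taylor_coeff_growth[OF p \<alpha> f q pq]) (rule that, assumption+)
  have s: "?s > 0" using \<alpha> p q by (intro add_pos_nonneg divide_pos_pos mult_nonneg_nonneg) auto
  \<comment> \<open>A point strictly between \<open>max 0 (e + 1)\<close> and the Carleson exponent:
    positive, as \<open>moment_decay\<close> demands, and with e - \<sigma> < -1 for
    convergence.\<close>
  define \<sigma> where "\<sigma> = (max 0 (e + 1) + ?s) / 2"
  have \<sigma>: "0 < \<sigma>" "\<sigma> < ?s" "e + 1 < \<sigma>"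
  proof -
    have "0 < (max 0 x + S) / 2 \<and> (max 0 x + S) / 2 < S \<and> x < (max 0 x + S) / 2" if "x < S" "0 < S" for x S :: real
      using that by (auto simp: max_def)
    from this[OF e s] show "0 < \<sigma>" "\<sigma> < ?s" "e + 1 < \<sigma>" by (simp_all only: \<sigma>_def)
  qed
  obtain D where D: "D \<ge> 0" "\<And>k. k > 0 \<Longrightarrow> (\<integral>t. t ^ k \<partial>\<mu>) \<le> D * real k powr (- \<sigma>)"
    by (rule moment_decay[OF car \<sigma>(1,2)]) (rule that, assumption+)
  show ?thesis
  proof (rule summable_comparison_test'[where N=4])
    show "summable (\<lambda>k. C * D * real k powr (e - \<sigma>))"
      using \<sigma> by (intro summable_mult) (simp add: summable_real_powr_iff)
    fix k :: nat assume k: "k \<ge> 4"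
    have "norm (taylor_coeff f k) * (\<integral>t. t ^ k \<partial>\<mu>) \<le> (C * real k powr e) * (D * real k powr (- \<sigma>))"
      using C[OF k] D(2)[of k] k moment_nonneg[of k] norm_ge_zero[of "taylor_coeff f k"]
      by (intro mult_mono) (auto intro: order_trans[OF _ C[OF k]])
    also have "\<dots> = C * D * (real k powr e * real k powr (- \<sigma>))" by simp
    also have "real k powr e * real k powr (- \<sigma>) = real k powr (e - \<sigma>)" by (simp add: powr_add[symmetric])
    finally show "norm (norm (taylor_coeff f k) * (\<integral>t. t ^ k \<partial>\<mu>)) \<le> C * D * real k powr (e - \<sigma>)"
      using moment_nonneg[of k] by simp
  qed
qed

end

section \<open>Linearity and norm estimate for the operator\<close>

text \<open>The image function is given by a series whose meaning is confined to the disc, so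
  linearity of the operator is available only there; the norm does not see the values
  outside.\<close>

lemma dirichlet_norm_cong:
  assumes "f holomorphic_on ball 0 1" "g holomorphic_on ball 0 1" "\<And>z. z \<in> ball 0 1 \<Longrightarrow> f z = g z"
  shows "dirichlet_norm q b f = dirichlet_norm q b g"
proof -
  have d: "deriv f z = deriv g z" if "z \<in> ball 0 1" for z
    using complex_derivative_transform_within_open[OF assms(1,2) open_ball that assms(3)] .
  have "bergman_int q b (deriv f) = bergman_int q b (deriv g)"
    unfolding bergman_int_def by (intro nn_integral_cong) (auto simp: indicator_def d)
  then show ?thesis using assms(3)[of 0] by (simp add: dirichlet_norm_def bergman_norm_def)
qed

context measure_01 begin

lemma Hankel_diff:
  assumes b: "b > 0" and f: "f holomorphic_on ball 0 1" and g: "g holomorphic_on ball 0 1"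
    and smf: "summable (\<lambda>k. norm (taylor_coeff f k) * (\<integral>t. t ^ k \<partial>\<mu>))"
    and smg: "summable (\<lambda>k. norm (taylor_coeff g k) * (\<integral>t. t ^ k \<partial>\<mu>))"
    and z: "z \<in> ball 0 1"
  shows "Hankel \<mu> b (\<lambda>z. f z - g z) z = Hankel \<mu> b f z - Hankel \<mu> b g z"
proof -
  have tc: "taylor_coeff (\<lambda>z. f z - g z) k = taylor_coeff f k - taylor_coeff g k" for k
    using higher_deriv_diff[OF f g open_ball, of 0 k] by (simp add: taylor_coeff_def diff_divide_distrib)
  have H: "H_coeff \<mu> b (\<lambda>z. f z - g z) n = H_coeff \<mu> b f n - H_coeff \<mu> b g n" for n
    unfolding H_coeff_def tc right_diff_distrib
    by (rule suminf_diff[symmetric]) (intro H_coeff_summable b f g smf smg)+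
  have "summable (\<lambda>n. H_coeff \<mu> b f n * z ^ n)" "summable (\<lambda>n. H_coeff \<mu> b g n * z ^ n)"
    using H_defined[OF b f smf] H_defined[OF b g smg] z by (auto simp: H_defined_def)
  then show ?thesis
    unfolding Hankel_def H left_diff_distrib by (rule suminf_diff[symmetric])
qed

text \<open>\<open>F i\<close> may be any bound of \<open>h\<close> on the \<open>i\<close>-th
  block. Because of this freedom one estimate yields both boundedness, with \<open>F\<close> from
  \<open>dirichlet_dyadic_bound\<close>, and compactness, with \<open>F\<close> a small constant on
  finitely many blocks. The rate (b + 1)(1 - 1/q) is the summand N/q' of the Carleson
  exponent.\<close>

lemma Hankel_norm_bound:
  assumes b: "b > 0" and q: "q > 1"
  obtains C where "C > 0" "\<And>h F E. \<lbrakk>h holomorphic_on ball 0 1;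
      summable (\<lambda>k. norm (taylor_coeff h k) * (\<integral>t. t ^ k \<partial>\<mu>)); \<forall>i. F i \<ge> 0;
      \<forall>i. \<forall>t\<in>dyadic_block i. norm (h (of_real t)) \<le> F i;
      summable (\<lambda>i. (F i * measure \<mu> (dyadic_block i) * 2 powr (real i * ((b + 1) * (1 - 1 / q)))) powr q);
      (\<Sum>i. (F i * measure \<mu> (dyadic_block i) * 2 powr (real i * ((b + 1) * (1 - 1 / q)))) powr q) \<le> E\<rbrakk> \<Longrightarrow>
    in_dirichlet q (b - 1) (Hankel \<mu> b h) \<and> dirichlet_norm q (b - 1) (Hankel \<mu> b h) \<le> C * E powr (1 / q)"
proof -
  define N where "N = b + 1"
  have N: "N > 1" using b by (simp add: N_def)
  \<comment> \<open>The one-sided decay rates are N/q for i \<le> k and N (1 - 1/q) for i > k;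
    \<open>q > 1\<close> keeps the second one positive.\<close>
  define c where "c = N * min (1 / q) (1 - 1 / q)"
  have c: "c > 0" using N q by (simp add: c_def)
  have c1: "c \<le> N * (1 / q)" "c \<le> N * (1 - 1 / q)"
    unfolding c_def using N by (intro mult_left_mono; simp)+
  have q0: "q > 0" and b1: "b - 1 > -1" using q b by auto
  obtain K where K: "K > 0" "\<And>e. \<lbrakk>\<forall>i. e i \<ge> 0; summable (\<lambda>i. e i powr q)\<rbrakk> \<Longrightarrow>
      (\<forall>k. summable (\<lambda>i. e i * decay c k i)) \<and> summable (\<lambda>k. (\<Sum>i. e i * decay c k i) powr q) \<and>
      (\<Sum>k. (\<Sum>i. e i * decay c k i) powr q) \<le> K * (\<Sum>i. e i powr q)"
    by (rule decay_convolution[OF q0 c]) (rule that, assumption+)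
  obtain D where D: "D > 0" "\<And>g v. \<lbrakk>\<forall>k. v k \<ge> 0; summable (\<lambda>k. v k * 2 powr (- real k * (b - 1 + 2)));
      \<forall>z\<in>ball 0 1. \<forall>k. 2 powr (- real k) < norm (1 - z) \<longrightarrow> norm (1 - z) \<le> 2 powr (1 - real k) \<longrightarrow> g z \<le> ennreal (v k)\<rbrakk> \<Longrightarrow>
    (\<integral>\<^sup>+z. g z \<partial>disc_weight (b - 1)) \<le> ennreal (D * (\<Sum>k. v k * 2 powr (- real k * (b - 1 + 2))))"
    by (rule disc_weight_dyadic[OF b1]) (rule that, assumption+)
  define L where "L = b * 2 powr (b + 1) * 2 powr N"
  have L: "L > 0" using b by (simp add: L_def)
  \<comment> \<open>The first summand is for the value at 0, the second for the derivative; its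
    factor \<open>b\<close> is the normalisation (b - 1) + 1 of the target norm.\<close>
  define R where "R = K powr (1 / q) + (b * (D * L powr q * K / pi)) powr (1 / q)"
  show ?thesis
  proof (rule that[of R])
    show "R > 0" using K unfolding R_def by (intro add_pos_nonneg) auto
    fix h F E
    let ?w = "\<lambda>i. F i * measure \<mu> (dyadic_block i) * 2 powr (real i * ((b + 1) * (1 - 1 / q)))"
    assume hol: "h holomorphic_on ball 0 1"
      and smh: "summable (\<lambda>k. norm (taylor_coeff h k) * (\<integral>t. t ^ k \<partial>\<mu>))" and F0': "\<forall>i. F i \<ge> 0"
      and hF: "\<forall>i. \<forall>t\<in>dyadic_block i. norm (h (of_real t)) \<le> F i"
      and sme: "summable (\<lambda>i. ?w i powr q)" and E: "(\<Sum>i. ?w i powr q) \<le> E"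
    have F0: "F i \<ge> 0" for i using F0' by blast
    define e where "e i = F i * measure \<mu> (dyadic_block i) * 2 powr (real i * (N * (1 - 1 / q)))" for i
    have e0: "e i \<ge> 0" for i using F0 by (simp add: e_def)
    have sme': "summable (\<lambda>i. e i powr q)" and E': "(\<Sum>i. e i powr q) \<le> E"
      using sme E by (simp_all add: e_def N_def)
    define y where "y k = (\<Sum>i. e i * decay c k i)" for k
    have y: "\<And>k. summable (\<lambda>i. e i * decay c k i)" "summable (\<lambda>k. y k powr q)" "(\<Sum>k. y k powr q) \<le> K * (\<Sum>i. e i powr q)"
      using K(2)[of e, OF _ sme'] e0 unfolding y_def by auto
    have y0: "y k \<ge> 0" for k
      unfolding y_def by (intro suminf_nonneg y(1)) (use e0 in auto)
    have yE: "(\<Sum>k. y k powr q) \<le> K * E"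
      using y(3) mult_left_mono[OF E', of K] K by linarith
    have E0: "E \<ge> 0"
    proof -
      have "0 \<le> (\<Sum>i. e i powr q)" by (intro suminf_nonneg sme') auto
      then show ?thesis using E' by linarith
    qed
    have Fm: "F i * measure \<mu> (dyadic_block i) = e i * 2 powr (- (real i * (N * (1 - 1 / q))))" for i
      unfolding e_def mult.assoc powr_add[symmetric] by simp
    have fin: "emeasure \<mu> {0..<1} < \<infinity>" by (simp add: less_top[symmetric])

    \<comment> \<open>The value at 0 is dominated by the convolution at \<open>k = 0\<close>, since
      \<open>decay c 0 i\<close> falls off no faster than 2^(-i N (1 - 1/q)).\<close>
    have H0: "norm (Hankel \<mu> b h 0) \<le> y 0"
    proof -
      have le: "F i * measure \<mu> (dyadic_block i) \<le> e i * decay c 0 i" for i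
        unfolding Fm using e0 c1
        by (intro mult_left_mono) (auto simp: decay_def mult.commute[of c] intro!: mult_left_mono)
      have sm: "summable (\<lambda>i. F i * measure \<mu> (dyadic_block i))"
        by (rule summable_comparison_test'[OF y(1)[of 0], of 0]) (use le F0 in auto)
      have "ennreal (norm (Hankel \<mu> b h 0)) \<le> (\<integral>\<^sup>+t. ennreal (norm (radial h t)) \<partial>\<mu>)"
        unfolding Hankel_0[OF b hol smh] by (rule integral_norm_bound_ennreal[OF integrable_radial[OF b hol smh]])
      also have "\<dots> \<le> ennreal (\<Sum>i. F i * measure \<mu> (dyadic_block i))"
      proof (rule nn_integral_dyadic[OF measure_on_01 fin F0 sm])
        fix t i assume t: "t \<in> dyadic_block i"
        then have "t \<in> {0..<1}" using dyadic_block_subset(2) by blast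
        then show "ennreal (norm (radial h t)) \<le> ennreal (F i)" using hF t by (auto intro!: ennreal_leI)
      qed
      also have "\<dots> \<le> ennreal (y 0)" unfolding y_def by (intro ennreal_leI suminf_le le sm y(1))
      finally show ?thesis using y0 by simp
    qed
    have H1: "norm (deriv (Hankel \<mu> b h) z) \<le> L * 2 powr (real k * (N / q)) * y k"
      if z: "z \<in> ball 0 1" and k: "2 powr (- real k) < norm (1 - z)" for z k
    proof -
      \<comment> \<open>For \<open>t\<close> in block \<open>i\<close> and \<open>z\<close> in
        annulus \<open>k\<close> the maximum of \<open>1 - t\<close> and \<open>norm (1 - z)\<close>
        is at least half of 2^(-min(i,k)); its power - N gives the factor multiplying
        \<open>F i\<close>.\<close>
      define \<Phi> where "\<Phi> i = F i * (2 powr N * 2 powr (N * min (real i) (real k)))" for i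
      have \<Phi>0: "\<Phi> i \<ge> 0" for i using F0 by (simp add: \<Phi>_def)
      have le: "\<Phi> i * measure \<mu> (dyadic_block i) \<le> 2 powr N * 2 powr (real k * (N / q)) * (e i * decay c k i)" for i
      proof -
        have "N * min (real i) (real k) - real i * (N * (1 - 1 / q)) \<le> real k * (N / q) - c * \<bar>real i - real k\<bar>"
        proof (cases "i \<le> k")
          case True
          have "c * (real k - real i) \<le> (N * (1 / q)) * (real k - real i)"
            using True c1 by (intro mult_right_mono) auto
          then show ?thesis using True by (simp add: algebra_simps)
        next
          case False
          have "c * (real i - real k) \<le> (N * (1 - 1 / q)) * (real i - real k)"
            using False c1 by (intro mult_right_mono) auto
          then show ?thesis using False by (simp add: algebra_simps)
        qed
        then have "2 powr (N * min (real i) (real k) - real i * (N * (1 - 1 / q))) \<le> (2::real) powr (real k * (N / q) - c * \<bar>real i - real k\<bar>)"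
          by (intro powr_mono) auto
        then have *: "2 powr (N * min (real i) (real k)) * 2 powr (- (real i * (N * (1 - 1 / q)))) \<le> 2 powr (real k * (N / q)) * decay c k i"
          by (simp add: decay_def powr_add[symmetric])
        have "\<Phi> i * measure \<mu> (dyadic_block i) = 2 powr N * e i * (2 powr (N * min (real i) (real k)) * 2 powr (- (real i * (N * (1 - 1 / q)))))"
          using Fm[of i] by (simp add: \<Phi>_def mult_ac)
        also have "\<dots> \<le> 2 powr N * e i * (2 powr (real k * (N / q)) * decay c k i)"
          using e0 by (intro mult_left_mono *) auto
        finally show ?thesis by (simp add: mult_ac)
      qed
      have sm: "summable (\<lambda>i. \<Phi> i * measure \<mu> (dyadic_block i))"
        by (rule summable_comparison_test'[OF summable_mult[OF y(1)[of k], of "2 powr N * 2 powr (real k * (N / q))"], of 0])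
           (use le \<Phi>0 in auto)
      have "(\<integral>\<^sup>+t. ennreal (norm (radial h t) * max (1 - t) (norm (1 - z)) powr (- (b + 1))) \<partial>\<mu>) \<le> ennreal (\<Sum>i. \<Phi> i * measure \<mu> (dyadic_block i))"
      proof (rule nn_integral_dyadic[OF measure_on_01 fin \<Phi>0 sm])
        fix t i assume t: "t \<in> dyadic_block i"
        then have t01: "t \<in> {0..<1}" using dyadic_block_subset(2) by blast
        define m where "m = max (1 - t) (norm (1 - z))"
        have m1: "2 powr (- real i) / 2 \<le> m" "2 powr (- real k) / 2 \<le> m"
        proof -
          have "1 - t \<le> m" "norm (1 - z) \<le> m" "(0::real) < 2 powr (- real k)" by (auto simp: m_def)
          moreover have "2 powr (- real i) / 2 < 1 - t" using t by (simp add: dyadic_block_mem)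
          ultimately show "2 powr (- real i) / 2 \<le> m" "2 powr (- real k) / 2 \<le> m" using k by linarith+
        qed
        have "2 powr (- min (real i) (real k)) / 2 \<le> m"
          using m1 by (cases "i \<le> k") (auto simp: min_def)
        then have "m powr (- N) \<le> (2 powr (- min (real i) (real k)) / 2) powr (- N)"
          using N by (intro powr_mono2') auto
        also have "\<dots> = 2 powr N * 2 powr (N * min (real i) (real k))"
        proof -
          have "2 powr (- min (real i) (real k)) / 2 = (2::real) powr (- min (real i) (real k) - 1)"
            by (simp add: powr_diff)
          then have "(2 powr (- min (real i) (real k)) / 2) powr (- N) = (2::real) powr ((- min (real i) (real k) - 1) * (- N))"
            by (simp only: powr_powr)
          also have "(- min (real i) (real k) - 1) * (- N) = N + N * min (real i) (real k)"
            by (simp add: algebra_simps)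
          finally show ?thesis by (simp only: powr_add)
        qed
        finally have "m powr (- N) \<le> 2 powr N * 2 powr (N * min (real i) (real k))" .
        moreover have "norm (radial h t) \<le> F i" using hF t t01 by simp
        ultimately show "ennreal (norm (radial h t) * max (1 - t) (norm (1 - z)) powr (- (b + 1))) \<le> ennreal (\<Phi> i)"
          unfolding \<Phi>_def m_def[symmetric] N_def[symmetric] using F0 by (intro ennreal_leI mult_mono) auto
      qed
      also have "(\<Sum>i. \<Phi> i * measure \<mu> (dyadic_block i)) \<le> (\<Sum>i. 2 powr N * 2 powr (real k * (N / q)) * (e i * decay c k i))"
        by (intro suminf_le le sm summable_mult y(1))
      then have "ennreal (\<Sum>i. \<Phi> i * measure \<mu> (dyadic_block i)) \<le> ennreal (2 powr N * 2 powr (real k * (N / q)) * y k)"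
        unfolding y_def by (subst (asm) suminf_mult[OF y(1)]) (rule ennreal_leI)
      finally have I: "(\<integral>\<^sup>+t. ennreal (norm (radial h t) * max (1 - t) (norm (1 - z)) powr (- (b + 1))) \<partial>\<mu>) \<le> ennreal (2 powr N * 2 powr (real k * (N / q)) * y k)" .
      have "ennreal (norm (deriv (Hankel \<mu> b h) z)) \<le> ennreal (b * 2 powr (b + 1)) * ennreal (2 powr N * 2 powr (real k * (N / q)) * y k)"
        by (rule order_trans[OF norm_deriv_Hankel_le[OF b hol smh] mult_left_mono[OF I]]) (use z in auto)
      also have "\<dots> = ennreal (L * 2 powr (real k * (N / q)) * y k)"
        using b y0 by (simp add: ennreal_mult'[symmetric] L_def mult_ac)
      finally show ?thesis using L y0 by simp
    qed
    \<comment> \<open>After raising to the power \<open>q\<close>, the growth 2^(k N/q) is cancelled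
      exactly by the factor 2^(-k N) for the mass of the annulus.\<close>
    define v where "v k = (L * 2 powr (real k * (N / q)) * y k) powr q" for k
    have vk: "v k * 2 powr (- real k * (b - 1 + 2)) = L powr q * y k powr q" for k
    proof -
      have "v k = L powr q * 2 powr (real k * N) * y k powr q"
        using q0 by (simp add: v_def powr_mult powr_powr)
      moreover have "2 powr (real k * N) * 2 powr (- real k * (b - 1 + 2)) = (2::real) powr 0"
        by (simp only: powr_add[symmetric]) (simp add: N_def algebra_simps)
      ultimately show ?thesis by simp
    qed
    have "disc_energy q (b - 1) (deriv (Hankel \<mu> b h)) \<le> ennreal (D * (\<Sum>k. v k * 2 powr (- real k * (b - 1 + 2))))"
    proof (rule D(2))
      show "\<forall>k. 0 \<le> v k" by (simp add: v_def)
      show "summable (\<lambda>k. v k * 2 powr (- real k * (b - 1 + 2)))"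
        unfolding vk by (intro summable_mult y(2))
      show "\<forall>z\<in>ball 0 1. \<forall>k. 2 powr (- real k) < norm (1 - z) \<longrightarrow> norm (1 - z) \<le> 2 powr (1 - real k) \<longrightarrow>
         ennreal (norm (deriv (Hankel \<mu> b h) z) powr q) \<le> ennreal (v k)"
        unfolding v_def using H1 q0 by (auto intro!: ennreal_leI powr_mono2)
    qed
    also have "\<dots> = ennreal (D * (L powr q * (\<Sum>k. y k powr q)))"
      unfolding vk by (subst suminf_mult[OF y(2)]) simp
    also have "\<dots> \<le> ennreal (D * L powr q * K * E)"
      using mult_left_mono[OF yE, of "D * L powr q"] D by (intro ennreal_leI) (simp add: mult_ac)
    finally have J: "disc_energy q (b - 1) (deriv (Hankel \<mu> b h)) \<le> ennreal (D * L powr q * K * E)" .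
    have J0: "D * L powr q * K * E \<ge> 0" using D K E0 by simp
    note dn = dirichlet_norm_leI[OF Hankel_holomorphic[OF b hol smh] J J0 q0 b1]
    have "y 0 powr q = (\<Sum>k\<in>{0}. y k powr q)" by simp
    also have "\<dots> \<le> (\<Sum>k. y k powr q)" by (intro sum_le_suminf y(2)) auto
    also note yE
    finally have "(y 0 powr q) powr (1 / q) \<le> (K * E) powr (1 / q)" using q0 by (intro powr_mono2) auto
    then have "y 0 \<le> K powr (1 / q) * E powr (1 / q)" using q0 y0 by (simp add: powr_powr powr_mult)
    then have "norm (Hankel \<mu> b h 0) \<le> K powr (1 / q) * E powr (1 / q)" using H0 by linarith
    moreover have "((b - 1 + 1) * (D * L powr q * K * E / pi)) powr (1 / q) = (b * (D * L powr q * K / pi)) powr (1 / q) * E powr (1 / q)"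
      by (subst powr_mult[symmetric]) (simp add: field_simps)
    ultimately have "dirichlet_norm q (b - 1) (Hankel \<mu> b h) \<le> R * E powr (1 / q)"
      using dn(2) unfolding R_def by (simp only: distrib_right)
    with dn(1) show "in_dirichlet q (b - 1) (Hankel \<mu> b h) \<and> dirichlet_norm q (b - 1) (Hankel \<mu> b h) \<le> R * E powr (1 / q)"
      by blast
  qed
qed

end

section \<open>Ingredients of the compactness argument\<close>

text \<open>The derivative is bounded pointwise on the smaller disc, and the increment from 0 is
  controlled by it. This supplies the local boundedness for Montel's theorem.\<close>

lemma dirichlet_local_bound:
  assumes p: "p > 0" and \<alpha>: "\<alpha> > -1" and \<rho>: "\<rho> < 1"
  obtains B where "\<And>f (z :: complex). \<lbrakk>f holomorphic_on ball 0 1; norm (f 0) \<le> M;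
      disc_energy p \<alpha> (deriv f) \<le> ennreal J; norm z \<le> \<rho>\<rbrakk> \<Longrightarrow> norm (f z) \<le> B"
proof -
  obtain D where D: "D > 0" "\<And>g z. \<lbrakk>g holomorphic_on ball 0 1; z \<in> ball 0 1\<rbrakk> \<Longrightarrow>
    ennreal (norm (g z) powr p * (1 - norm z) powr (\<alpha> + 2)) \<le>
      ennreal D * (\<integral>\<^sup>+\<zeta>. indicator (ball z ((1 - norm z) / 2)) \<zeta> * ennreal (norm (g \<zeta>) powr p) \<partial>disc_weight \<alpha>)"
    by (rule pointwise_bound[OF p]) (rule that, assumption+)
  define B where "B = (D * max 0 J / (1 - \<rho>) powr (\<alpha> + 2)) powr (1 / p)"
  show ?thesis
  proof (rule that[of "M + B"])
    fix f and z :: complex assume hol: "f holomorphic_on ball 0 1" and M: "norm (f 0) \<le> M" and z: "norm z \<le> \<rho>"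
      and J: "disc_energy p \<alpha> (deriv f) \<le> ennreal J"
    have hold: "deriv f holomorphic_on ball 0 1" using hol by (intro holomorphic_deriv) auto
    have db: "norm (deriv f w) \<le> B" if w: "norm w \<le> \<rho>" for w :: complex
    proof -
      have w1: "w \<in> ball 0 1" using w \<rho> by simp
      have "ennreal (norm (deriv f w) powr p * (1 - norm w) powr (\<alpha> + 2)) \<le> ennreal D * disc_energy p \<alpha> (deriv f)"
        by (rule order_trans[OF D(2)[OF hold w1]])
           (auto intro!: mult_left_mono nn_integral_mono simp: indicator_def)
      also have "\<dots> \<le> ennreal D * ennreal (max 0 J)"
        using J by (intro mult_left_mono) (auto simp: ennreal_max_0)
      finally have "norm (deriv f w) powr p * (1 - norm w) powr (\<alpha> + 2) \<le> D * max 0 J"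
        using D by (simp only: ennreal_mult'[symmetric] less_imp_le ennreal_le_iff mult_nonneg_nonneg max.cobounded1)
      moreover have "norm (deriv f w) powr p * (1 - \<rho>) powr (\<alpha> + 2) \<le> norm (deriv f w) powr p * (1 - norm w) powr (\<alpha> + 2)"
        using w \<rho> \<alpha> by (intro mult_left_mono powr_mono2) auto
      ultimately have "norm (deriv f w) powr p * (1 - \<rho>) powr (\<alpha> + 2) \<le> D * max 0 J" by linarith
      then have "norm (deriv f w) powr p \<le> D * max 0 J / (1 - \<rho>) powr (\<alpha> + 2)"
        using \<rho> by (simp add: pos_le_divide_eq)
      then have "(norm (deriv f w) powr p) powr (1 / p) \<le> B"
        unfolding B_def using p by (intro powr_mono2) auto
      then show ?thesis using p by (simp add: powr_powr)
    qed
    have r0: "\<rho> \<ge> 0" using z norm_ge_zero[of z] by linarith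
    have "norm (f z - f 0) \<le> B * norm (z - 0)"
    proof (rule field_differentiable_bound[where S="cball (0::complex) \<rho>" and f'="deriv f"])
      fix w :: complex assume w: "w \<in> cball 0 \<rho>"
      then have w1: "w \<in> ball 0 1" using \<rho> by simp
      show "(f has_field_derivative deriv f w) (at w within cball 0 \<rho>)"
        by (rule has_field_derivative_at_within[OF holomorphic_derivI[OF hol open_ball w1]])
      show "norm (deriv f w) \<le> B" using w by (intro db) auto
    qed (use z r0 in auto)
    also have "\<dots> \<le> B * 1" using z \<rho> by (intro mult_left_mono) (auto simp: B_def)
    finally show "norm (f z) \<le> M + B"
      using M norm_triangle_sub[of "f z" "f 0"] by linarith
  qed
qed

text \<open>Locally uniform convergence passes to derivatives, and Fatou's lemma does the rest. It
  keeps the limit of a bounded sequence inside the source space.\<close>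

lemma dirichlet_Fatou:
  assumes p: "p > 0"
    and F: "\<And>j. F j holomorphic_on ball 0 1" and f: "f holomorphic_on ball 0 1"
    and lim: "\<And>K. \<lbrakk>compact K; K \<subseteq> ball 0 1\<rbrakk> \<Longrightarrow> uniform_limit K F f sequentially"
    and J: "\<And>j. (disc_energy p \<alpha> (deriv (F j))) \<le> J"
  shows "disc_energy p \<alpha> (deriv f) \<le> J"
proof -
  have hd: "deriv (F j) holomorphic_on ball 0 1" for j
    using F by (intro holomorphic_deriv) auto
  have [measurable]: "deriv (F j) \<in> borel_measurable (disc_weight \<alpha>)" for j
    by (rule holomorphic_measurable_disc_weight[OF hd])
  have dlim: "(\<lambda>j. deriv (F j) z) \<longlonglongrightarrow> deriv f z" if z: "z \<in> ball 0 1" for z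
  proof -
    obtain r where r: "r > 0" "cball z r \<subseteq> ball 0 1" using z by (metis open_ball open_contains_cball)
    have ul: "uniform_limit (ball z r) F f sequentially"
      by (rule uniform_limit_on_subset[OF lim[OF _ r(2)]]) auto
    have "(\<lambda>j. (deriv ^^ 1) (F j) z) \<longlonglongrightarrow> (deriv ^^ 1) f z"
    proof (rule higher_deriv_complex_uniform_limit[OF ul])
      have "ball z r \<subseteq> ball 0 1" using r(2) by auto
      then have "F j holomorphic_on ball z r" for j by (rule holomorphic_on_subset[OF F])
      then show "eventually (\<lambda>j. F j holomorphic_on ball z r) sequentially" by simp
    qed (use r in auto)
    then show ?thesis by simp
  qed
  have "disc_energy p \<alpha> (deriv f) =
      (\<integral>\<^sup>+z. liminf (\<lambda>j. ennreal (norm (deriv (F j) z) powr p)) \<partial>disc_weight \<alpha>)"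
  proof (rule nn_integral_cong)
    fix z assume "z \<in> space (disc_weight \<alpha>)"
    then have "z \<in> ball 0 1" by simp
    then have "(\<lambda>j. ennreal (norm (deriv (F j) z) powr p)) \<longlonglongrightarrow> ennreal (norm (deriv f z) powr p)"
      using p by (intro tendsto_ennrealI tendsto_powr' tendsto_norm dlim) auto
    then show "ennreal (norm (deriv f z) powr p) = liminf (\<lambda>j. ennreal (norm (deriv (F j) z) powr p))"
      by (intro lim_imp_Liminf[symmetric]) auto
  qed
  also have "\<dots> \<le> liminf (\<lambda>j. disc_energy p \<alpha> (deriv (F j)))"
    by (rule nn_integral_liminf) measurable
  also have "\<dots> \<le> J"
    by (rule order_trans[OF Liminf_le_Limsup Limsup_bounded]) (auto simp: J)
  finally show ?thesis .
qed

text \<open>Comparison with twice the larger of the two norms gives the constant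
  \<open>2 powr p\<close> for every \<open>p > 0\<close>, below and above 1 alike.\<close>

lemma nn_integral_powr_diff_le:
  assumes p: "p > 0" and f: "f holomorphic_on ball 0 1" and g: "g holomorphic_on ball 0 1"
  shows "(\<integral>\<^sup>+z. ennreal (norm (f z - g z) powr p) \<partial>disc_weight a) \<le>
    ennreal (2 powr p) * (disc_energy p a f + disc_energy p a g)"
proof -
  have [measurable]: "f \<in> borel_measurable (disc_weight a)" "g \<in> borel_measurable (disc_weight a)"
    using f g by (auto intro: holomorphic_measurable_disc_weight)
  have le: "norm (x - y) powr p \<le> 2 powr p * (norm x powr p + norm y powr p)" for x y :: complex
  proof -
    have "norm (x - y) \<le> 2 * max (norm x) (norm y)" using norm_triangle_ineq4[of x y] by linarith
    then have "norm (x - y) powr p \<le> (2 * max (norm x) (norm y)) powr p" using p by (intro powr_mono2) auto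
    also have "\<dots> = 2 powr p * max (norm x) (norm y) powr p" by (simp add: powr_mult)
    also have "\<dots> \<le> 2 powr p * (norm x powr p + norm y powr p)"
      by (intro mult_left_mono) (auto simp: max_def)
    finally show ?thesis .
  qed
  have "(\<integral>\<^sup>+z. ennreal (norm (f z - g z) powr p) \<partial>disc_weight a) \<le>
      (\<integral>\<^sup>+z. ennreal (2 powr p) * (ennreal (norm (f z) powr p) + ennreal (norm (g z) powr p)) \<partial>disc_weight a)"
    using le by (intro nn_integral_mono) (auto simp: ennreal_mult'[symmetric] ennreal_plus[symmetric] simp del: ennreal_plus intro!: ennreal_leI)
  also have "\<dots> = ennreal (2 powr p) * (disc_energy p a f + disc_energy p a g)"
    by (subst nn_integral_cmult, measurable) (subst nn_integral_add, auto)
  finally show ?thesis .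
qed

lemma deriv_diff_disc:
  assumes "f holomorphic_on ball 0 1" "g holomorphic_on ball 0 1" "z \<in> ball 0 1"
  shows "deriv (\<lambda>z. f z - g z) z = deriv f z - deriv g z"
  using higher_deriv_diff[OF assms(1,2) open_ball assms(3), of 1] by simp

subsection \<open>Sufficiency\<close>

lemma measure_01I:
  assumes mu: "measure_on_01 \<mu>" and fin: "emeasure \<mu> {0..<1} < \<infinity>"
  shows "measure_01 \<mu>"
proof -
  have sets: "sets \<mu> = sets borel" and null: "emeasure \<mu> (UNIV - {0..<1}) = 0"
    using mu by (auto simp: measure_on_01_def)
  have sp: "space \<mu> = UNIV" using sets_eq_imp_space_eq[OF sets] by simp
  have "emeasure \<mu> (space \<mu>) \<le> emeasure \<mu> {0..<1} + emeasure \<mu> (UNIV - {0..<1})"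
    unfolding sp by (rule order_trans[OF _ emeasure_subadditive]) (auto simp: sets intro!: emeasure_mono)
  then have f: "emeasure \<mu> (space \<mu>) \<noteq> \<infinity>" using fin null by (auto simp: top_unique)
  have "AE t in \<mu>. t \<in> {0..<1}"
    by (rule AE_I[OF _ null]) (auto simp: sets sp)
  with f sets show ?thesis
    by (auto intro!: measure_01.intro finite_measureI measure_01_axioms.intro)
qed

text \<open>Here \<kappa> = N/p is the growth rate of functions, \<theta> = N (1 - 1/q) the rate in
  \<open>Hankel_norm_bound\<close>, and \<kappa> + \<theta> the Carleson exponent: the three powers
  of 2 cancel and only the constant of the measure bound survives.\<close>

lemma block_energy_le:
  fixes x m c \<kappa> \<theta> q :: real
  assumes "0 \<le> x" "0 \<le> m" "m \<le> c * 2 powr (- real i * (\<kappa> + \<theta>))" "0 \<le> c" "0 < q"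
  shows "(x * 2 powr (real i * \<kappa>) * m * 2 powr (real i * \<theta>)) powr q \<le> c powr q * x powr q"
proof -
  have "x * 2 powr (real i * \<kappa>) * m * 2 powr (real i * \<theta>) = x * (2 powr (real i * \<kappa>) * 2 powr (real i * \<theta>)) * m"
    by simp
  also have "\<dots> \<le> x * (2 powr (real i * \<kappa>) * 2 powr (real i * \<theta>)) * (c * 2 powr (- real i * (\<kappa> + \<theta>)))"
    using assms by (intro mult_left_mono) auto
  also have "\<dots> = c * x * (2 powr (real i * \<kappa>) * 2 powr (real i * \<theta>) * 2 powr (- real i * (\<kappa> + \<theta>)))"
    by simp
  also have "2 powr (real i * \<kappa>) * 2 powr (real i * \<theta>) * 2 powr (- real i * (\<kappa> + \<theta>)) = (2::real) powr 0"
    by (simp only: powr_add[symmetric]) (simp add: algebra_simps)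
  finally have "x * 2 powr (real i * \<kappa>) * m * 2 powr (real i * \<theta>) \<le> c * x" by simp
  then have "(x * 2 powr (real i * \<kappa>) * m * 2 powr (real i * \<theta>)) powr q \<le> (c * x) powr q"
    using assms by (intro powr_mono2) auto
  then show ?thesis by (simp add: powr_mult)
qed

lemma vanishing_carleson_dyadic:
  assumes sets: "sets \<mu> = sets borel" and van: "vanishing_carleson \<mu> s" and "\<epsilon> > 0"
  obtains i0 where "\<And>i. i \<ge> i0 \<Longrightarrow> measure \<mu> (dyadic_block i) \<le> \<epsilon> * 2 powr (- real i * s)"
proof -
  obtain \<delta> where \<delta>: "\<delta> > 0" and le: "\<And>t. 1 - \<delta> < t \<Longrightarrow> t < 1 \<Longrightarrow> emeasure \<mu> {t..<1} \<le> ennreal (\<epsilon> * (1 - t) powr s)"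
    using van \<open>\<epsilon> > 0\<close> unfolding vanishing_carleson_def by meson
  obtain i0 :: nat where i0: "(1/2) ^ i0 < \<delta>"
    using real_arch_pow_inv[OF \<delta>, of "1/2"] by auto
  show ?thesis
  proof (rule that[of i0])
    fix i assume i: "i \<ge> i0"
    have "(1/2 :: real) ^ i \<le> (1/2) ^ i0" using i by (intro power_decreasing) auto
    moreover have "2 powr (- real i) = (1/2 :: real) ^ i"
      by (simp add: powr_minus_divide powr_realpow power_one_over)
    ultimately have "2 powr (- real i) < \<delta>" using i0 by linarith
    then have "emeasure \<mu> {1 - 2 powr (- real i)..<1} \<le> ennreal (\<epsilon> * (1 - (1 - 2 powr (- real i))) powr s)"
      by (intro le) auto
    then show "measure \<mu> (dyadic_block i) \<le> \<epsilon> * 2 powr (- real i * s)"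
      using \<open>\<epsilon> > 0\<close> by (intro measure_dyadic_block_le[OF sets]) auto
  qed
qed

context measure_01 begin

text \<open>The Montel limit \<open>f\<close> obeys the same energy bound, so the differences
  \<open>h j\<close> are bounded in the source space and tend to 0 uniformly on compact sets. Blocks
  from \<open>i0\<close> on contribute little by the vanishing condition, uniformly in
  \<open>j\<close>; the earlier blocks lie in a compact segment of the radius, where
  \<open>h j\<close> is eventually small.\<close>

lemma Hankel_compact_if_vanishing:
  assumes p: "p > 0" and q: "q > 1" and pq: "p \<le> q" and \<alpha>: "\<alpha> > p - 1"
    and van: "vanishing_carleson \<mu> ((\<alpha> + 2 - p) / p + (\<alpha> + 2 - p) * (1 - 1 / q))"
  shows "Hankel_compact \<mu> (\<alpha> + 1 - p) p \<alpha> q (\<alpha> - p)"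
proof -
  define b where "b = \<alpha> + 1 - p"
  have b: "b > 0" and \<alpha>b: "\<alpha> - p = b - 1" "\<alpha> + 2 - p = b + 1" using \<alpha> by (auto simp: b_def)
  define \<kappa> where "\<kappa> = (b + 1) / p"
  define \<theta> where "\<theta> = (b + 1) * (1 - 1 / q)"
  let ?s = "\<kappa> + \<theta>"
  have \<kappa>\<theta>: "\<kappa> > 0" "\<theta> > 0" using b p q by (auto simp: \<kappa>_def \<theta>_def)
  have q0: "q > 0" and \<alpha>1: "\<alpha> > -1" using q p \<alpha> by auto
  have van': "vanishing_carleson \<mu> ?s" using van by (simp add: \<kappa>_def \<theta>_def \<alpha>b)
  have fin: "emeasure \<mu> {0..<1} < \<infinity>" by (simp add: less_top[symmetric])
  have car: "carleson \<mu> ?s"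
    using \<kappa>\<theta> by (intro vanishing_carleson_imp_carleson[OF van' fin sets_mu]) auto
  have sm: "summable (\<lambda>k. norm (taylor_coeff f k) * (\<integral>t. t ^ k \<partial>\<mu>))" if "in_dirichlet p \<alpha> f" for f
    using dirichlet_summable[OF p \<alpha> that q pq] car by (simp add: \<kappa>_def \<theta>_def \<alpha>b)
  let ?m = "\<lambda>i. measure \<mu> (dyadic_block i)"
  obtain R where R: "R > 0" "\<And>h F E. \<lbrakk>h holomorphic_on ball 0 1;
      summable (\<lambda>k. norm (taylor_coeff h k) * (\<integral>t. t ^ k \<partial>\<mu>)); \<forall>i. F i \<ge> 0;
      \<forall>i. \<forall>t\<in>dyadic_block i. norm (h (of_real t)) \<le> F i;
      summable (\<lambda>i. (F i * measure \<mu> (dyadic_block i) * 2 powr (real i * ((b + 1) * (1 - 1 / q)))) powr q);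
      (\<Sum>i. (F i * measure \<mu> (dyadic_block i) * 2 powr (real i * ((b + 1) * (1 - 1 / q)))) powr q) \<le> E\<rbrakk> \<Longrightarrow>
    in_dirichlet q (b - 1) (Hankel \<mu> b h) \<and> dirichlet_norm q (b - 1) (Hankel \<mu> b h) \<le> R * E powr (1 / q)"
    by (rule Hankel_norm_bound[OF b q]) (rule that, assumption+)
  note R2 = R(2)[folded \<theta>_def]
  obtain C where C: "C > 0" "\<And>i. ?m i \<le> C * 2 powr (- real i * ?s)"
    by (rule carleson_dyadic[OF sets_mu car]) (rule that, assumption+)

  have maps: "H_defined \<mu> b f \<and> in_dirichlet q (b - 1) (Hankel \<mu> b f)" if f: "in_dirichlet p \<alpha> f" for f
  proof -
    note hol = in_dirichlet_deriv(1)[OF f]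
    obtain J where J: "disc_energy p \<alpha> (deriv f) = ennreal J"
      using in_dirichlet_deriv(3)[OF f] by (cases "disc_energy p \<alpha> (deriv f)") auto
    obtain A where A: "\<And>g. \<lbrakk>g holomorphic_on ball 0 1; norm (g 0) \<le> norm (f 0);
        disc_energy p \<alpha> (deriv g) \<le> ennreal J\<rbrakk> \<Longrightarrow>
      \<exists>x. (\<forall>i. x i \<ge> 0) \<and> summable (\<lambda>i. x i powr q) \<and> (\<Sum>i. x i powr q) \<le> A \<and>
        (\<forall>i. \<forall>t\<in>dyadic_block i. norm (g (of_real t)) \<le> x i * 2 powr (real i * ((\<alpha> + 2 - p) / p)))"
      by (rule dirichlet_dyadic_bound[OF p pq \<alpha>]) (rule that, assumption+)
    obtain x where x0: "\<And>i. x i \<ge> 0" and xs: "summable (\<lambda>i. x i powr q)" and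
      fx: "\<And>i t. t \<in> dyadic_block i \<Longrightarrow> norm (f (of_real t)) \<le> x i * 2 powr (real i * \<kappa>)"
      using A[OF hol order_refl] J unfolding \<alpha>b \<kappa>_def by auto
    have le: "(x i * 2 powr (real i * \<kappa>) * ?m i * 2 powr (real i * \<theta>)) powr q \<le> C powr q * x i powr q" for i
      by (rule block_energy_le) (use x0 C q0 in auto)
    have "summable (\<lambda>i. (x i * 2 powr (real i * \<kappa>) * ?m i * 2 powr (real i * \<theta>)) powr q)"
      by (rule summable_comparison_test'[OF summable_mult[OF xs, of "C powr q"], of 0]) (use le in auto)
    from R2[OF hol sm[OF f] _ _ this order_refl] x0 fx
    have "in_dirichlet q (b - 1) (Hankel \<mu> b f)" by auto
    with H_defined[OF b hol sm[OF f]] show ?thesis by blast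
  qed

  have comp: "\<exists>r g. strict_mono r \<and> in_dirichlet q (b - 1) g \<and>
      (\<lambda>j. dirichlet_norm q (b - 1) (\<lambda>z. Hankel \<mu> b (F (r j)) z - g z)) \<longlonglongrightarrow> 0"
    if F: "\<forall>j. in_dirichlet p \<alpha> (F j) \<and> dirichlet_norm p \<alpha> (F j) \<le> M" for F :: "nat \<Rightarrow> complex \<Rightarrow> complex" and M
  proof -
    define J where "J = pi * M powr p / (\<alpha> + 1)"
    have J0: "J \<ge> 0" using \<alpha>1 by (simp add: J_def)
    have Fhol: "F j holomorphic_on ball 0 1" and FM: "norm (F j 0) \<le> M"
      and FJ: "disc_energy p \<alpha> (deriv (F j)) \<le> ennreal J" for j
      using F in_dirichlet_deriv(1) dirichlet_norm_le_imp[OF _ _ p \<alpha>1] unfolding J_def by blast+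
    have Fdhol: "deriv (F j) holomorphic_on ball 0 1" for j
      using Fhol by (intro holomorphic_deriv) auto
    have locbound: "\<exists>B. \<forall>h\<in>range F. \<forall>z\<in>K. norm (h z) \<le> B" if K: "compact K" "K \<subseteq> ball 0 1" for K
    proof (cases "K = {}")
      case False
      obtain z0 where z0: "z0 \<in> K" "\<forall>z\<in>K. norm z \<le> norm z0"
        using continuous_attains_sup[OF K(1) False, of norm] by (auto intro: continuous_intros)
      have "norm z0 < 1" using z0 K by auto
      then obtain B where "\<And>f (z::complex). \<lbrakk>f holomorphic_on ball 0 1; norm (f 0) \<le> M;
          disc_energy p \<alpha> (deriv f) \<le> ennreal J; norm z \<le> norm z0\<rbrakk> \<Longrightarrow> norm (f z) \<le> B"
        by (rule dirichlet_local_bound[OF p \<alpha>1, of _ M J]) (rule that, assumption+)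
      then show ?thesis using Fhol FM FJ z0 by (intro exI[of _ B]) auto
    qed auto
    obtain f r where f: "f holomorphic_on ball 0 1" and r: "strict_mono r"
      and lim: "\<And>x. x \<in> ball 0 1 \<Longrightarrow> (\<lambda>n. F (r n) x) \<longlonglongrightarrow> f x"
      and ulim: "\<And>K. compact K \<Longrightarrow> K \<subseteq> ball 0 1 \<Longrightarrow> uniform_limit K (F \<circ> r) f sequentially"
      by (rule Montel[of "ball 0 1" "range F" F]) (use locbound Fhol in auto)
    have fM: "norm (f 0) \<le> M"
      by (rule tendsto_upperbound[OF tendsto_norm[OF lim]]) (use FM in auto)
    have fJ: "disc_energy p \<alpha> (deriv f) \<le> ennreal J"
      by (rule dirichlet_Fatou[OF p _ f, of "F \<circ> r"]) (use Fhol FJ ulim in auto)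
    have fd: "in_dirichlet p \<alpha> f"
      using fJ by (intro in_dirichletI[OF f]) (auto simp: order_le_less_trans)
    have fdhol: "deriv f holomorphic_on ball 0 1" using f by (intro holomorphic_deriv) auto
    define h where "h j z = F (r j) z - f z" for j z
    have hhol: "h j holomorphic_on ball 0 1" for j
      unfolding h_def by (intro holomorphic_intros Fhol f)
    define J' where "J' = 2 powr p * (J + J)"
    have hM: "norm (h j 0) \<le> M + M" for j
      unfolding h_def using FM[of "r j"] fM norm_triangle_ineq4[of "F (r j) 0" "f 0"] by linarith
    have hJ: "disc_energy p \<alpha> (deriv (h j)) \<le> ennreal J'" for j
    proof -
      have "disc_energy p \<alpha> (deriv (h j)) = (\<integral>\<^sup>+z. ennreal (norm (deriv (F (r j)) z - deriv f z) powr p) \<partial>disc_weight \<alpha>)"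
        unfolding h_def by (intro nn_integral_cong) (simp add: deriv_diff_disc[OF Fhol f])
      also have "\<dots> \<le> ennreal (2 powr p) * (disc_energy p \<alpha> (deriv (F (r j))) + disc_energy p \<alpha> (deriv f))"
        by (rule nn_integral_powr_diff_le[OF p Fdhol fdhol])
      also have "\<dots> \<le> ennreal (2 powr p) * (ennreal J + ennreal J)"
        by (intro mult_left_mono add_mono FJ fJ) auto
      also have "\<dots> = ennreal J'"
        unfolding J'_def by (simp only: ennreal_plus[OF J0 J0, symmetric] ennreal_mult'[symmetric] powr_ge_zero)
      finally show ?thesis .
    qed
    have hd: "in_dirichlet p \<alpha> (h j)" for j
      using hJ[of j] by (intro in_dirichletI[OF hhol]) (auto simp: order_le_less_trans)
    \<comment> \<open>One constant \<open>A\<close> serves all \<open>j\<close>; the tail estimate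
      below depends on this uniformity.\<close>
    obtain A where A: "\<And>g. \<lbrakk>g holomorphic_on ball 0 1; norm (g 0) \<le> M + M;
        disc_energy p \<alpha> (deriv g) \<le> ennreal J'\<rbrakk> \<Longrightarrow>
      \<exists>x. (\<forall>i. x i \<ge> 0) \<and> summable (\<lambda>i. x i powr q) \<and> (\<Sum>i. x i powr q) \<le> A \<and>
        (\<forall>i. \<forall>t\<in>dyadic_block i. norm (g (of_real t)) \<le> x i * 2 powr (real i * ((\<alpha> + 2 - p) / p)))"
      by (rule dirichlet_dyadic_bound[OF p pq \<alpha>]) (rule that, assumption+)
    have "\<exists>x. (\<forall>i. x i \<ge> 0) \<and> summable (\<lambda>i. x i powr q) \<and> (\<Sum>i. x i powr q) \<le> A \<and>
        (\<forall>i. \<forall>t\<in>dyadic_block i. norm (h j (of_real t)) \<le> x i * 2 powr (real i * \<kappa>))" for j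
      using A[OF hhol hM hJ] unfolding \<alpha>b \<kappa>_def .
    then obtain x where x: "\<And>j i. x j i \<ge> 0" "\<And>j. summable (\<lambda>i. x j i powr q)" "\<And>j. (\<Sum>i. x j i powr q) \<le> A"
        "\<And>j i t. t \<in> dyadic_block i \<Longrightarrow> norm (h j (of_real t)) \<le> x j i * 2 powr (real i * \<kappa>)"
      by metis
    have A0: "A \<ge> 0"
    proof -
      have "0 \<le> (\<Sum>i. x 0 i powr q)" by (intro suminf_nonneg x) auto
      then show ?thesis using x(3)[of 0] by linarith
    qed
    have small: "eventually (\<lambda>j. dirichlet_norm q (b - 1) (Hankel \<mu> b (h j)) \<le> R * E powr (1 / q)) sequentially"
      if E: "E > 0" for E
    proof -
      have half: "E / (2 * (X + 1)) * X \<le> E / 2" if "X \<ge> 0" for X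
      proof -
        have "E / (2 * (X + 1)) * X \<le> E / (2 * (X + 1)) * (X + 1)" using that E by (intro mult_left_mono) auto
        also have "\<dots> = E / 2" using that by (simp add: divide_simps)
        finally show ?thesis .
      qed
      \<comment> \<open>Half of the budget \<open>E\<close> goes to the tail and half to the head;
        adding 1 to \<open>A\<close> and to \<open>S\<close> keeps the denominators
        positive.\<close>
      define \<epsilon> where "\<epsilon> = (E / (2 * (A + 1))) powr (1 / q)"
      have \<epsilon>: "\<epsilon> > 0" using E A0 by (simp add: \<epsilon>_def)
      have "\<epsilon> powr q = E / (2 * (A + 1))" using E A0 q0 by (simp add: \<epsilon>_def powr_powr)
      then have \<epsilon>A: "\<epsilon> powr q * A \<le> E / 2" using half[OF A0] by simp
      obtain i0 where i0: "\<And>i. i \<ge> i0 \<Longrightarrow> ?m i \<le> \<epsilon> * 2 powr (- real i * ?s)"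
        by (rule vanishing_carleson_dyadic[OF sets_mu van' \<epsilon>]) (rule that, assumption+)
      define S where "S = (\<Sum>i<i0. (?m i * 2 powr (real i * \<theta>)) powr q)"
      have S0: "S \<ge> 0" unfolding S_def by (intro sum_nonneg) auto
      \<comment> \<open>\<open>\<eta>\<close> is chosen after \<open>i0\<close>, since the head sum
        \<open>S\<close> depends on \<open>i0\<close>.\<close>
      define \<eta> where "\<eta> = (E / (2 * (S + 1))) powr (1 / q)"
      have \<eta>: "\<eta> > 0" using E S0 by (simp add: \<eta>_def)
      have "\<eta> powr q = E / (2 * (S + 1))" using E S0 q0 by (simp add: \<eta>_def powr_powr)
      then have \<eta>S: "\<eta> powr q * S \<le> E / 2" using half[OF S0] by simp
      \<comment> \<open>The last head block, of index \<open>i0 - 1\<close>, ends at 1 - 2^(-i0), so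
        this segment contains all head blocks.\<close>
      let ?K = "of_real ` {0..1 - 2 powr (- real i0)} :: complex set"
      have K: "compact ?K" "?K \<subseteq> ball 0 1"
      proof -
        show "compact ?K" by (intro compact_continuous_image continuous_intros) auto
        have "(0::real) < 2 powr (- real i0)" by simp
        then show "?K \<subseteq> ball 0 1" by (auto simp del: powr_gt_zero)
      qed
      have "eventually (\<lambda>j. \<forall>z\<in>?K. dist ((F \<circ> r) j z) (f z) < \<eta>) sequentially"
        by (rule uniform_limitD[OF ulim[OF K] \<eta>])
      then show ?thesis
      proof eventually_elim
        case (elim j)
        define G where "G i = (if i < i0 then \<eta> else x j i * 2 powr (real i * \<kappa>))" for i
        have G0: "G i \<ge> 0" for i using \<eta> x(1) by (simp add: G_def)
        have hG: "norm (h j (of_real t)) \<le> G i" if t: "t \<in> dyadic_block i" for i t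
        proof (cases "i < i0")
          case True
          have t1: "t < 1 - 2 powr (- real (Suc i))" and t0: "0 \<le> t"
            using t dyadic_block_subset(2)[of i] by (auto simp: dyadic_block_def simp del: of_nat_Suc)
          have "2 powr (- real i0) \<le> (2::real) powr (- real (Suc i))" using True by (intro powr_mono) auto
          with t1 have "t \<le> 1 - 2 powr (- real i0)" by linarith
          with t0 have "t \<in> {0..1 - 2 powr (- real i0)}" by simp
          then have "dist ((F \<circ> r) j (of_real t)) (f (of_real t)) < \<eta>" using elim by blast
          then show ?thesis using True by (simp add: G_def h_def dist_norm)
        qed (use x(4)[OF t] in \<open>simp add: G_def\<close>)
        define g where "g i = (if i < i0 then \<eta> powr q * (?m i * 2 powr (real i * \<theta>)) powr q else 0)" for i
        have le: "(G i * ?m i * 2 powr (real i * \<theta>)) powr q \<le> g i + \<epsilon> powr q * x j i powr q" for i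
        proof (cases "i < i0")
          case True
          then have "(G i * ?m i * 2 powr (real i * \<theta>)) powr q = g i"
            by (simp add: G_def g_def mult.assoc powr_mult)
          then show ?thesis by simp
        next
          case False
          have "(x j i * 2 powr (real i * \<kappa>) * ?m i * 2 powr (real i * \<theta>)) powr q \<le> \<epsilon> powr q * x j i powr q"
            by (rule block_energy_le) (use x(1) i0[of i] False \<epsilon> q0 in auto)
          then show ?thesis using False by (simp add: G_def g_def)
        qed
        have gsums: "g sums (\<Sum>i<i0. g i)"
          by (rule sums_finite) (auto simp: g_def)
        have gS: "(\<Sum>i<i0. g i) = \<eta> powr q * S"
          unfolding S_def sum_distrib_left by (intro sum.cong) (auto simp: g_def)
        have smx: "summable (\<lambda>i. g i + \<epsilon> powr q * x j i powr q)"
          by (intro summable_add summable_mult x(2) sums_summable[OF gsums])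
        have smG: "summable (\<lambda>i. (G i * ?m i * 2 powr (real i * \<theta>)) powr q)"
          by (rule summable_comparison_test'[OF smx, of 0]) (use le in auto)
        have "(\<Sum>i. (G i * ?m i * 2 powr (real i * \<theta>)) powr q) \<le> (\<Sum>i. g i + \<epsilon> powr q * x j i powr q)"
          by (intro suminf_le le smG smx)
        also have "\<dots> = (\<Sum>i. g i) + (\<Sum>i. \<epsilon> powr q * x j i powr q)"
          by (rule suminf_add[symmetric]) (intro summable_mult x(2) sums_summable[OF gsums])+
        also have "(\<Sum>i. g i) = \<eta> powr q * S" using sums_unique[OF gsums] gS by simp
        also have "(\<Sum>i. \<epsilon> powr q * x j i powr q) = \<epsilon> powr q * (\<Sum>i. x j i powr q)"
          by (rule suminf_mult[OF x(2)])
        also have "\<dots> \<le> \<epsilon> powr q * A" by (intro mult_left_mono x(3)) auto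
        finally have "(\<Sum>i. (G i * ?m i * 2 powr (real i * \<theta>)) powr q) \<le> E" using \<eta>S \<epsilon>A by linarith
        from R2[OF hhol sm[OF hd] _ _ smG this] G0 hG show ?case by auto
      qed
    qed
    have norm_h: "dirichlet_norm q (b - 1) (\<lambda>z. Hankel \<mu> b (F (r j)) z - Hankel \<mu> b f z) = dirichlet_norm q (b - 1) (Hankel \<mu> b (h j))" for j
    proof (rule dirichlet_norm_cong)
      have Fd: "in_dirichlet p \<alpha> (F (r j))" using F by blast
      show "(\<lambda>z. Hankel \<mu> b (F (r j)) z - Hankel \<mu> b f z) holomorphic_on ball 0 1"
        by (intro holomorphic_intros Hankel_holomorphic b f Fhol sm fd Fd)
      show "Hankel \<mu> b (h j) holomorphic_on ball 0 1"
        by (intro Hankel_holomorphic b hhol sm hd)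
      fix z :: complex assume "z \<in> ball 0 1"
      then show "Hankel \<mu> b (F (r j)) z - Hankel \<mu> b f z = Hankel \<mu> b (h j) z"
        unfolding h_def[abs_def] by (intro Hankel_diff[symmetric] b f Fhol sm fd Fd)
    qed
    have "(\<lambda>j. dirichlet_norm q (b - 1) (\<lambda>z. Hankel \<mu> b (F (r j)) z - Hankel \<mu> b f z)) \<longlonglongrightarrow> 0"
      unfolding norm_h
    proof (rule LIMSEQ_I)
      fix \<tau> :: real assume \<tau>: "\<tau> > 0"
      \<comment> \<open>Chosen so that \<open>R * E powr (1 / q)\<close> equals \<tau>/2.\<close>
      define E where "E = (\<tau> / (2 * R)) powr q"
      have E: "E > 0" using \<tau> R by (simp add: E_def)
      have RE: "R * E powr (1 / q) < \<tau>"
        using \<tau> R(1) q0 by (simp add: E_def powr_powr)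
      from small[OF E] obtain n0 where n0: "\<And>j. j \<ge> n0 \<Longrightarrow> dirichlet_norm q (b - 1) (Hankel \<mu> b (h j)) \<le> R * E powr (1 / q)"
        by (auto simp: eventually_sequentially)
      have "0 \<le> dirichlet_norm q (b - 1) (Hankel \<mu> b (h j))" for j
        by (simp add: dirichlet_norm_def bergman_norm_def)
      then show "\<exists>no. \<forall>n\<ge>no. norm (dirichlet_norm q (b - 1) (Hankel \<mu> b (h n)) - 0) < \<tau>"
        using n0 RE by (intro exI[of _ n0]) (auto intro: order_le_less_trans)
    qed
    with r maps[OF fd] show ?thesis by blast
  qed
  show ?thesis
    unfolding Hankel_compact_def \<alpha>b(1) b_def[symmetric] using maps comp by blast
qed

end

subsection \<open>Necessity\<close>

text \<open>The ball about \<open>A j\<close> of radius half the distance to the circle runs off to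
  the point 1 and so eventually leaves every fixed \<open>z\<close> behind. Dominated convergence,
  with the integrand of the finite energy as majorant, sends the local integrals to 0.\<close>

lemma weighted_point_eval_tendsto_0:
  assumes q: "q > 0" and g: "g holomorphic_on ball 0 1"
    and fin: "disc_energy q \<gamma> g < \<infinity>"
    and A: "\<And>j. 0 < A j" "\<And>j. A j < 1" "A \<longlonglongrightarrow> (1::real)"
  shows "(\<lambda>j. norm (g (of_real (A j))) * (1 - A j) powr ((\<gamma> + 2) / q)) \<longlonglongrightarrow> 0"
proof -
  have [measurable]: "g \<in> borel_measurable (disc_weight \<gamma>)"
    by (rule holomorphic_measurable_disc_weight) fact
  have [measurable]: "(\<lambda>z. indicator (ball w r) z :: ennreal) \<in> borel_measurable (disc_weight \<gamma>)" for w :: complex and r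
    by (rule measurable_disc_weightI) simp
  obtain D where D: "D > 0" "\<And>g z. \<lbrakk>g holomorphic_on ball 0 1; z \<in> ball 0 1\<rbrakk> \<Longrightarrow>
    ennreal (norm (g z) powr q * (1 - norm z) powr (\<gamma> + 2)) \<le>
      ennreal D * (\<integral>\<^sup>+\<zeta>. indicator (ball z ((1 - norm z) / 2)) \<zeta> * ennreal (norm (g \<zeta>) powr q) \<partial>disc_weight \<gamma>)"
    by (rule pointwise_bound[OF q]) (rule that, assumption+)
  let ?I = "\<lambda>j. \<integral>\<^sup>+z. indicator (ball (of_real (A j)) ((1 - A j) / 2)) z * ennreal (norm (g z) powr q) \<partial>disc_weight \<gamma>"
  have "?I \<longlonglongrightarrow> (\<integral>\<^sup>+z. 0 \<partial>disc_weight \<gamma>)"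
  proof (rule nn_integral_dominated_convergence[OF _ _ _ _ fin])
    show "AE z in disc_weight \<gamma>. (\<lambda>j. indicator (ball (of_real (A j)) ((1 - A j) / 2)) z * ennreal (norm (g z) powr q)) \<longlonglongrightarrow> 0"
    proof (rule AE_I2)
      fix z assume "z \<in> space (disc_weight \<gamma>)"
      then have "0 < norm (1 - z)" by auto
      moreover have "(\<lambda>j. 2 * (1 - A j)) \<longlonglongrightarrow> 2 * (1 - 1)" by (intro tendsto_intros A)
      ultimately have "eventually (\<lambda>j. 2 * (1 - A j) < norm (1 - z)) sequentially"
        by (intro order_tendstoD) auto
      then have "eventually (\<lambda>j. indicator (ball (of_real (A j)) ((1 - A j) / 2)) z * ennreal (norm (g z) powr q) = 0) sequentially"
      proof eventually_elim
        case (elim j)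
        \<comment> \<open>A point of the ball satisfies |1 - z| < (3/2) (1 - A j), which the choice
          of \<open>j\<close> excludes.\<close>
        have "z \<notin> ball (of_real (A j)) ((1 - A j) / 2)"
        proof
          assume "z \<in> ball (of_real (A j)) ((1 - A j) / 2)"
          then have 1: "norm (of_real (A j) - z) < (1 - A j) / 2" by (simp add: dist_norm)
          have 2: "norm (1 - z) \<le> norm (1 - complex_of_real (A j)) + norm (of_real (A j) - z)"
            using norm_triangle_ineq[of "1 - complex_of_real (A j)" "of_real (A j) - z"] by simp
          have 3: "norm (1 - complex_of_real (A j)) = 1 - A j"
            using A(2)[of j] by (metis abs_of_pos diff_gt_0_iff_gt norm_of_real of_real_1 of_real_diff)
          have "False" if "x < (1 - y) / 2" "w \<le> X + x" "X = 1 - y" "2 * (1 - y) < w" "y < 1" for w x y X :: real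
            using that by (simp add: field_simps)
          from this[OF 1 2 3 elim A(2)] show False .
        qed
        then show ?case by simp
      qed
      then show "(\<lambda>j. indicator (ball (of_real (A j)) ((1 - A j) / 2)) z * ennreal (norm (g z) powr q)) \<longlonglongrightarrow> 0"
        by (rule tendsto_eventually)
    qed
    show "(\<lambda>z. indicator (ball (of_real (A j)) ((1 - A j) / 2)) z * ennreal (norm (g z) powr q)) \<in> borel_measurable (disc_weight \<gamma>)" for j
      by measurable
  qed (auto simp: indicator_def)
  then have I0: "?I \<longlonglongrightarrow> 0" by simp
  have "(\<lambda>j. ennreal D * ?I j) \<longlonglongrightarrow> ennreal D * 0"
    by (intro ennreal_tendsto_cmult I0) auto
  then have "(\<lambda>j. ennreal D * ?I j) \<longlonglongrightarrow> 0" by simp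
  then have lim: "(\<lambda>j. ennreal (norm (g (of_real (A j))) powr q * (1 - A j) powr (\<gamma> + 2))) \<longlonglongrightarrow> 0"
  proof (rule tendsto_sandwich[OF _ _ tendsto_const, rotated 2])
    show "eventually (\<lambda>j. ennreal (norm (g (of_real (A j))) powr q * (1 - A j) powr (\<gamma> + 2)) \<le> ennreal D * ?I j) sequentially"
    proof (rule always_eventually, rule allI)
      fix j
      have "norm (complex_of_real (A j)) = A j" using A(1)[of j] by simp
      then show "ennreal (norm (g (of_real (A j))) powr q * (1 - A j) powr (\<gamma> + 2)) \<le> ennreal D * ?I j"
        using D(2)[OF g, of "of_real (A j)"] A(2)[of j] by simp
    qed
  qed auto
  have "(\<lambda>j. norm (g (of_real (A j))) powr q * (1 - A j) powr (\<gamma> + 2)) \<longlonglongrightarrow> 0"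
    using lim by (subst (asm) ennreal_0[symmetric], subst (asm) tendsto_ennreal_iff) auto
  then have "(\<lambda>j. (norm (g (of_real (A j))) powr q * (1 - A j) powr (\<gamma> + 2)) powr (1 / q)) \<longlonglongrightarrow> 0 powr (1 / q)"
    using q by (intro tendsto_powr') auto
  then show ?thesis using q by (simp add: powr_mult powr_powr)
qed

section \<open>Test functions and the lower bound for their images\<close>

text \<open>The exponent exceeds \<kappa> = N/p by 1, so that the energy of the derivative
  concentrates at distance about 1 - a from the point 1; the factor 1 - a then keeps this energy
  bounded in \<open>a\<close>.\<close>

definition test_fun :: "real \<Rightarrow> real \<Rightarrow> complex \<Rightarrow> complex" where
  "test_fun \<kappa> a z = of_real (1 - a) * (1 - of_real a * z) powr (- of_real (\<kappa> + 1))"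

lemma one_minus_mult_not_nonpos:
  fixes z :: complex
  assumes "0 \<le> a" "a * norm z < 1"
  shows "1 - of_real a * z \<notin> \<real>\<^sub>\<le>\<^sub>0"
proof -
  have "a * Re z \<le> a * norm z" using assms by (intro mult_left_mono complex_Re_le_cmod) auto
  then have "0 < Re (1 - of_real a * z)" using assms by simp
  then show ?thesis by (auto simp: complex_nonpos_Reals_iff)
qed

lemma test_fun_has_deriv:
  assumes "0 \<le> a" "a * norm z < 1"
  shows "(test_fun \<kappa> a has_field_derivative
    of_real ((1 - a) * (\<kappa> + 1) * a) * (1 - of_real a * z) powr (- of_real (\<kappa> + 2))) (at z)"
proof -
  have "(test_fun \<kappa> a has_field_derivative
    of_real (1 - a) * ((- of_real (\<kappa> + 1)) * (1 - of_real a * z) powr (- of_real (\<kappa> + 1) - 1) * (- of_real a))) (at z)"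
  proof -
    have d1: "((\<lambda>w. w powr (- of_real (\<kappa> + 1))) has_field_derivative
        (- of_real (\<kappa> + 1)) * (1 - of_real a * z) powr (- of_real (\<kappa> + 1) - 1)) (at (1 - of_real a * z))"
      by (rule has_field_derivative_powr[OF one_minus_mult_not_nonpos[OF assms]])
    have d2: "((\<lambda>z. 1 - of_real a * z) has_field_derivative (- of_real a)) (at z)"
      by (auto intro!: derivative_eq_intros)
    show ?thesis
      unfolding test_fun_def[abs_def] by (rule DERIV_cmult[OF DERIV_chain2[OF d1 d2]])
  qed
  moreover have "- of_real (\<kappa> + 1) - 1 = - complex_of_real (\<kappa> + 2)" by simp
  moreover have "of_real (1 - a) * ((- of_real (\<kappa> + 1)) * P * (- of_real a)) = of_real ((1 - a) * (\<kappa> + 1) * a) * P" for P :: complex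
    by (simp add: algebra_simps)
  ultimately show ?thesis by (simp only:)
qed

text \<open>For \<open>a < 1\<close> the larger disc contains the closed unit disc; this is what
  makes the Taylor coefficients absolutely summable.\<close>

lemma test_fun_holomorphic:
  assumes "0 < a" shows "test_fun \<kappa> a holomorphic_on ball 0 (1 / a)"
proof (rule holomorphic_onI)
  fix z :: complex assume "z \<in> ball 0 (1 / a)"
  then have "a * norm z < 1" using assms by (simp add: field_simps)
  then show "test_fun \<kappa> a field_differentiable at z within ball 0 (1 / a)"
    using test_fun_has_deriv[of a z \<kappa>] assms field_differentiable_at_within field_differentiable_def by (metis less_imp_le)
qed

lemma test_fun_holomorphic_disc:
  assumes "0 < a" "a < 1" shows "test_fun \<kappa> a holomorphic_on ball 0 1"
  using assms by (intro holomorphic_on_subset[OF test_fun_holomorphic] subset_ball) auto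

lemma test_fun_of_real:
  assumes "0 \<le> a * t" "a * t < 1"
  shows "test_fun \<kappa> a (of_real t) = of_real ((1 - a) * (1 - a * t) powr (- (\<kappa> + 1)))"
proof -
  have "(1 - of_real a * of_real t) powr (- of_real (\<kappa> + 1)) = complex_of_real (1 - a * t) powr of_real (- (\<kappa> + 1))"
    by simp
  also have "\<dots> = of_real ((1 - a * t) powr (- (\<kappa> + 1)))"
    by (rule powr_of_real) (use assms in auto)
  finally show ?thesis by (simp add: test_fun_def)
qed

text \<open>With 1 - a of size 2^(-i), the \<open>p\<close>-th power of the derivative on annulus
  \<open>k\<close> is at most a constant times 2^(m (\<alpha> + 2 + p) - i p), m = min(i,k).
  Multiplied by 2^(-k (\<alpha> + 2)) for the mass of the annulus it decays away from k = i, at rate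
  \<open>p\<close> for k < i and at rate \<alpha> + 2 for k > i; \<open>c\<close> is the smaller
  rate.\<close>

lemma test_fun_bounded:
  assumes p: "p > 0" and \<alpha>: "\<alpha> > p - 1" and \<kappa>: "\<kappa> = (\<alpha> + 2 - p) / p"
  obtains M where "\<And>a. \<lbrakk>0 < a; a < 1\<rbrakk> \<Longrightarrow> in_dirichlet p \<alpha> (test_fun \<kappa> a) \<and> dirichlet_norm p \<alpha> (test_fun \<kappa> a) \<le> M"
proof -
  have \<alpha>1: "\<alpha> > -1" using p \<alpha> by simp
  have \<kappa>0: "\<kappa> > 0" using p \<alpha> \<kappa> by simp
  have \<kappa>p: "(\<kappa> + 2) * p = \<alpha> + 2 + p" using p by (simp add: \<kappa> field_simps)
  define c where "c = min p (\<alpha> + 2)"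
  have c: "c > 0" using p \<alpha>1 by (simp add: c_def)
  obtain D where D: "D > 0" "\<And>g v. \<lbrakk>\<forall>k. v k \<ge> 0; summable (\<lambda>k. v k * 2 powr (- real k * (\<alpha> + 2)));
      \<forall>z\<in>ball 0 1. \<forall>k. 2 powr (- real k) < norm (1 - z) \<longrightarrow> norm (1 - z) \<le> 2 powr (1 - real k) \<longrightarrow> g z \<le> ennreal (v k)\<rbrakk> \<Longrightarrow>
    (\<integral>\<^sup>+z. g z \<partial>disc_weight \<alpha>) \<le> ennreal (D * (\<Sum>k. v k * 2 powr (- real k * (\<alpha> + 2))))"
    by (rule disc_weight_dyadic[OF \<alpha>1]) (rule that, assumption+)
  define B where "B = (\<kappa> + 1) powr p * 2 powr (2 * (\<alpha> + 2 + p))"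
  have B: "B \<ge> 0" by (simp add: B_def)
  define J where "J = D * (B * (2 / (1 - 2 powr (- c))))"
  have "2 powr (- c) < (1 :: real)" using c by (simp add: powr_less_one)
  then have J: "J \<ge> 0" using D B by (simp add: J_def)
  show ?thesis
  proof (rule that[of "1 + ((\<alpha> + 1) * (J / pi)) powr (1 / p)"])
    fix a :: real assume a: "0 < a" "a < 1"
    obtain i where i: "a \<in> dyadic_block i" using dyadic_block_cover[of a] a by auto
    have ai: "1 - a \<le> 2 powr (- real i)" "2 powr (- real i) / 2 < 1 - a" using i by (auto simp: dyadic_block_mem)
    have hol: "test_fun \<kappa> a holomorphic_on ball 0 1" by (rule test_fun_holomorphic_disc[OF a])
    define v where "v k = B * decay c i k * 2 powr (real k * (\<alpha> + 2))" for k
    have vk: "v k * 2 powr (- real k * (\<alpha> + 2)) = B * decay c i k" for k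
    proof -
      have "2 powr (real k * (\<alpha> + 2)) * 2 powr (- real k * (\<alpha> + 2)) = (2::real) powr 0"
        by (simp only: powr_add[symmetric]) simp
      then show ?thesis by (simp add: v_def mult.assoc)
    qed
    have bound: "norm (deriv (test_fun \<kappa> a) z) powr p \<le> v k" if z: "z \<in> ball 0 1" and k: "2 powr (- real k) < norm (1 - z)" for z k
    proof -
      define m where "m = min (real i) (real k)"
      have "a * norm z \<le> 1 * norm z" using a by (intro mult_right_mono) auto
      then have az: "a * norm z < 1" using z by simp
      have "deriv (test_fun \<kappa> a) z = of_real ((1 - a) * (\<kappa> + 1) * a) * (1 - of_real a * z) powr (- of_real (\<kappa> + 2))"
        using test_fun_has_deriv[OF less_imp_le[OF a(1)] az] by (rule DERIV_imp_deriv)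
      then have "norm (deriv (test_fun \<kappa> a) z) = norm (complex_of_real ((1 - a) * (\<kappa> + 1) * a)) * norm ((1 - of_real a * z) powr (- of_real (\<kappa> + 2)))"
        by (simp only: norm_mult)
      also have "norm (complex_of_real ((1 - a) * (\<kappa> + 1) * a)) = (1 - a) * (\<kappa> + 1) * a"
        using a \<kappa>0 by (subst norm_of_real) simp
      also have "norm ((1 - of_real a * z) powr (- of_real (\<kappa> + 2))) = norm (1 - of_real a * z) powr (- (\<kappa> + 2))"
        by (subst norm_powr_real_powr') auto
      \<comment> \<open>The 2 in \<open>- m - 2\<close> collects one halving from the block bound on
        1 - a and one from \<open>norm_one_minus_mult_ge\<close>.\<close>
      also have "(1 - a) * (\<kappa> + 1) * a * norm (1 - of_real a * z) powr (- (\<kappa> + 2)) \<le> (2 powr (- real i) * (\<kappa> + 1) * 1) * (2 powr (- m - 2)) powr (- (\<kappa> + 2))"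
      proof (intro mult_mono powr_mono2')
        have "2 powr (- m) / 2 \<le> max (1 - a) (norm (1 - z))"
          using ai k by (cases "i \<le> k") (auto simp: m_def min_def max_def)
        then have "2 powr (- m) / 2 / 2 \<le> max (1 - a) (norm (1 - z)) / 2" by (rule divide_right_mono) simp
        also have "\<dots> \<le> norm (1 - of_real a * z)"
          by (rule norm_one_minus_mult_ge) (use a z in auto)
        finally have "2 powr (- m) / 2 / 2 \<le> norm (1 - of_real a * z)" .
        then show "2 powr (- m - 2) \<le> norm (1 - of_real a * z)" by (simp add: powr_diff)
      qed (use a ai \<kappa>0 in auto)
      also have "(2 powr (- m - 2)) powr (- (\<kappa> + 2)) = (2::real) powr ((m + 2) * (\<kappa> + 2))"
        by (simp add: powr_powr algebra_simps)
      finally have "norm (deriv (test_fun \<kappa> a) z) powr p \<le> (2 powr (- real i) * (\<kappa> + 1) * 1 * 2 powr ((m + 2) * (\<kappa> + 2))) powr p"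
        using p by (intro powr_mono2) auto
      also have "\<dots> = (\<kappa> + 1) powr p * (2 powr (- real i * p) * 2 powr ((m + 2) * ((\<kappa> + 2) * p)))"
        by (simp add: powr_mult powr_powr mult_ac)
      also have "2 powr (- real i * p) * 2 powr ((m + 2) * ((\<kappa> + 2) * p)) = 2 powr (2 * (\<alpha> + 2 + p)) * (2::real) powr (m * (\<alpha> + 2 + p) - real i * p)"
        unfolding \<kappa>p powr_add[symmetric] by (simp add: algebra_simps)
      finally have "norm (deriv (test_fun \<kappa> a) z) powr p \<le> B * 2 powr (m * (\<alpha> + 2 + p) - real i * p)"
        by (simp only: B_def mult.assoc)
      also have "\<dots> \<le> B * 2 powr (- c * \<bar>real k - real i\<bar> + real k * (\<alpha> + 2))"
      proof (rule mult_left_mono[OF powr_mono B])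
        show "m * (\<alpha> + 2 + p) - real i * p \<le> - c * \<bar>real k - real i\<bar> + real k * (\<alpha> + 2)"
        proof (cases "k \<le> i")
          case True
          have "c * (real i - real k) \<le> p * (real i - real k)" using True by (intro mult_right_mono) (auto simp: c_def)
          then show ?thesis using True by (simp add: m_def algebra_simps)
        next
          case False
          have "c * (real k - real i) \<le> (\<alpha> + 2) * (real k - real i)" using False by (intro mult_right_mono) (auto simp: c_def)
          then show ?thesis using False by (simp add: m_def algebra_simps)
        qed
      qed simp
      also have "\<dots> = v k" by (simp only: v_def decay_def powr_add mult.assoc)
      finally show ?thesis .
    qed
    have sm: "summable (\<lambda>k. B * decay c i k)" by (intro summable_mult decay_sum c)
    have "disc_energy p \<alpha> (deriv (test_fun \<kappa> a)) \<le> ennreal (D * (\<Sum>k. v k * 2 powr (- real k * (\<alpha> + 2))))"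
    proof (rule D(2))
      show "\<forall>k. v k \<ge> 0" using B by (simp add: v_def)
      show "summable (\<lambda>k. v k * 2 powr (- real k * (\<alpha> + 2)))" unfolding vk by (rule sm)
    qed (use bound in \<open>auto intro!: ennreal_leI\<close>)
    also have "\<dots> \<le> ennreal J"
    proof (rule ennreal_leI)
      have "(\<Sum>k. v k * 2 powr (- real k * (\<alpha> + 2))) = B * (\<Sum>k. decay c i k)"
        unfolding vk by (intro suminf_mult decay_sum c)
      also have "\<dots> \<le> B * (2 / (1 - 2 powr (- c)))" by (intro mult_left_mono decay_sum c B)
      finally show "D * (\<Sum>k. v k * 2 powr (- real k * (\<alpha> + 2))) \<le> J"
        unfolding J_def using D by (intro mult_left_mono) auto
    qed
    finally have J1: "disc_energy p \<alpha> (deriv (test_fun \<kappa> a)) \<le> ennreal J" .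
    have "test_fun \<kappa> a 0 = of_real (1 - a)" by (simp add: test_fun_def)
    then have "norm (test_fun \<kappa> a 0) \<le> 1" using a by (simp only: norm_of_real)
    with dirichlet_norm_leI[OF hol J1 J p \<alpha>1]
    show "in_dirichlet p \<alpha> (test_fun \<kappa> a) \<and> dirichlet_norm p \<alpha> (test_fun \<kappa> a) \<le> 1 + ((\<alpha> + 1) * (J / pi)) powr (1 / p)"
      by auto
  qed
qed

context measure_01 begin

text \<open>The Taylor series converges absolutely at 1, inside the disc of radius 1/a, and the
  moments are at most the total mass. In the converse direction no Carleson bound at the critical
  exponent is at hand, so \<open>dirichlet_summable\<close> does not apply.\<close>

lemma test_fun_summable:
  assumes a: "0 < a" "a < 1"
  shows "summable (\<lambda>k. norm (taylor_coeff (test_fun \<kappa> a) k) * (\<integral>t. t ^ k \<partial>\<mu>))"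
proof -
  define \<rho> where "\<rho> = (1 + 1 / a) / 2"
  have \<rho>: "1 < \<rho>" "\<rho> < 1 / a" using a by (auto simp: \<rho>_def field_simps)
  have "(\<lambda>k. taylor_coeff (test_fun \<kappa> a) k * of_real \<rho> ^ k) sums test_fun \<kappa> a (of_real \<rho>)"
    using holomorphic_power_series[OF test_fun_holomorphic[OF a(1)], of "of_real \<rho>"] \<rho>
    by (simp add: taylor_coeff_def)
  then have "summable (\<lambda>k. norm (taylor_coeff (test_fun \<kappa> a) k * 1 ^ k))"
    by (intro powser_insidea[where x="of_real \<rho>"]) (use \<rho> in \<open>auto simp: sums_iff\<close>)
  then have sm: "summable (\<lambda>k. norm (taylor_coeff (test_fun \<kappa> a) k) * (\<integral>t. t ^ 0 \<partial>\<mu>))"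
    by (intro summable_mult2) simp
  show ?thesis
    by (rule summable_comparison_test'[OF sm, of 0])
       (use moment_antimono[of _ 0] moment_nonneg in \<open>auto simp: abs_mult intro!: mult_left_mono\<close>)
qed

text \<open>At the real point \<open>a\<close> the integrand is non-negative on [0,1), so nothing
  cancels and the integral may be restricted to [a,1).\<close>

lemma Hankel_test_fun_lower:
  assumes b: "b > 0" and \<kappa>: "\<kappa> > 0" and a: "1 / 2 \<le> a" "a < 1"
  shows "b / 2 * 2 powr (- (\<kappa> + b + 2)) * (1 - a) powr (- (\<kappa> + b + 1)) * measure \<mu> {a..<1}
    \<le> norm (deriv (Hankel \<mu> b (test_fun \<kappa> a)) (of_real a))"
proof -
  have a0: "0 < a" using a by simp
  note hol = test_fun_holomorphic_disc[OF a0 a(2)]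
  note sm = test_fun_summable[OF a0 a(2)]
  have na: "norm (complex_of_real a) < 1" using a by simp
  let ?f = "\<lambda>t. of_real t * radial (test_fun \<kappa> a) t * (1 - of_real t * of_real a) powr (- complex_of_real (b + 1))"
  define k where "k t = indicator {0..<1} t * (t * ((1 - a) * (1 - a * t) powr (- (\<kappa> + 1))) * (1 - a * t) powr (- (b + 1)))" for t :: real
  have fk: "?f t = of_real (k t)" if t: "t \<in> {0..<1}" for t
  proof -
    have "a * t \<le> 1 * t" using t a by (intro mult_right_mono) auto
    then have at: "0 \<le> a * t" "a * t < 1" using t a by auto
    have "(1 - of_real t * of_real a) powr (- complex_of_real (b + 1)) = complex_of_real (1 - a * t) powr of_real (- (b + 1))"
      by (simp add: mult.commute)
    also have "\<dots> = of_real ((1 - a * t) powr (- (b + 1)))"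
      by (rule powr_of_real) (use at in auto)
    finally show ?thesis using t test_fun_of_real[OF at, of \<kappa>] by (simp add: k_def)
  qed
  have AEk: "AE t in \<mu>. ?f t = of_real (k t)" using fk by (intro AE_01I)
  have mk [measurable]: "k \<in> borel_measurable borel" unfolding k_def[abs_def] by measurable
  have "integrable \<mu> (\<lambda>t. complex_of_real (k t))"
    using integrable_cong_AE[THEN iffD1, OF _ _ AEk deriv_Hankel(1)[OF b hol sm na]] deriv_Hankel(1)[OF b hol sm na]
    by auto
  then have ik: "integrable \<mu> k" by (simp only: complex_of_real_integrable_eq)
  have "deriv (Hankel \<mu> b (test_fun \<kappa> a)) (of_real a) = of_real b * (\<integral>t. ?f t \<partial>\<mu>)"
    by (rule deriv_Hankel(2)[OF b hol sm na])
  also have "(\<integral>t. ?f t \<partial>\<mu>) = (\<integral>t. complex_of_real (k t) \<partial>\<mu>)"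
    by (rule integral_cong_AE[OF _ _ AEk]) (use deriv_Hankel(1)[OF b hol sm na] in auto)
  also have "\<dots> = of_real (\<integral>t. k t \<partial>\<mu>)" by (rule integral_complex_of_real)
  finally have eq: "norm (deriv (Hankel \<mu> b (test_fun \<kappa> a)) (of_real a)) = b * \<bar>\<integral>t. k t \<partial>\<mu>\<bar>"
    using b by (simp add: norm_mult)
  \<comment> \<open>The factor 1/2 bounds \<open>t\<close> from below; the power of 2 comes from 1 -
    a t \<le> 1 - a^2 \<le> 2 (1 - a); the exponent is (\<kappa> + 1) + (b + 1), lowered by 1
    through the factor 1 - a of the test function.\<close>
  define L where "L = 1 / 2 * 2 powr (- (\<kappa> + b + 2)) * (1 - a) powr (- (\<kappa> + b + 1))"
  have "L * measure \<mu> {a..<1} = (\<integral>t. L * indicator {a..<1} t \<partial>\<mu>)" by simp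
  also have "\<dots> \<le> (\<integral>t. k t \<partial>\<mu>)"
  proof (rule integral_mono_AE[OF _ ik], goal_cases)
    case 2
    show ?case
    proof (rule AE_01I)
      fix t :: real assume t: "t \<in> {0..<1}"
      show "L * indicator {a..<1} t \<le> k t"
      proof (cases "t \<in> {a..<1}")
        case True
        have "a * a \<le> a * t" using True a0 by (intro mult_left_mono) auto
        moreover have "0 \<le> (1 - a) * (1 - a)" by simp
        ultimately have le: "1 - a * t \<le> 2 * (1 - a)" by (simp add: algebra_simps)
        have "a * t < 1 * 1" using True a by (intro mult_strict_mono) auto
        then have pos: "0 < 1 - a * t" by simp
        have "L = 1 / 2 * ((1 - a) * (2 * (1 - a)) powr (- (\<kappa> + b + 2)))"
        proof -
          have "(1 - a) powr (- (\<kappa> + b + 1)) = (1 - a) powr 1 * (1 - a) powr (- (\<kappa> + b + 2))"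
            unfolding powr_add[symmetric] by (simp add: algebra_simps)
          moreover have "(1 - a) powr 1 = 1 - a" using a by simp
          ultimately have eq: "(1 - a) powr (- (\<kappa> + b + 1)) = (1 - a) * (1 - a) powr (- (\<kappa> + b + 2))"
            by (simp only:)
          show ?thesis unfolding L_def eq powr_mult[of 2 "1 - a"] by (simp only: mult_ac)
        qed
        also have "\<dots> \<le> t * ((1 - a) * (1 - a * t) powr (- (\<kappa> + b + 2)))"
          using True a le pos b \<kappa> by (intro mult_mono mult_left_mono powr_mono2') auto
        also have "(1 - a * t) powr (- (\<kappa> + b + 2)) = (1 - a * t) powr (- (\<kappa> + 1)) * (1 - a * t) powr (- (b + 1))"
          unfolding powr_add[symmetric] by (rule arg_cong[where f="\<lambda>e. (1 - a * t) powr e"]) simp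
        finally show ?thesis using True t by (simp add: k_def mult_ac)
      next
        case False
        then show ?thesis using t a by (simp add: k_def)
      qed
    qed
  qed (auto intro!: integrable_mult_right integrable_bounded[where B=1] simp: indicator_def)
  finally have "b * (L * measure \<mu> {a..<1}) \<le> b * \<bar>\<integral>t. k t \<partial>\<mu>\<bar>" using b by (intro mult_left_mono) auto
  then show ?thesis unfolding eq L_def by (simp add: mult_ac)
qed

text \<open>The evaluation points move with \<open>j\<close>, so two facts are combined: weighted
  point evaluation of the derivative is bounded uniformly in the point, which handles the difference
  from the limit \<open>g\<close>, and for the single function \<open>g\<close> the weighted values
  tend to 0.\<close>

lemma vanishing_if_Hankel_compact:
  assumes p: "p > 0" and q: "q > 1" and \<alpha>: "\<alpha> > p - 1"
    and comp: "Hankel_compact \<mu> (\<alpha> + 1 - p) p \<alpha> q (\<alpha> - p)"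
  shows "vanishing_carleson \<mu> ((\<alpha> + 2 - p) / p + (\<alpha> + 2 - p) * (1 - 1 / q))"
proof (rule ccontr)
  define b where "b = \<alpha> + 1 - p"
  have b: "b > 0" and \<alpha>b: "\<alpha> - p = b - 1" "\<alpha> + 2 - p = b + 1" using \<alpha> by (auto simp: b_def)
  define \<kappa> where "\<kappa> = (b + 1) / p"
  have \<kappa>: "\<kappa> > 0" using b p by (simp add: \<kappa>_def)
  have q0: "q > 0" and b1: "b - 1 > -1" using q b by auto
  define s where "s = \<kappa> + (b + 1) * (1 - 1 / q)"
  assume "\<not> vanishing_carleson \<mu> ((\<alpha> + 2 - p) / p + (\<alpha> + 2 - p) * (1 - 1 / q))"
  then have "\<not> vanishing_carleson \<mu> s" by (simp add: s_def \<kappa>_def \<alpha>b)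
  then obtain \<epsilon> where \<epsilon>: "\<epsilon> > 0" "\<And>\<delta>. \<delta> > 0 \<Longrightarrow> \<exists>t. 1 - \<delta> < t \<and> t < 1 \<and> \<not> emeasure \<mu> {t..<1} \<le> ennreal (\<epsilon> * (1 - t) powr s)"
    unfolding vanishing_carleson_def by blast
  \<comment> \<open>The shift by 2 ensures \<open>1 / 2 \<le> A j\<close>, as
    \<open>Hankel_test_fun_lower\<close> demands.\<close>
  have "\<exists>t. 1 - 1 / (real j + 2) < t \<and> t < 1 \<and> \<not> emeasure \<mu> {t..<1} \<le> ennreal (\<epsilon> * (1 - t) powr s)" for j
    by (rule \<epsilon>(2)) simp
  then obtain A where A: "\<And>j. 1 - 1 / (real j + 2) < A j" "\<And>j. A j < 1"
    "\<And>j. \<not> emeasure \<mu> {A j..<1} \<le> ennreal (\<epsilon> * (1 - A j) powr s)" by metis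
  have Ahalf: "1 / 2 \<le> A j" for j
  proof -
    have "1 / (real j + 2) \<le> 1 / 2" by (intro divide_left_mono) auto
    then show ?thesis using A(1)[of j] by linarith
  qed
  have A0: "0 < A j" for j using Ahalf[of j] by linarith
  have Alim: "A \<longlonglongrightarrow> 1"
  proof (rule tendsto_sandwich[of "\<lambda>j. 1 - 1 / (real j + 2)" _ _ "\<lambda>_. 1"])
    have "(\<lambda>j. 1 - inverse (real (Suc (Suc j)))) \<longlonglongrightarrow> 1 - 0"
      by (intro tendsto_intros LIMSEQ_Suc[OF LIMSEQ_inverse_real_of_nat])
    then show "(\<lambda>j. 1 - 1 / (real j + 2)) \<longlonglongrightarrow> 1" by (simp add: inverse_eq_divide add.commute)
  qed (use A(1,2) in \<open>auto intro!: always_eventually less_imp_le\<close>)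
  have mA: "\<epsilon> * (1 - A j) powr s \<le> measure \<mu> {A j..<1}" for j
    using A(3)[of j] \<epsilon>(1) by (simp add: emeasure_eq_measure not_le)
  have \<kappa>': "\<kappa> = (\<alpha> + 2 - p) / p" by (simp add: \<kappa>_def \<alpha>b)
  obtain M where M: "\<And>a. \<lbrakk>0 < a; a < 1\<rbrakk> \<Longrightarrow> in_dirichlet p \<alpha> (test_fun \<kappa> a) \<and> dirichlet_norm p \<alpha> (test_fun \<kappa> a) \<le> M"
    by (rule test_fun_bounded[OF p \<alpha> \<kappa>']) (rule that, assumption+)
  define F where "F j = test_fun \<kappa> (A j)" for j
  have "\<forall>j. in_dirichlet p \<alpha> (F j) \<and> dirichlet_norm p \<alpha> (F j) \<le> M"
    unfolding F_def using M A0 A(2) by blast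
  then obtain r g where r: "strict_mono r" and g: "in_dirichlet q (b - 1) g"
    and lim: "(\<lambda>j. dirichlet_norm q (b - 1) (\<lambda>z. Hankel \<mu> b (F (r j)) z - g z)) \<longlonglongrightarrow> 0"
    using comp unfolding Hankel_compact_def \<alpha>b b_def[symmetric] by blast
  have HF: "in_dirichlet q (b - 1) (Hankel \<mu> b (F j))" for j
    using comp M A0 A(2) unfolding Hankel_compact_def \<alpha>b b_def[symmetric] F_def by blast
  note ghol = in_dirichlet_deriv(1,2)[OF g]
  note Hhol = in_dirichlet_deriv(1,2)[OF HF]
  define u where "u j z = deriv (Hankel \<mu> b (F (r j))) z - deriv g z" for j z
  have uhol: "u j holomorphic_on ball 0 1" for j
    unfolding u_def by (intro holomorphic_intros Hhol(2) ghol(2))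
  define a where "a j = A (r j)" for j
  have a: "\<And>j. 1 / 2 \<le> a j" "\<And>j. 0 < a j" "\<And>j. a j < 1" "a \<longlonglongrightarrow> 1"
    using Ahalf A0 A(2) LIMSEQ_subseq_LIMSEQ[OF Alim r] by (auto simp: a_def[abs_def] o_def)
  define T where "T j = dirichlet_norm q (b - 1) (\<lambda>z. Hankel \<mu> b (F (r j)) z - g z)" for j
  have T0: "T j \<ge> 0" for j by (simp add: T_def dirichlet_norm_def bergman_norm_def)
  have Ilow: "disc_energy q (b - 1) (u j) \<le> ennreal (pi * T j powr q / b)" for j
  proof -
    let ?d = "\<lambda>z. Hankel \<mu> b (F (r j)) z - g z"
    have eq: "disc_energy q (b - 1) (deriv ?d) = disc_energy q (b - 1) (u j)"
      unfolding u_def by (intro nn_integral_cong) (simp add: deriv_diff_disc[OF Hhol(1) ghol(1)])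
    \<comment> \<open>Membership of the difference has to come first: \<open>bergman_norm\<close>
      sends an infinite integral to 0, so a small norm alone would say nothing about the
      energy.\<close>
    have "disc_energy q (b - 1) (u j) \<le> ennreal (2 powr q) * ((disc_energy q (b - 1) (deriv (Hankel \<mu> b (F (r j))))) + disc_energy q (b - 1) (deriv g))"
      unfolding u_def by (rule nn_integral_powr_diff_le[OF q0 Hhol(2) ghol(2)])
    also have "\<dots> < \<infinity>"
      using in_dirichlet_deriv(3)[OF HF] in_dirichlet_deriv(3)[OF g] by (simp add: ennreal_mult_less_top)
    finally have "in_dirichlet q (b - 1) ?d"
      by (intro in_dirichletI holomorphic_intros Hhol(1) ghol(1)) (simp only: eq)
    from dirichlet_norm_le_imp(2)[OF this order_refl q0 b1] show ?thesis by (simp add: eq T_def)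
  qed
  obtain D where D: "D > 0" "\<And>g z. \<lbrakk>g holomorphic_on ball 0 1; z \<in> ball 0 1\<rbrakk> \<Longrightarrow>
    ennreal (norm (g z) powr q * (1 - norm z) powr (b - 1 + 2)) \<le>
      ennreal D * (\<integral>\<^sup>+\<zeta>. indicator (ball z ((1 - norm z) / 2)) \<zeta> * ennreal (norm (g \<zeta>) powr q) \<partial>disc_weight (b - 1))"
    by (rule pointwise_bound[OF q0]) (rule that, assumption+)
  define K where "K = (D * pi / b) powr (1 / q)"
  have ua: "norm (u j (of_real (a j))) * (1 - a j) powr ((b - 1 + 2) / q) \<le> K * T j" for j
  proof -
    have na: "norm (complex_of_real (a j)) = a j" using a(2)[of j] by simp
    then have "ennreal (norm (u j (of_real (a j))) powr q * (1 - a j) powr (b - 1 + 2)) \<le>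
      ennreal D * (\<integral>\<^sup>+\<zeta>. indicator (ball (of_real (a j)) ((1 - a j) / 2)) \<zeta> * ennreal (norm (u j \<zeta>) powr q) \<partial>disc_weight (b - 1))"
      using D(2)[OF uhol, of "of_real (a j)" j] a(3)[of j] by simp
    also have "\<dots> \<le> ennreal D * disc_energy q (b - 1) (u j)"
      by (intro mult_left_mono nn_integral_mono) (auto simp: indicator_def)
    also have "\<dots> \<le> ennreal D * ennreal (pi * T j powr q / b)"
      by (intro mult_left_mono Ilow) auto
    finally have "norm (u j (of_real (a j))) powr q * (1 - a j) powr (b - 1 + 2) \<le> D * (pi * T j powr q / b)"
      using D b by (simp add: ennreal_mult'[symmetric])
    then have "(norm (u j (of_real (a j))) powr q * (1 - a j) powr (b - 1 + 2)) powr (1 / q) \<le> ((D * pi / b) * T j powr q) powr (1 / q)"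
      using q0 by (intro powr_mono2) auto
    moreover have "((D * pi / b) * T j powr q) powr (1 / q) = K * T j"
      unfolding powr_mult K_def using q0 T0[of j] by (simp add: powr_powr)
    moreover have "(norm (u j (of_real (a j))) powr q * (1 - a j) powr (b - 1 + 2)) powr (1 / q) =
        norm (u j (of_real (a j))) * (1 - a j) powr ((b - 1 + 2) / q)"
      unfolding powr_mult using q0 by (simp add: powr_powr)
    ultimately show ?thesis by (simp only:)
  qed
  define c where "c = b / 2 * 2 powr (- (\<kappa> + b + 2)) * \<epsilon>"
  have c: "c > 0" using b \<epsilon> by (simp add: c_def)
  have low: "c \<le> norm (deriv (Hankel \<mu> b (F (r j))) (of_real (a j))) * (1 - a j) powr ((b - 1 + 2) / q)" for j
  proof -
    have "c = b / 2 * 2 powr (- (\<kappa> + b + 2)) * (1 - a j) powr (- (\<kappa> + b + 1)) * (\<epsilon> * (1 - a j) powr s) * (1 - a j) powr ((b - 1 + 2) / q)"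
    proof -
      \<comment> \<open>The growth of the image of the test function, the exponent \<open>s\<close>
        and the weight of point evaluation balance exactly.\<close>
      have "- (\<kappa> + b + 1) + s + (b - 1 + 2) / q = 0"
        by (simp add: s_def algebra_simps add_divide_distrib)
      then have "(1 - a j) powr (- (\<kappa> + b + 1)) * (1 - a j) powr s * (1 - a j) powr ((b - 1 + 2) / q) = 1"
        using a(3)[of j] by (simp only: powr_add[symmetric]) simp
      moreover have "X * P * (\<epsilon> * Q) * Y = X * \<epsilon> * (P * Q * Y)" for X P Q Y :: real
        by (simp only: mult_ac)
      ultimately show ?thesis unfolding c_def by simp
    qed
    also have "\<dots> \<le> b / 2 * 2 powr (- (\<kappa> + b + 2)) * (1 - a j) powr (- (\<kappa> + b + 1)) * measure \<mu> {a j..<1} * (1 - a j) powr ((b - 1 + 2) / q)"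
      using mA[of "r j"] b unfolding a_def by (intro mult_right_mono mult_left_mono) auto
    also have "\<dots> \<le> norm (deriv (Hankel \<mu> b (F (r j))) (of_real (a j))) * (1 - a j) powr ((b - 1 + 2) / q)"
      unfolding F_def a_def[symmetric]
      by (intro mult_right_mono Hankel_test_fun_lower b \<kappa> a) auto
    finally show ?thesis .
  qed
  have "(\<lambda>j. K * T j + norm (deriv g (of_real (a j))) * (1 - a j) powr ((b - 1 + 2) / q)) \<longlonglongrightarrow> K * 0 + 0"
    using lim unfolding T_def[symmetric]
    by (intro tendsto_intros weighted_point_eval_tendsto_0 q0 ghol(2) in_dirichlet_deriv(3)[OF g] a)
  moreover have "c \<le> K * T j + norm (deriv g (of_real (a j))) * (1 - a j) powr ((b - 1 + 2) / q)" for j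
  proof -
    have "norm (deriv (Hankel \<mu> b (F (r j))) (of_real (a j))) \<le> norm (u j (of_real (a j))) + norm (deriv g (of_real (a j)))"
      unfolding u_def by (metis add.commute norm_triangle_sub)
    then have "norm (deriv (Hankel \<mu> b (F (r j))) (of_real (a j))) * (1 - a j) powr ((b - 1 + 2) / q) \<le>
       (norm (u j (of_real (a j))) + norm (deriv g (of_real (a j)))) * (1 - a j) powr ((b - 1 + 2) / q)"
      by (intro mult_right_mono) auto
    then show ?thesis using low[of j] ua[of j] by (simp only: distrib_right)
  qed
  ultimately have "c \<le> K * 0 + 0"
    by (intro tendsto_lowerbound[where f="\<lambda>j. K * T j + norm (deriv g (of_real (a j))) * (1 - a j) powr ((b - 1 + 2) / q)"]) auto
  then show False using c by simp
qed

end

theorem theorem5p03: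
  fixes \<mu> :: "real measure" and p q \<alpha> :: real
  assumes "q > 1" and "0 < p" and "p \<le> q" and "\<alpha> > p - 1"
    and "measure_on_01 \<mu>" and "cond_W \<mu> p \<alpha>"
  shows "Hankel_compact \<mu> (\<alpha> + 1 - p) p \<alpha> q (\<alpha> - p) \<longleftrightarrow>
         vanishing_carleson \<mu> ((\<alpha> + 2 - p) / p + (\<alpha> + 2 - p) / (q / (q - 1)))"
proof -
  interpret measure_01 \<mu>
    by (rule measure_01I[OF assms(5) cond_W_finite[OF assms(6)]])
  have "(\<alpha> + 2 - p) / (q / (q - 1)) = (\<alpha> + 2 - p) * (1 - 1 / q)"
    using assms(1) by (simp add: field_simps)
  then show ?thesis
    using Hankel_compact_if_vanishing[OF assms(2,1,3,4)] vanishing_if_Hankel_compact[OF assms(2,1,4)] by auto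
qed

end
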